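(* Let $\lambda$ be a partition of $n$ that is neither hook-shaped nor self-transpose, and let $N=|\mathrm{SYT}(\lambda)|$. Then the image of the cactus group $C_n$ in the permutation group $S_N$ of the set $\mathrm{SYT}(\lambda)$ is either all of $S_N$ or the alternating group $A_N$.
   Context: A partition $\lambda$ of $n$ is identified with its Young diagram (boxes $(i,j)$, row $i$, column $j$). A standard Young tableau of shape $\lambda$ is a filling of the boxes by $1,\dots,n$, each used once, increasing along rows and down columns; $\mathrm{SYT}(\lambda)$ is the set of these. $\lambda$ is hook-shaped if its diagram does not contain the box $(2,2)$, and self-transpose if it equals its transpose. The cactus group $C_n$ is generated by $s_{[i,j]}$ ($1\le i<j\le n$) with relations $s_{[i,j]}^2=1$; $s_{[i,j]}s_{[k,l]}=s_{[k,l]}s_{[i,j]}$ if $[i,j]\cap[k,l]=\emptyset$; $s_{[i,j]}s_{[k,l]}s_{[i,j]}=s_{[i+j-l,i+j-k]}$ if $[k,l]\subseteq[i,j]$. It acts on $\mathrm{SYT}(\lambda)$ with $s_{[1,j]}$ acting as the Schützenberger involution (evacuation) of the subtableau of entries $1,\dots,j$; the image of $C_n$ in the permutations of $\mathrm{SYT}(\lambda)$ equals the group generated by the Bender–Knuth involutions $t_1,\dots,t_{n-1}$ ($t_i$ swaps $i$ and $i+1$ if the result is standard, and is the identity otherwise). *)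

theory Defs
  imports
    "HOL-Algebra.Group_Action"
    "HOL-Combinatorics.Permutations"
begin

section \<open>Partitions and standard Young tableaux\<close>

definition partition_of :: "nat \<Rightarrow> nat list \<Rightarrow> bool" where
  "partition_of n lam \<longleftrightarrow> sorted_wrt (\<ge>) lam \<and> 0 \<notin> set lam \<and> sum_list lam = n"

type_synonym box = "nat \<times> nat"

text \<open>Boxes are (row, column), both counted from 1.\<close>

definition diagram :: "nat list \<Rightarrow> box set" where
  "diagram lam = {(i, j). 1 \<le> i \<and> i \<le> length lam \<and> 1 \<le> j \<and> j \<le> lam ! (i - 1)}"

definition hook_shaped :: "nat list \<Rightarrow> bool" where
  "hook_shaped lam \<longleftrightarrow> (2, 2) \<notin> diagram lam"

definition self_transpose :: "nat list \<Rightarrow> bool" where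
  "self_transpose lam \<longleftrightarrow> prod.swap ` diagram lam = diagram lam"

text \<open>
  A filling assigns a number to every box of the quarter plane; the value 0 marks a box that is
  not occupied. Hence a tableau is determined by its filling, and the subtableau of the
  entries \<open>1, \<dots>, j\<close> is again a filling.
\<close>

type_synonym filling = "box \<Rightarrow> nat"

definition SYT :: "nat list \<Rightarrow> filling set" where
  "SYT lam = {T.
     (\<forall>b. b \<notin> diagram lam \<longrightarrow> T b = 0) \<and>
     bij_betw T (diagram lam) {1..sum_list lam} \<and>
     (\<forall>i j j'. (i, j) \<in> diagram lam \<and> (i, j') \<in> diagram lam \<and> j < j' \<longrightarrow> T (i, j) < T (i, j')) \<and>
     (\<forall>i i' j. (i, j) \<in> diagram lam \<and> (i', j) \<in> diagram lam \<and> i < i' \<longrightarrow> T (i, j) < T (i', j))}"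

section \<open>The Schuetzenberger involution\<close>

text \<open>
  Jeu de taquin: the hole at \<open>b\<close> moves to the right or lower neighbour, whichever is occupied
  by the smaller entry; it stays at \<open>b\<close> if neither neighbour is occupied.
\<close>

definition slide_next :: "filling \<Rightarrow> box \<Rightarrow> box" where
  "slide_next T b =
     (let r = (fst b, Suc (snd b)); d = (Suc (fst b), snd b) in
      if T r = 0 \<and> T d = 0 then b
      else if T d = 0 \<or> (T r \<noteq> 0 \<and> T r < T d) then r
      else d)"

definition slide_path :: "filling \<Rightarrow> box set" where
  "slide_path T = range (\<lambda>k. (slide_next T ^^ k) (1, 1))"

text \<open>
  Delete the entry of the corner box \<open>(1, 1)\<close> and slide. The last box of the path becomes
  empty; the other entries are not renumbered.
\<close>

definition slide :: "filling \<Rightarrow> filling" where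
  "slide T = (\<lambda>b. if b \<in> slide_path T
                  then (if slide_next T b = b then 0 else T (slide_next T b))
                  else T b)"

text \<open>
  Evacuation of a filling with \<open>m\<close> occupied boxes: the box vacated by the first slide receives
  \<open>m\<close>, the one vacated by the second slide receives \<open>m - 1\<close>, and so on.
\<close>

primrec evac :: "nat \<Rightarrow> filling \<Rightarrow> filling" where
  "evac 0 T = (\<lambda>b. 0)"
| "evac (Suc m) T = (\<lambda>b. if T b \<noteq> 0 \<and> slide T b = 0 then Suc m else evac m (slide T) b)"

definition evac_upto :: "nat \<Rightarrow> filling \<Rightarrow> filling" where
  "evac_upto j T =
     (\<lambda>b. if T b \<le> j then evac j (\<lambda>c. if T c \<le> j then T c else 0) b else T b)"

section \<open>Groups given by generators and relations\<close>

text \<open>The letter \<open>(True, x)\<close> is the generator \<open>x\<close>, the letter \<open>(False, x)\<close> its formal inverse.\<close>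

type_synonym 'x gword = "(bool \<times> 'x) list"

definition gwords :: "'x set \<Rightarrow> 'x gword set" where
  "gwords X = lists (UNIV \<times> X)"

inductive pres_eq :: "'x set \<Rightarrow> ('x gword \<times> 'x gword) set \<Rightarrow> 'x gword \<Rightarrow> 'x gword \<Rightarrow> bool"
  for X R where
  pres_refl: "pres_eq X R u u"
| pres_sym: "pres_eq X R u v \<Longrightarrow> pres_eq X R v u"
| pres_trans: "pres_eq X R u v \<Longrightarrow> pres_eq X R v w \<Longrightarrow> pres_eq X R u w"
| pres_cancel: "x \<in> X \<Longrightarrow> pres_eq X R (u @ [(e, x), (\<not> e, x)] @ v) (u @ v)"
| pres_relation: "(r, s) \<in> R \<Longrightarrow> pres_eq X R (u @ r @ v) (u @ s @ v)"

definition pres_rel :: "'x set \<Rightarrow> ('x gword \<times> 'x gword) set \<Rightarrow> ('x gword \<times> 'x gword) set" where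
  "pres_rel X R = {(u, v). u \<in> gwords X \<and> v \<in> gwords X \<and> pres_eq X R u v}"

definition presented_group :: "'x set \<Rightarrow> ('x gword \<times> 'x gword) set \<Rightarrow> 'x gword set monoid" where
  "presented_group X R =
     \<lparr>carrier = gwords X // pres_rel X R,
      monoid.mult = (\<lambda>A B. pres_rel X R `` {u @ v |u v. u \<in> A \<and> v \<in> B}),
      one = pres_rel X R `` {[]}\<rparr>"

lemma pres_eq_append:
  assumes "pres_eq X R u u'" "pres_eq X R v v'"
  shows "pres_eq X R (u @ v) (u' @ v')"
proof -
  have l: "pres_eq X R (w @ u) (w @ u')" if "pres_eq X R u u'" for w u u'
    using that
  proof induction
    case (pres_cancel x u e v)
    then show ?case using pres_eq.pres_cancel[of x X R "w @ u" e v] by simp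
  next
    case (pres_relation r s u v)
    then show ?case using pres_eq.pres_relation[of r s R X "w @ u" v] by simp
  qed (blast intro: pres_refl pres_sym pres_trans)+
  have r: "pres_eq X R (u @ w) (u' @ w)" if "pres_eq X R u u'" for w u u'
    using that
  proof induction
    case (pres_cancel x u e v)
    then show ?case using pres_eq.pres_cancel[of x X R u e "v @ w"] by simp
  next
    case (pres_relation r s u v)
    then show ?case using pres_eq.pres_relation[of r s R X u "v @ w"] by simp
  qed (blast intro: pres_refl pres_sym pres_trans)+
  show ?thesis using l r assms by (blast intro: pres_trans)
qed

lemma equiv_pres_rel: "equiv (gwords X) (pres_rel X R)"
proof (rule equivI)
  show "pres_rel X R \<subseteq> gwords X \<times> gwords X" by (auto simp: pres_rel_def)
  show "refl_on (gwords X) (pres_rel X R)" by (simp add: pres_rel_def refl_on_def pres_refl)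
  show "sym (pres_rel X R)" by (rule symI) (simp add: pres_rel_def pres_sym)
  show "trans (pres_rel X R)" by (rule transI) (auto simp: pres_rel_def dest: pres_trans)
qed

lemma gwords_append: "u \<in> gwords X \<Longrightarrow> v \<in> gwords X \<Longrightarrow> u @ v \<in> gwords X"
  by (auto simp: gwords_def)

lemma presented_group_mult:
  assumes "u \<in> gwords X" "v \<in> gwords X"
  shows "(pres_rel X R `` {u}) \<otimes>\<^bsub>presented_group X R\<^esub> (pres_rel X R `` {v})
    = pres_rel X R `` {u @ v}"
proof -
  let ?r = "pres_rel X R"
  have c: "(u @ v, u' @ v') \<in> ?r" if "(u, u') \<in> ?r" "(v, v') \<in> ?r" for u' v'
    using that by (auto simp: pres_rel_def gwords_append pres_eq_append)
  have "(u, u) \<in> ?r" "(v, v) \<in> ?r"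
    using assms by (auto simp: pres_rel_def pres_refl)
  then have "?r `` {u @ v} \<subseteq> ?r `` {a @ b |a b. a \<in> ?r `` {u} \<and> b \<in> ?r `` {v}}"
    by blast
  moreover have "?r `` {a @ b |a b. a \<in> ?r `` {u} \<and> b \<in> ?r `` {v}} \<subseteq> ?r `` {u @ v}"
    using c equivE[OF equiv_pres_rel[of X R]] by (blast dest: transD)
  ultimately show ?thesis by (simp add: presented_group_def)
qed

lemma pres_eq_left_inverse:
  assumes "u \<in> gwords X"
  shows "pres_eq X R (rev (map (\<lambda>(e, x). (\<not> e, x)) u) @ u) []"
  using assms
proof (induction u)
  case (Cons a u)
  obtain e x where a: "a = (e, x)" by (cases a)
  let ?u = "rev (map (\<lambda>(e, x). (\<not> e, x)) u)"
  from Cons a have x: "x \<in> X" and u: "u \<in> gwords X" by (auto simp: gwords_def)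
  have "pres_eq X R (?u @ [(\<not> e, x), (\<not> \<not> e, x)] @ u) (?u @ u)"
    by (rule pres_cancel[OF x])
  then show ?case using Cons.IH[OF u] a by (auto intro: pres_trans)
qed (simp add: pres_refl)

lemma group_presented_group: "group (presented_group X R)"
proof -
  let ?G = "presented_group X R" and ?c = "\<lambda>u. pres_rel X R `` {u}"
  have carr: "A \<in> carrier ?G \<longleftrightarrow> (\<exists>u\<in>gwords X. A = ?c u)" for A
    by (auto simp: presented_group_def quotient_def)
  have one: "\<one>\<^bsub>?G\<^esub> = ?c []" by (simp add: presented_group_def)
  have nil: "[] \<in> gwords X" by (simp add: gwords_def)
  show ?thesis
  proof (rule groupI)
    fix A B assume "A \<in> carrier ?G" "B \<in> carrier ?G"
    then show "A \<otimes>\<^bsub>?G\<^esub> B \<in> carrier ?G"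
      by (auto simp: carr presented_group_mult intro: gwords_append)
  next
    show "\<one>\<^bsub>?G\<^esub> \<in> carrier ?G" using nil by (auto simp: carr one)
  next
    fix A B C assume "A \<in> carrier ?G" "B \<in> carrier ?G" "C \<in> carrier ?G"
    then show "A \<otimes>\<^bsub>?G\<^esub> B \<otimes>\<^bsub>?G\<^esub> C = A \<otimes>\<^bsub>?G\<^esub> (B \<otimes>\<^bsub>?G\<^esub> C)"
      by (auto simp: carr presented_group_mult gwords_append)
  next
    fix A assume "A \<in> carrier ?G"
    then show "\<one>\<^bsub>?G\<^esub> \<otimes>\<^bsub>?G\<^esub> A = A"
      using nil by (auto simp: carr one presented_group_mult)
  next
    fix A assume "A \<in> carrier ?G"
    then obtain u where u: "u \<in> gwords X" "A = ?c u" by (auto simp: carr)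
    let ?v = "rev (map (\<lambda>(e, x). (\<not> e, x)) u)"
    have v: "?v \<in> gwords X" using u by (auto simp: gwords_def)
    have "(?v @ u, []) \<in> pres_rel X R"
      using u v nil pres_eq_left_inverse[OF u(1)] by (simp add: pres_rel_def gwords_append)
    then have "?c ?v \<otimes>\<^bsub>?G\<^esub> A = \<one>\<^bsub>?G\<^esub>"
      using u v by (simp add: presented_group_mult one equiv_class_eq[OF equiv_pres_rel])
    then show "\<exists>B\<in>carrier ?G. B \<otimes>\<^bsub>?G\<^esub> A = \<one>\<^bsub>?G\<^esub>"
      using v carr by blast
  qed
qed

section \<open>The cactus group\<close>

text \<open>The pair \<open>(i, j)\<close> stands for the interval \<open>[i, j]\<close>.\<close>

definition intervals :: "nat \<Rightarrow> (nat \<times> nat) set" where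
  "intervals n = {(i, j). 1 \<le> i \<and> i < j \<and> j \<le> n}"

abbreviation sletter :: "nat \<Rightarrow> nat \<Rightarrow> bool \<times> nat \<times> nat" where
  "sletter i j \<equiv> (True, (i, j))"

definition cactus_relations :: "nat \<Rightarrow> ((nat \<times> nat) gword \<times> (nat \<times> nat) gword) set" where
  "cactus_relations n =
     {([sletter i j, sletter i j], []) |i j. (i, j) \<in> intervals n} \<union>
     {([sletter i j, sletter k l], [sletter k l, sletter i j]) |i j k l.
        (i, j) \<in> intervals n \<and> (k, l) \<in> intervals n \<and> {i..j} \<inter> {k..l} = {}} \<union>
     {([sletter i j, sletter k l, sletter i j], [sletter (i + j - l) (i + j - k)]) |i j k l.
        (i, j) \<in> intervals n \<and> (k, l) \<in> intervals n \<and> {k..l} \<subseteq> {i..j}}"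

definition cactus_group :: "nat \<Rightarrow> (nat \<times> nat) gword set monoid" where
  "cactus_group n = presented_group (intervals n) (cactus_relations n)"

definition cactus_gen :: "nat \<Rightarrow> nat \<Rightarrow> nat \<Rightarrow> (nat \<times> nat) gword set" where
  "cactus_gen n i j = pres_rel (intervals n) (cactus_relations n) `` {[sletter i j]}"

text \<open>
  An action of the cactus group is determined by the action of the generators \<open>s\<^bsub>[1,j]\<^esub>\<close>, since
  \<open>s\<^bsub>[i,j]\<^esub> = s\<^bsub>[1,j]\<^esub> s\<^bsub>[1,j-i+1]\<^esub> s\<^bsub>[1,j]\<^esub>\<close>. So at most one homomorphism \<open>\<phi>\<close> satisfies the
  following (on the carrier); that one exists is the classical fact that the cactus group acts
  on standard Young tableaux by partial Schuetzenberger involutions.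
\<close>

definition schuetzenberger_action ::
  "nat \<Rightarrow> nat list \<Rightarrow> ((nat \<times> nat) gword set \<Rightarrow> filling \<Rightarrow> filling) \<Rightarrow> bool" where
  "schuetzenberger_action n lam \<phi> \<longleftrightarrow>
     group_action (cactus_group n) (SYT lam) \<phi> \<and>
     (\<forall>j T. 1 < j \<and> j \<le> n \<and> T \<in> SYT lam \<longrightarrow> \<phi> (cactus_gen n 1 j) T = evac_upto j T)"

section \<open>The alternating group of a set\<close>

text \<open>
  Elements of \<^term>\<open>Bij S\<close> are undefined outside \<open>S\<close>, whereas \<^const>\<open>evenperm\<close> expects a
  permutation of the whole type.
\<close>

definition Alt :: "'a set \<Rightarrow> ('a \<Rightarrow> 'a) set" where
  "Alt S = {f \<in> Bij S. evenperm (\<lambda>x. if x \<in> S then f x else x)}"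

end

theory Submission
  imports Defs
begin

text \<open>
  Evacuation of the entries \<open>1, \<dots>, j\<close> is a product of Bender--Knuth involutions, and these
  products generate the same group as the involutions \<open>t\<^sub>1, \<dots>, t\<^bsub>n-1\<^esub>\<close> themselves. So it suffices to
  find all 3-cycles in the group generated by the involutions.

  Call a shape good if it is neither a hook nor self-transpose. By induction on the number \<open>m\<close> of
  boxes, for every good shape all 3-cycles of its tableaux are realised by words in
  \<open>t\<^sub>1, \<dots>, t\<^bsub>m-1\<^esub>\<close> that fix all tableaux of all other shapes with \<open>m\<close> boxes, apart from the transpose.
  A good shape \<open>\<lambda>\<close> with more than five boxes has a corner \<open>c\<close> such that \<open>\<mu> = \<lambda> - c\<close> is good, and the
  induction hypothesis for \<open>\<mu>\<close> gives 3-cycles on the tableaux of \<open>\<lambda>\<close> with last entry in \<open>c\<close>. Lying in a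
  common 3-cycle is an equivalence relation invariant under the group, and the tableaux with last
  entry in \<open>c\<close> do not form a block, so all 3-cycles on the tableaux of \<open>\<lambda>\<close> occur. To make them fix
  the tableaux of another shape \<open>\<nu>\<close>, only the case \<open>\<nu> = \<mu> + c'\<close> is hard. There one takes commutators of
  3-cycles from \<open>\<mu>\<close> with each other and with \<open>t\<^bsub>m-1\<^esub>\<close>, which acts differently on \<open>\<lambda>\<close> and on \<open>\<nu>\<close>,
  depending on whether a corner of \<open>\<mu>\<close> is adjacent to \<open>c\<close> or to \<open>c'\<close>.
\<close>

text \<open>A 3-cycle on the tableaux of \<open>D - {c}\<close> also acts on the tableaux of every
  other \<open>D - {k}\<close>, and it remains a 3-cycle on \<open>D\<close> only if it is trivial
  there; so words have to be controlled on all shapes of one size together. The transpose must be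
  exempted because all words commute with transposition. Self-transpose shapes are the main
  obstacle: they occur as the other shape to be fixed, and on them a word may move tableaux together
  with their mirror images. Two facts turn one suitable word into all of them. The words trivial on
  a given shape form a normal subgroup, so one 3-cycle in it produces the others. And the commutator
  of two 3-cycles with a single common point is a 3-cycle, while it is trivial wherever a factor is
  trivial or the supports are disjoint. Both arguments use five tableaux. The induction starts at
  five boxes because the only smaller diagram containing (2, 2) is the self-transpose
  square.\<close>

section \<open>Three-cycles in permutation groups\<close>

text \<open>HOL-Algebra uses the token \<open>inv\<close> for inverses in a group structure.\<close>

abbreviation finv :: "('a \<Rightarrow> 'a) \<Rightarrow> 'a \<Rightarrow> 'a" where
  "finv \<equiv> inv_into UNIV"

text \<open>Nothing is said about \<open>g\<close> outside \<open>S\<close>: one word acts on the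
  tableaux of all shapes, as a 3-cycle on one of them and differently on others.\<close>

definition cyc :: "('a \<Rightarrow> 'a) \<Rightarrow> 'a set \<Rightarrow> 'a \<Rightarrow> 'a \<Rightarrow> 'a \<Rightarrow> bool" where
  "cyc g S x y z \<longleftrightarrow> x \<in> S \<and> y \<in> S \<and> z \<in> S \<and> x \<noteq> y \<and> y \<noteq> z \<and> x \<noteq> z \<and>
     g x = y \<and> g y = z \<and> g z = x \<and> (\<forall>v\<in>S. v \<noteq> x \<longrightarrow> v \<noteq> y \<longrightarrow> v \<noteq> z \<longrightarrow> g v = v)"

lemma cyc_rot: "cyc g S x y z \<Longrightarrow> cyc g S y z x"
  by (auto simp: cyc_def)

lemma cyc_inv:
  assumes "bij g" "cyc g S x y z"
  shows "cyc (finv g) S x z y"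
proof -
  have "g u = v \<Longrightarrow> finv g v = u" for u v
    using assms(1) by (metis bij_is_inj inv_f_f)
  then show ?thesis
    using assms(2) unfolding cyc_def by metis
qed

lemma cyc_points:
  assumes "cyc g S x y z"
  shows "x \<in> S" "y \<in> S" "z \<in> S" "x \<noteq> y" "y \<noteq> z" "x \<noteq> z" "g x = y" "g y = z" "g z = x"
  using assms by (auto simp: cyc_def)

lemma cyc_fixes: "cyc g S x y z \<Longrightarrow> v \<in> S \<Longrightarrow> v \<noteq> x \<Longrightarrow> v \<noteq> y \<Longrightarrow> v \<noteq> z \<Longrightarrow> g v = v"
  by (simp add: cyc_def)

lemma cyc_conj:
  assumes k: "bij k" "\<And>v. v \<in> S \<Longrightarrow> k v \<in> S" "\<And>v. v \<in> S \<Longrightarrow> finv k v \<in> S" and g: "cyc g S x y z"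
  shows "cyc (k \<circ> g \<circ> finv k) S (k x) (k y) (k z)"
proof -
  have [simp]: "finv k (k v) = v" "k (finv k v) = v" for v
    using k(1) by (simp_all add: bij_is_inj bij_is_surj surj_f_inv_f)
  have [simp]: "k u = k v \<longleftrightarrow> u = v" for u v
    using k(1) by (simp add: bij_is_inj inj_eq)
  note g' = cyc_points[OF g]
  have "(k \<circ> g \<circ> finv k) v = v" if "v \<in> S" "v \<noteq> k x" "v \<noteq> k y" "v \<noteq> k z" for v
  proof -
    have "finv k v \<noteq> x" "finv k v \<noteq> y" "finv k v \<noteq> z"
      using that by auto
    then show ?thesis
      using cyc_fixes[OF g k(3)[OF that(1)]] by simp
  qed
  then show ?thesis
    using g' k(2) by (simp add: cyc_def)
qed

text \<open>The supports share only \<open>x\<close>. A commutator belongs to every normal subgroup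
  containing one of its factors, so this is how triviality on several shapes is collected in a
  single 3-cycle.\<close>

lemma cyc_commutator:
  assumes "bij a" "bij a'" and a: "cyc a S x b z" and a': "cyc a' S x c w" and d: "distinct [b, c, z, w]"
  shows "cyc (a \<circ> a' \<circ> finv a \<circ> finv a') S x b c"
proof -
  have ia: "cyc (finv a) S x z b" and ia': "cyc (finv a') S x w c"
    using cyc_inv[OF assms(1) a] cyc_inv[OF assms(2) a'] by auto
  note p = cyc_points[OF a] cyc_points[OF a'] cyc_points[OF ia] cyc_points[OF ia']
  have q: "a c = c" "a w = w" "a' b = b" "a' z = z"
    "finv a c = c" "finv a w = w" "finv a' b = b" "finv a' z = z"
    using p(1-3,10-12) d p(4-6,13-15)
    by (auto intro!: cyc_fixes[OF a] cyc_fixes[OF a'] cyc_fixes[OF ia] cyc_fixes[OF ia'])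
  have "(a \<circ> a' \<circ> finv a \<circ> finv a') v = v" if "v \<in> S" "v \<noteq> x" "v \<noteq> b" "v \<noteq> c" for v
  proof (cases "v = z \<or> v = w")
    case True
    then show ?thesis
      using p q by auto
  next
    case False
    then show ?thesis
      using that by (simp add: cyc_fixes[OF a] cyc_fixes[OF a'] cyc_fixes[OF ia] cyc_fixes[OF ia'])
  qed
  moreover have "(a \<circ> a' \<circ> finv a \<circ> finv a') x = b" "(a \<circ> a' \<circ> finv a \<circ> finv a') b = c"
    "(a \<circ> a' \<circ> finv a \<circ> finv a') c = x"
    using p q by simp_all
  ultimately show ?thesis
    unfolding cyc_def using p d by simp
qed

text \<open>These are the two factors of a commutator \<open>k s k^-1 s^-1\<close> when
  \<open>k\<close> moves just one point of the 3-cycle \<open>s\<close>, namely \<open>p\<close> to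
  \<open>q\<close>.\<close>

lemma cyc_comp_shared_pair:
  assumes f: "cyc f S q a b" and g: "cyc g S p b a" and "p \<noteq> q"
  shows "cyc (f \<circ> g) S a p q"
proof -
  note p = cyc_points[OF f] cyc_points[OF g]
  have q: "f p = p" "g q = q"
    using p(1-6,10-15) \<open>p \<noteq> q\<close> by (auto intro!: cyc_fixes[OF f] cyc_fixes[OF g])
  have "(f \<circ> g) v = v" if "v \<in> S" "v \<noteq> a" "v \<noteq> p" "v \<noteq> q" for v
  proof (cases "v = b")
    case True
    then show ?thesis using p q by simp
  next
    case False
    then show ?thesis
      using that by (simp add: cyc_fixes[OF f] cyc_fixes[OF g])
  qed
  then show ?thesis
    unfolding cyc_def using p q \<open>p \<noteq> q\<close> by simp
qed

text \<open>If \<open>b\<close> moves \<open>v\<close>, it also moves \<open>b v\<close>, so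
  \<open>a\<close> fixes both.\<close>

lemma disjoint_supports_commute:
  assumes "bij a" "bij b" "\<And>v. v \<in> S \<Longrightarrow> a v \<in> S" "\<And>v. v \<in> S \<Longrightarrow> b v \<in> S"
    and disj: "\<And>v. v \<in> S \<Longrightarrow> a v = v \<or> b v = v" and "v \<in> S"
  shows "a (b v) = b (a v)"
proof -
  have "a u = u \<longleftrightarrow> a (a u) = a u" "b u = u \<longleftrightarrow> b (b u) = b u" for u
    using assms(1,2) by (auto simp: bij_is_inj inj_eq)
  then show ?thesis
    using assms by metis
qed

text \<open>The members are bijections of the whole type that preserve \<open>S\<close>. Instances
  are all words of \<open>G m\<close> and the subgroup of those trivial on a given shape.\<close>

locale perm_group =
  fixes H :: "('a \<Rightarrow> 'a) set" and S :: "'a set"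
  assumes id_mem: "id \<in> H"
    and comp_mem: "g \<in> H \<Longrightarrow> h \<in> H \<Longrightarrow> g \<circ> h \<in> H"
    and inv_mem: "g \<in> H \<Longrightarrow> finv g \<in> H"
    and bij: "g \<in> H \<Longrightarrow> bij g"
    and stable: "g \<in> H \<Longrightarrow> v \<in> S \<Longrightarrow> g v \<in> S"
begin

lemma inv_simps [simp]:
  "g \<in> H \<Longrightarrow> finv g (g v) = v" "g \<in> H \<Longrightarrow> g (finv g v) = v"
  using bij by (simp_all add: bij_is_inj bij_is_surj surj_f_inv_f)

lemma conj_mem:
  assumes "k \<in> H" "g \<in> H" "cyc g S x y z"
  shows "k \<circ> g \<circ> finv k \<in> H" "cyc (k \<circ> g \<circ> finv k) S (k x) (k y) (k z)"
  using assms by (simp_all add: comp_mem inv_mem cyc_conj bij stable)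

text \<open>This makes \<open>linked\<close> transitive. The cases are the coincidences among the
  four outer points: for \<open>z = w\<close> conjugate \<open>a'\<close> by \<open>a\<close>, for
  four distinct points take the commutator.\<close>

lemma cyc_third_point:
  assumes a: "a \<in> H" "cyc a S x b z" and a': "a' \<in> H" "cyc a' S x c w" and "b \<noteq> c"
  shows "\<exists>k\<in>H. cyc k S x b c"
proof -
  consider "z = c" | "w = b" | "z = w" "z \<noteq> c" | "distinct [b, c, z, w]"
    using cyc_points(5)[OF a(2)] cyc_points(5)[OF a'(2)] \<open>b \<noteq> c\<close> by auto
  then show ?thesis
  proof cases
    case 1
    then show ?thesis using a by blast
  next
    case 2
    then show ?thesis using a' by (meson cyc_inv bij inv_mem)
  next
    case 3
    then have "a c = c"
      using cyc_fixes[OF a(2)] cyc_points[OF a'(2)] \<open>b \<noteq> c\<close> by metis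
    moreover have "a x = b" "a z = x"
      using cyc_points[OF a(2)] by auto
    ultimately have "cyc (a \<circ> a' \<circ> finv a) S b c x"
      using conj_mem(2)[OF a(1) a'] 3 by simp
    then show ?thesis
      using conj_mem(1)[OF a(1) a'] cyc_rot by metis
  next
    case 4
    then show ?thesis
      using cyc_commutator[OF bij[OF a(1)] bij[OF a'(1)] a(2) a'(2)] a(1) a'(1)
      by (meson comp_mem inv_mem)
  qed
qed

definition linked :: "'a \<Rightarrow> 'a \<Rightarrow> bool" where
  "linked u v \<longleftrightarrow> u = v \<or> (\<exists>g\<in>H. \<exists>w. cyc g S u v w)"

lemma linked_sym: "linked u v \<Longrightarrow> linked v u"
  unfolding linked_def by (metis cyc_inv cyc_rot bij inv_mem)

lemma linked_trans:
  assumes "linked u v" "linked v w"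
  shows "linked u w"
proof (cases "u = v \<or> v = w \<or> u = w")
  case False
  then obtain g a h b where "g \<in> H" "cyc g S v u a" "h \<in> H" "cyc h S v w b"
    using linked_sym[OF assms(1)] assms(2) unfolding linked_def by blast
  then obtain k where "k \<in> H" "cyc k S v u w"
    using cyc_third_point False by blast
  then show ?thesis
    unfolding linked_def using cyc_rot by metis
qed (use assms in \<open>auto simp: linked_def\<close>)

lemma linked_conj: "linked u v \<Longrightarrow> g \<in> H \<Longrightarrow> linked (g u) (g v)"
  unfolding linked_def using conj_mem by metis

lemma all_linked_imp_cyc:
  assumes l: "\<And>u. u \<in> S \<Longrightarrow> linked p u" and "x \<in> S" "y \<in> S" "z \<in> S" "x \<noteq> y" "y \<noteq> z" "x \<noteq> z"
  shows "\<exists>g\<in>H. cyc g S x y z"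
proof -
  have "linked x y" "linked x z"
    using l assms linked_sym linked_trans by blast+
  then show ?thesis
    using cyc_third_point assms unfolding linked_def by metis
qed

end

section \<open>Young diagrams and their linear extensions\<close>

text \<open>Incomparability in the product order: one box is strictly north-east of the other.
  Consecutive entries of a tableau can be exchanged exactly in this position.\<close>

definition incmp :: "box \<Rightarrow> box \<Rightarrow> bool" where
  "incmp a b \<longleftrightarrow> fst a < fst b \<and> snd b < snd a \<or> fst b < fst a \<and> snd a < snd b"

definition young :: "box set \<Rightarrow> bool" where
  "young D \<longleftrightarrow> finite D \<and> (\<forall>i j. (i, j) \<in> D \<longrightarrow> 1 \<le> i \<and> 1 \<le> j \<and>
     (\<forall>i' j'. 1 \<le> i' \<and> i' \<le> i \<and> 1 \<le> j' \<and> j' \<le> j \<longrightarrow> (i', j') \<in> D))"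

text \<open>
  A standard tableau is encoded as the list of its boxes in the order of their entries. The
  subtableau of the entries \<open>1, \<dots>, k\<close> is then a prefix, and \<open>bk i\<close> below, which swaps the positions
  \<open>i\<close> and \<open>i + 1\<close> counted from 0, is the Bender--Knuth involution \<open>t\<^bsub>i+1\<^esub>\<close>.
\<close>

definition LE :: "box set \<Rightarrow> box list set" where
  "LE D = {xs. distinct xs \<and> set xs = D \<and> (\<forall>k. young (set (take k xs)))}"

definition corner :: "box set \<Rightarrow> box \<Rightarrow> bool" where
  "corner D c \<longleftrightarrow> c \<in> D \<and> young (D - {c})"

definition bk :: "nat \<Rightarrow> box list \<Rightarrow> box list" where
  "bk i xs = (if Suc i < length xs \<and> incmp (xs ! i) (xs ! Suc i)
     then take i xs @ [xs ! Suc i, xs ! i] @ drop (i + 2) xs else xs)"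

abbreviation tr :: "box set \<Rightarrow> box set" where
  "tr D \<equiv> prod.swap ` D"

lemma incmp_sym: "incmp a b \<longleftrightarrow> incmp b a"
  by (auto simp: incmp_def)

lemma incmp_swap [simp]: "incmp (prod.swap a) (prod.swap b) \<longleftrightarrow> incmp a b"
  by (auto simp: incmp_def)

lemma young_finite: "young D \<Longrightarrow> finite D"
  by (simp add: young_def)

lemma youngD: "young D \<Longrightarrow> (i, j) \<in> D \<Longrightarrow> 1 \<le> i' \<Longrightarrow> i' \<le> i \<Longrightarrow> 1 \<le> j' \<Longrightarrow> j' \<le> j \<Longrightarrow> (i', j') \<in> D"
  unfolding young_def by blast

lemma young_pos: "young D \<Longrightarrow> (i, j) \<in> D \<Longrightarrow> 1 \<le> i \<and> 1 \<le> j"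
  unfolding young_def by blast

lemma young_empty [simp]: "young {}"
  by (simp add: young_def)

lemma tr_tr [simp]: "tr (tr D) = D"
  by (simp add: image_comp)

lemma mem_tr [simp]: "(i, j) \<in> tr D \<longleftrightarrow> (j, i) \<in> D"
  by (force simp: image_iff)

lemma young_tr [simp]: "young (tr D) \<longleftrightarrow> young D"
proof -
  have "young D \<Longrightarrow> young (tr D)" for D
    unfolding young_def mem_tr using finite_imageI[of D prod.swap] by blast
  from this[of D] this[of "tr D"] show ?thesis unfolding tr_tr by blast
qed

lemma corner_iff:
  assumes D: "young D"
  shows "corner D c \<longleftrightarrow> c \<in> D \<and> (Suc (fst c), snd c) \<notin> D \<and> (fst c, Suc (snd c)) \<notin> D"
proof
  assume c: "corner D c"
  obtain p q where [simp]: "c = (p, q)" by (cases c)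
  have "1 \<le> p" "1 \<le> q" using D c young_pos by (auto simp: corner_def)
  then show "c \<in> D \<and> (Suc (fst c), snd c) \<notin> D \<and> (fst c, Suc (snd c)) \<notin> D"
    using c youngD[of "D - {c}" "Suc p" q p q] youngD[of "D - {c}" p "Suc q" p q]
    by (auto simp: corner_def)
next
  assume c: "c \<in> D \<and> (Suc (fst c), snd c) \<notin> D \<and> (fst c, Suc (snd c)) \<notin> D"
  obtain p q where [simp]: "c = (p, q)" by (cases c)
  have "(p, q) \<noteq> (i', j')" if "(i, j) \<in> D - {c}" "i' \<le> i" "j' \<le> j" for i j i' j'
  proof
    assume e: "(p, q) = (i', j')"
    then have "Suc p \<le> i \<or> Suc q \<le> j" using that by auto
    then show False
      using youngD[OF D, of i j "Suc p" q] youngD[OF D, of i j p "Suc q"] that e c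
        young_pos[OF D, of p q] by auto
  qed
  moreover have "c \<in> D" using c by blast
  ultimately show "corner D c"
    using D unfolding young_def corner_def \<open>c = (p, q)\<close> by (metis DiffD1 DiffI finite_Diff singletonD)
qed

lemma corner_incmp:
  assumes D: "young D" and "corner D c" "corner D d" "c \<noteq> d"
  shows "incmp c d"
proof -
  have *: False if "corner D c" "d \<in> D" "c \<noteq> d" "fst c \<le> fst d" "snd c \<le> snd d" for c d
  proof -
    obtain p q i j where [simp]: "c = (p, q)" "d = (i, j)" by (cases c, cases d)
    have "Suc p \<le> i \<or> Suc q \<le> j" using that by auto
    then show False
      using youngD[OF D, of i j "Suc p" q] youngD[OF D, of i j p "Suc q"] that
        young_pos[OF D, of p q] by (auto simp: corner_iff[OF D])
  qed
  show ?thesis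
    using *[of c d] *[of d c] assms unfolding incmp_def corner_def by force
qed

text \<open>A box of \<open>D\<close> weakly south-east of \<open>b\<close> with the largest
  coordinate sum has no neighbour to the right or below.\<close>

lemma corner_above:
  assumes D: "young D" and "b \<in> D"
  obtains c where "corner D c" "fst b \<le> fst c" "snd b \<le> snd c"
proof -
  let ?A = "{c \<in> D. fst b \<le> fst c \<and> snd b \<le> snd c}"
  have fin: "finite ?A" "b \<in> ?A"
    using assms young_finite[OF D] by simp_all
  define m where "m = Max ((\<lambda>c. fst c + snd c) ` ?A)"
  have "m \<in> (\<lambda>c. fst c + snd c) ` ?A"
    unfolding m_def using fin(1) fin(2) by (intro Max_in) blast+
  then obtain c where c: "c \<in> ?A" "fst c + snd c = m" by auto
  have mx: "fst d + snd d \<le> m" if "d \<in> ?A" for d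
    unfolding m_def using fin(1) that by (intro Max_ge) simp_all
  have "corner D c"
    unfolding corner_iff[OF D] using c mx[of "(Suc (fst c), snd c)"] mx[of "(fst c, Suc (snd c))"] by force
  then show ?thesis using c that by auto
qed

lemma corner_tr [simp]: "corner (tr D) (prod.swap c) \<longleftrightarrow> corner D c"
proof -
  have "tr D - {prod.swap c} = tr (D - {c})" by (cases c) auto
  moreover have "prod.swap c \<in> tr D \<longleftrightarrow> c \<in> D" by (cases c) simp
  ultimately show ?thesis by (simp add: corner_def)
qed

lemma young_swap:
  assumes "young (insert a (insert b A))" "young A" "incmp a b"
  shows "young (insert b A)"
  unfolding young_def
proof (intro conjI allI impI)
  show "finite (insert b A)" using assms young_finite by simp
next
  fix i j assume ij: "(i, j) \<in> insert b A"
  then show "1 \<le> i" "1 \<le> j" using young_pos[OF assms(1), of i j] by auto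
  fix i' j' assume le: "1 \<le> i' \<and> i' \<le> i \<and> 1 \<le> j' \<and> j' \<le> j"
  show "(i', j') \<in> insert b A"
  proof (cases "(i, j) \<in> A")
    case True
    then show ?thesis using youngD[OF assms(2) True] le by blast
  next
    case False
    then have "b = (i, j)" using ij by simp
    then have "(i', j') \<noteq> a" using le assms(3) by (auto simp: incmp_def)
    then show ?thesis using youngD[OF assms(1), of i j i' j'] ij le by blast
  qed
qed

lemma LE_young: "xs \<in> LE D \<Longrightarrow> young D"
  unfolding LE_def by (metis (mono_tags, lifting) mem_Collect_eq take_all_iff order_refl)

lemma LE_length: "xs \<in> LE D \<Longrightarrow> length xs = card D"
  unfolding LE_def using distinct_card by fastforce

lemma finite_LE: "finite (LE D)"
proof (cases "finite D")
  case True
  have "LE D \<subseteq> {xs. set xs \<subseteq> D \<and> length xs = card D}"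
    using LE_length by (auto simp: LE_def)
  then show ?thesis using finite_lists_length_eq[OF True] finite_subset by blast
next
  case False
  then have "LE D = {}" by (auto simp: LE_def)
  then show ?thesis by simp
qed

lemma LE_snoc:
  assumes "young D"
  shows "xs @ [c] \<in> LE D \<longleftrightarrow> c \<in> D \<and> xs \<in> LE (D - {c})"
proof
  assume l: "xs @ [c] \<in> LE D"
  have "young (set (take k xs))" for k
  proof (cases "k \<le> length xs")
    case True
    then show ?thesis using l unfolding LE_def by (auto dest: spec[where x = k])
  next
    case False
    then show ?thesis using l unfolding LE_def by (auto dest: spec[where x = "length xs"])
  qed
  then show "c \<in> D \<and> xs \<in> LE (D - {c})" using l by (auto simp: LE_def)
next
  assume r: "c \<in> D \<and> xs \<in> LE (D - {c})"
  then have s: "set xs = D - {c}" "distinct xs" by (auto simp: LE_def)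
  have "young (set (take k (xs @ [c])))" for k
  proof (cases "k \<le> length xs")
    case True
    then show ?thesis using r unfolding LE_def by simp
  next
    case False
    then have "take k (xs @ [c]) = xs @ [c]" by simp
    then show ?thesis using s r assms by (simp add: insert_absorb)
  qed
  then show "xs @ [c] \<in> LE D" using r s by (auto simp: LE_def)
qed

lemma LE_empty: "LE {} = {[]}"
  by (auto simp: LE_def)

lemma LE_snocE:
  assumes "ys \<in> LE D" "D \<noteq> {}"
  obtains xs c where "ys = xs @ [c]" "corner D c" "xs \<in> LE (D - {c})"
proof -
  have "ys \<noteq> []" using assms by (auto simp: LE_def)
  then obtain xs c where ys: "ys = xs @ [c]" by (meson rev_exhaust)
  have "c \<in> D" "xs \<in> LE (D - {c})"
    using assms(1) LE_snoc[OF LE_young[OF assms(1)]] ys by auto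
  then show ?thesis using that ys LE_young by (auto simp: corner_def)
qed

lemma LE_first:
  assumes "xs \<in> LE D" "xs = x # ys"
  shows "x = (1, 1)"
proof -
  have "young (set (take 1 xs))" using assms unfolding LE_def by blast
  then have "young {x}" by (simp add: assms(2))
  then have "(1, 1) \<in> {x}"
    using youngD[of "{x}" "fst x" "snd x" 1 1] young_pos[of "{x}" "fst x" "snd x"] by simp
  then show ?thesis by simp
qed

lemma LE_snocI: "young D \<Longrightarrow> corner D c \<Longrightarrow> xs \<in> LE (D - {c}) \<Longrightarrow> xs @ [c] \<in> LE D"
  by (simp add: LE_snoc corner_def)

text \<open>Grow \<open>K\<close> to \<open>D\<close> box by box. The same tail serves all tableaux
  of \<open>K\<close>, so appending it is injective and the number of tableaux is monotone in the
  shape.\<close>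

lemma LE_extend:
  assumes "young K" "young D" "K \<subseteq> D"
  shows "\<exists>zs. \<forall>ys\<in>LE K. ys @ zs \<in> LE D"
  using assms(2,3)
proof (induction "card (D - K)" arbitrary: D)
  case 0
  then have "D = K" using young_finite by auto
  then show ?case by (intro exI[of _ "[]"]) simp
next
  case (Suc n)
  then obtain b where b: "b \<in> D" "b \<notin> K"
    by (metis Diff_iff card.empty ex_in_conv nat.distinct(1))
  obtain c where c: "corner D c" "fst b \<le> fst c" "snd b \<le> snd c"
    using corner_above[OF Suc.prems(1) b(1)] .
  have "c \<notin> K"
    using b c youngD[OF assms(1), of "fst c" "snd c" "fst b" "snd b"]
      young_pos[OF Suc.prems(1), of "fst b" "snd b"] by auto
  moreover have "D - {c} - K = (D - K) - {c}" by auto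
  ultimately have "card (D - {c} - K) = n" "K \<subseteq> D - {c}" "young (D - {c})"
    using Suc c by (auto simp: corner_def)
  then obtain zs where "\<forall>ys\<in>LE K. ys @ zs \<in> LE (D - {c})"
    using Suc.hyps(1)[of "D - {c}"] by metis
  then have "\<forall>ys\<in>LE K. ys @ (zs @ [c]) \<in> LE D"
    using LE_snocI[OF Suc.prems(1) c(1)] by fastforce
  then show ?case by blast
qed

lemma LE_nonempty: "young D \<Longrightarrow> \<exists>xs. xs \<in> LE D"
  using LE_extend[of "{}" D] by (auto simp: LE_empty)

lemma card_LE_mono:
  assumes "young K" "young D" "K \<subseteq> D"
  shows "card (LE K) \<le> card (LE D)"
proof -
  obtain zs where zs: "\<forall>ys\<in>LE K. ys @ zs \<in> LE D" using LE_extend[OF assms] by blast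
  have "inj_on (\<lambda>ys. ys @ zs) (LE K)" by (auto simp: inj_on_def)
  moreover have "(\<lambda>ys. ys @ zs) ` LE K \<subseteq> LE D" using zs by auto
  ultimately show ?thesis using card_inj_on_le finite_LE by blast
qed

lemma LE_tr: "xs \<in> LE D \<Longrightarrow> map prod.swap xs \<in> LE (tr D)"
  by (auto simp: LE_def distinct_map take_map)

section \<open>Bender--Knuth involutions on linear extensions\<close>

lemma bk_decomp: "bk (length us) (us @ a # b # vs) = (if incmp a b then us @ b # a # vs else us @ a # b # vs)"
  by (simp add: bk_def nth_append)

lemma split_at:
  assumes "Suc i < length xs"
  obtains us a b vs where "xs = us @ a # b # vs" "length us = i"
proof
  show "xs = take i xs @ xs ! i # xs ! Suc i # drop (Suc (Suc i)) xs"
    using assms by (simp add: Cons_nth_drop_Suc)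
  show "length (take i xs) = i" using assms by simp
qed

lemma bk_short: "\<not> Suc i < length xs \<Longrightarrow> bk i xs = xs"
  by (simp add: bk_def)

lemma length_bk [simp]: "length (bk i xs) = length xs"
  by (cases "Suc i < length xs") (auto elim!: split_at simp: bk_decomp bk_short)

lemma bk_bk [simp]: "bk i (bk i xs) = xs"
proof (cases "Suc i < length xs")
  case True
  then obtain us a b vs where "xs = us @ a # b # vs" "length us = i" by (rule split_at)
  then show ?thesis using incmp_sym[of a b] by (auto simp: bk_decomp)
qed (simp add: bk_short)

lemma bij_bk: "bij (bk i)"
  by (rule involuntory_imp_bij) simp

lemma finv_bk [simp]: "finv (bk i) = bk i"
  by (rule inv_equality) simp_all

lemma bk_append:
  assumes "Suc i < length xs"
  shows "bk i (xs @ ys) = bk i xs @ ys"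
proof -
  obtain us a b vs where "xs = us @ a # b # vs" "length us = i"
    using assms by (rule split_at)
  then show ?thesis using bk_decomp[of us a b "vs @ ys"] bk_decomp[of us a b vs] by simp
qed

lemma bk_map_swap: "bk i (map prod.swap xs) = map prod.swap (bk i xs)"
proof (cases "Suc i < length xs")
  case True
  then obtain us a b vs where "xs = us @ a # b # vs" "length us = i" by (rule split_at)
  then show ?thesis
    using bk_decomp[of "map prod.swap us" "prod.swap a" "prod.swap b" "map prod.swap vs"]
      bk_decomp[of us a b vs] by simp
qed (simp add: bk_short)

lemma bk_LE:
  assumes "xs \<in> LE D"
  shows "bk i xs \<in> LE D"
proof (cases "Suc i < length xs")
  case True
  then obtain us a b vs where xs: "xs = us @ a # b # vs" "length us = i" by (rule split_at)
  have y: "young (set (take k xs))" for k using assms by (auto simp: LE_def)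
  have "young (set (take k (us @ b # a # vs)))" if "incmp a b" for k
  proof -
    consider "k \<le> i" | "k = Suc i" | j where "k = Suc (Suc i) + j"
      by (metis le_Suc_eq not_less_eq_eq nat_le_iff_add)
    then show ?thesis
    proof cases
      case 1
      then show ?thesis using y[of k] xs by simp
    next
      case 2
      have "young (insert a (insert b (set us)))" "young (set us)"
        using y[of "Suc (Suc i)"] y[of i] xs by (simp_all add: insert_commute)
      then show ?thesis using young_swap[OF _ _ that] 2 xs by simp
    next
      case 3
      then show ?thesis using y[of k] xs by (simp add: insert_commute)
    qed
  qed
  then show ?thesis
  proof (cases "incmp a b")
    case True
    then have "bk i xs = us @ b # a # vs" using bk_decomp[of us a b vs] xs by simp
    moreover have "us @ b # a # vs \<in> LE D"
      using assms xs \<open>\<And>k. incmp a b \<Longrightarrow> young (set (take k (us @ b # a # vs)))\<close>[OF True]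
      unfolding LE_def mem_Collect_eq by auto
    ultimately show ?thesis by (simp only:)
  next
    case False
    then show ?thesis using bk_decomp[of us a b vs] xs assms by simp
  qed
qed (use assms in \<open>simp add: bk_short\<close>)

text \<open>\<open>G m\<close> is generated by \<open>t\<^sub>1, \<dots>, t\<^bsub>m-1\<^esub>\<close> and acts on lists of any length through their first \<open>m\<close> boxes.\<close>

inductive_set G :: "nat \<Rightarrow> (box list \<Rightarrow> box list) set" for m where
  G_id: "id \<in> G m"
| G_step: "g \<in> G m \<Longrightarrow> Suc i < m \<Longrightarrow> bk i \<circ> g \<in> G m"

lemma G_bk: "Suc i < m \<Longrightarrow> bk i \<in> G m"
  using G_step[OF G_id] by simp

lemma G_comp: "g \<in> G m \<Longrightarrow> h \<in> G m \<Longrightarrow> g \<circ> h \<in> G m"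
  by (induction rule: G.induct) (auto simp: comp_assoc intro: G_step)

lemma G_bij: "g \<in> G m \<Longrightarrow> bij g"
  by (induction rule: G.induct) (simp_all only: bij_id bij_comp bij_bk)

lemma G_inv: "g \<in> G m \<Longrightarrow> finv g \<in> G m"
proof (induction rule: G.induct)
  case (G_step g i)
  have "finv (bk i \<circ> g) = finv g \<circ> bk i"
    using o_inv_distrib[OF bij_bk G_bij[OF G_step(1)]] by simp
  then show ?case using G_comp[OF G_step(3) G_bk[OF G_step(2)]] by (simp only:)
qed (simp only: inv_id G_id)

lemma G_LE: "g \<in> G m \<Longrightarrow> xs \<in> LE D \<Longrightarrow> g xs \<in> LE D"
  by (induction rule: G.induct) (auto intro: bk_LE)

lemma G_append_length: "g \<in> G m \<Longrightarrow> length xs = m \<Longrightarrow> g (xs @ ys) = g xs @ ys \<and> length (g xs) = m"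
  by (induction rule: G.induct) (auto simp: bk_append)

lemma G_append: "g \<in> G m \<Longrightarrow> length xs = m \<Longrightarrow> g (xs @ ys) = g xs @ ys"
  using G_append_length by blast

lemma G_map_swap: "g \<in> G m \<Longrightarrow> g (map prod.swap xs) = map prod.swap (g xs)"
  by (induction rule: G.induct) (auto simp: bk_map_swap)

lemma G_mono: "g \<in> G m \<Longrightarrow> m \<le> m' \<Longrightarrow> g \<in> G m'"
  by (induction rule: G.induct) (auto intro: G_id G_step)

lemma perm_group_G: "perm_group (G m) (LE D)"
  by (rule perm_group.intro) (blast intro: G_id G_comp G_inv G_bij G_LE)+

lemma G_snoc: "g \<in> G m \<Longrightarrow> xs \<in> LE E \<Longrightarrow> card E = m \<Longrightarrow> g (xs @ [c]) = g xs @ [c]"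
  by (simp add: G_append LE_length)

text \<open>Positions \<open>card D - 2\<close> and \<open>card D - 1\<close>, counted from 0, hold
  the last two boxes. This is the only generator of \<open>G (card D)\<close> that can change the
  last box.\<close>

lemma bk_last:
  assumes "xs \<in> LE (D - {c, d})" "c \<in> D" "d \<in> D" "c \<noteq> d"
  shows "bk (card D - 2) (xs @ [c, d]) = (if incmp c d then xs @ [d, c] else xs @ [c, d])"
proof -
  have "finite D" using LE_young[OF assms(1)] young_finite by (metis finite.emptyI finite_Diff2 finite_insert)
  then have "length xs = card D - 2" using LE_length[OF assms(1)] assms by (simp add: card_Diff_subset)
  then show ?thesis using bk_decomp[of xs c d "[]"] by simp
qed

lemma remove_commute: "D - {a} - {b} = D - {b} - {a}"
  by auto

lemma corner_remove: "young D \<Longrightarrow> corner D a \<Longrightarrow> corner D b \<Longrightarrow> a \<noteq> b \<Longrightarrow> corner (D - {a}) b"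
  using corner_iff[of D b] corner_iff[of "D - {a}" b] by (auto simp: corner_def)

lemma corner_young: "corner D c \<Longrightarrow> young (D - {c})"
  by (simp add: corner_def)

lemma card_remove: "young D \<Longrightarrow> corner D c \<Longrightarrow> card (D - {c}) = card D - 1"
  by (simp add: corner_def)

lemma card_ge_two:
  assumes "young D" "a \<in> D" "b \<in> D" "a \<noteq> b"
  shows "card D \<ge> 2"
proof -
  have "card {a, b} \<le> card D"
    using assms by (intro card_mono young_finite) auto
  then show ?thesis using assms(4) by simp
qed

lemma LE_snoc2:
  assumes "young D" "corner D c" "corner D d" "c \<noteq> d" "xs \<in> LE (D - {c} - {d})"
  shows "xs @ [c] \<in> LE (D - {d})" "xs @ [d] \<in> LE (D - {c})"
  using LE_snocI[OF corner_young corner_remove, of D d c xs]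
    LE_snocI[OF corner_young corner_remove, of D c d xs] assms by (simp_all add: remove_commute)

lemma bk_last':
  assumes "xs \<in> LE (D - {d} - {c})" "c \<in> D" "d \<in> D" "c \<noteq> d"
  shows "bk (card D - 2) (xs @ [c, d]) = (if incmp c d then xs @ [d, c] else xs @ [c, d])"
proof -
  have "D - {d} - {c} = D - {c, d}" by auto
  then show ?thesis using bk_last[of xs D c d] assms by simp
qed

lemma bk_corners:
  assumes "young D" "corner D c" "corner D d" "c \<noteq> d" "xs \<in> LE (D - {c} - {d})"
  shows "bk (card D - 2) (xs @ [c, d]) = xs @ [d, c]" "bk (card D - 2) (xs @ [d, c]) = xs @ [c, d]"
proof -
  have "incmp c d" "incmp d c" "c \<in> D" "d \<in> D"
    using corner_incmp[OF assms(1)] assms(2-4) by (auto simp: corner_def)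
  then show "bk (card D - 2) (xs @ [c, d]) = xs @ [d, c]" "bk (card D - 2) (xs @ [d, c]) = xs @ [c, d]"
    using bk_last'[of xs D d c] bk_last'[of xs D c d] assms(4,5) by (simp_all add: remove_commute)
qed

text \<open>Tableaux with the same last box are joined by induction. For last boxes \<open>a\<close>
  and \<open>b\<close>, pass through a tableau ending in \<open>b, a\<close>, which the last
  involution turns into one ending in \<open>a, b\<close>.\<close>

lemma LE_transitive:
  "x \<in> LE D \<Longrightarrow> y \<in> LE D \<Longrightarrow> \<exists>g\<in>G (card D). g x = y"
proof (induction "card D" arbitrary: D x y)
  case 0
  then have "D = {}" using LE_young young_finite by (metis card_0_eq)
  then have "id x = y" using 0 by (simp add: LE_empty)
  then show ?case using G_id by metis
next
  case (Suc n)
  have D: "young D" using Suc.prems LE_young by blast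
  have "D \<noteq> {}" using Suc.hyps(2) by auto
  then obtain x' a y' b where
    x: "x = x' @ [a]" "corner D a" "x' \<in> LE (D - {a})" and
    y: "y = y' @ [b]" "corner D b" "y' \<in> LE (D - {b})"
    using Suc.prems LE_snocE by metis
  have IH: "\<exists>g\<in>G n. g u = v" if "corner D k" "u \<in> LE (D - {k})" "v \<in> LE (D - {k})" for k u v
  proof -
    have "n = card (D - {k})" using Suc.hyps(2) card_remove[OF D that(1)] by simp
    then show ?thesis using Suc.hyps(1)[of "D - {k}" u v] that by simp
  qed
  have lift: "g (u @ [k]) = g u @ [k]" if "g \<in> G n" "corner D k" "u \<in> LE (D - {k})" for g u k
    using G_snoc[OF that(1,3)] card_remove[OF D that(2)] Suc.hyps(2) by simp
  have mono: "G n \<subseteq> G (card D)" using G_mono[of _ n "card D"] Suc.hyps(2) by auto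
  show ?case
  proof (cases "a = b")
    case True
    then show ?thesis using IH[of a x' y'] x y lift mono by (metis subsetD)
  next
    case False
    obtain z where z: "z \<in> LE (D - {a} - {b})"
      using LE_nonempty corner_young[OF corner_remove[OF D x(2) y(2) False]] by blast
    note za = LE_snoc2(1)[OF D x(2) y(2) False z] and zb = LE_snoc2(2)[OF D x(2) y(2) False z]
    obtain g1 where g1: "g1 \<in> G n" "g1 x' = z @ [b]" using IH[OF x(2,3) zb] by blast
    obtain g2 where g2: "g2 \<in> G n" "g2 (z @ [a]) = y'" using IH[OF y(2) za y(3)] by blast
    have c2: "card D \<ge> 2" using card_ge_two[OF D _ _ False] x(2) y(2) by (simp add: corner_def)
    have "(g2 \<circ> (bk (card D - 2) \<circ> g1)) x = g2 (z @ [a] @ [b])"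
      using x lift[OF g1(1) x(2,3)] g1(2) bk_corners(2)[OF D x(2) y(2) False z]
      by simp
    also have "\<dots> = y" using lift[OF g2(1) y(2) za] g2(2) y(1) by simp
    finally have "(g2 \<circ> (bk (card D - 2) \<circ> g1)) x = y" .
    moreover have "g2 \<circ> (bk (card D - 2) \<circ> g1) \<in> G (card D)"
      using G_bk[of "card D - 2" "card D"] g1(1) g2(1) mono c2 by (intro G_comp) auto
    ultimately show ?thesis by blast
  qed
qed

text \<open>
  Descent on the diagram: as long as a corner other than \<open>c\<close> can be removed without making \<open>c\<close> the
  only corner, conjugation by the last involution transports a violation of the block property.
\<close>

lemma last_box_not_block:
  assumes "young D" "corner D c" "corner D d" "d \<noteq> c" "c \<notin> {(1, 1), (1, 2), (2, 1)}"
  shows "\<exists>g\<in>G (card D). \<exists>x\<in>LE (D - {c}). \<exists>y\<in>LE (D - {c}).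
    last (g (x @ [c])) = c \<and> last (g (y @ [c])) \<noteq> c"
  using assms
proof (induction "card D" arbitrary: D d rule: less_induct)
  case less
  note D = less.prems(1) and c = less.prems(2) and d = less.prems(3) and dc = less.prems(4)
  have Dc: "young (D - {c})" and Dd: "young (D - {d})" using c d by (auto simp: corner_def)
  have c2: "card D \<ge> 2" using card_ge_two[OF D _ _ dc] c d by (simp add: corner_def)
  let ?t = "bk (card D - 2)"
  have t: "?t \<in> G (card D)" using G_bk c2 by simp
  have dc': "corner (D - {c}) d" "corner (D - {d}) c"
    using corner_remove[OF D] c d dc by auto
  show ?case
  proof (cases "\<exists>e. corner (D - {c}) e \<and> \<not> incmp e c")
    case True
    then obtain e where e: "corner (D - {c}) e" "\<not> incmp e c" by blast
    obtain v where v: "v \<in> LE (D - {c} - {e})" using LE_nonempty corner_young[OF e(1)] by blast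
    obtain w where w: "w \<in> LE (D - {c} - {d})" using LE_nonempty corner_young[OF dc'(1)] by blast
    \<comment> \<open>Here the last involution alone suffices: it fixes what ends in
      \<open>e, c\<close> and removes \<open>c\<close> from the end of what ends in
      \<open>d, c\<close>.\<close>
    have "?t (v @ [e, c]) = v @ [e, c]"
      using bk_last'[of v D c e] v e c by (auto simp: corner_def)
    moreover have "?t (w @ [d, c]) = w @ [c, d]"
      using bk_corners(2)[OF D c d dc[symmetric] w] .
    moreover have "v @ [e] \<in> LE (D - {c})" "w @ [d] \<in> LE (D - {c})"
      using LE_snocI[OF Dc e(1) v] LE_snocI[OF Dc dc'(1) w] by auto
    ultimately have "last (?t ((v @ [e]) @ [c])) = c" "last (?t ((w @ [d]) @ [c])) \<noteq> c"
      using dc by auto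
    then show ?thesis using t \<open>v @ [e] \<in> LE (D - {c})\<close> \<open>w @ [d] \<in> LE (D - {c})\<close> by blast
  next
    case False
    show ?thesis
    proof (cases "\<exists>f. corner (D - {d}) f \<and> f \<noteq> c")
      case True
      then obtain f where f: "corner (D - {d}) f" "f \<noteq> c" by blast
      have cd: "card (D - {d}) = card D - 1" using card_remove[OF D d] .
      then obtain g x y where g: "g \<in> G (card D - 1)" and x: "x \<in> LE (D - {d} - {c})"
        and y: "y \<in> LE (D - {d} - {c})" and gx: "last (g (x @ [c])) = c" and gy: "last (g (y @ [c])) \<noteq> c"
        using less.hyps[OF _ Dd dc'(2) f less.prems(5)] c2 unfolding cd by fastforce
      have xc: "u @ [c] \<in> LE (D - {d})" "u @ [d] \<in> LE (D - {c})" if "u \<in> LE (D - {d} - {c})" for u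
        using LE_snoc2[OF D d c dc that] by blast+
      have gl: "g (u @ [c]) \<in> LE (D - {d})" "g (u @ [c, d]) = g (u @ [c]) @ [d]"
        if "u \<in> LE (D - {d} - {c})" for u
        using G_LE[OF g xc(1)[OF that]] G_snoc[OF g xc(1)[OF that] cd, of d] by auto
      have t1: "?t (u @ [d, c]) = u @ [c, d]" if "u \<in> LE (D - {d} - {c})" for u
        using bk_corners(1)[OF D d c dc that] .
      have ne: "D - {d} \<noteq> {}" using c dc by (auto simp: corner_def)
      \<comment> \<open>\<open>?t\<close> puts \<open>d\<close> last, \<open>g\<close> acts on the
        tableaux of \<open>D - {d}\<close>, and \<open>?t\<close> exchanges back. Where
        \<open>g\<close> produces a last box \<open>k\<close> other than \<open>c\<close>, the
        result ends in \<open>d\<close> or \<open>k\<close>, never in \<open>c\<close>.\<close>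
      let ?h = "?t \<circ> (g \<circ> ?t)"
      have h: "?h \<in> G (card D)" using G_comp[OF t G_comp[OF G_mono[OF g] t]] by simp
      obtain x' where x': "g (x @ [c]) = x' @ [c]" "x' \<in> LE (D - {d} - {c})"
        using LE_snocE[OF gl(1)[OF x] ne] gx by (metis last_snoc)
      obtain y' k where y': "g (y @ [c]) = y' @ [k]" "corner (D - {d}) k" "y' \<in> LE (D - {d} - {k})" "k \<noteq> c"
        using LE_snocE[OF gl(1)[OF y] ne] gy by (metis last_snoc)
      have "?h ((x @ [d]) @ [c]) = x' @ [d, c]"
        using t1[OF x] gl(2)[OF x] x'(1) bk_corners(2)[OF D d c dc x'(2)] by simp
      moreover have "last (?h ((y @ [d]) @ [c])) \<noteq> c"
        using t1[OF y] gl(2)[OF y] y' bk_last'[of y' D d k] d dc by (auto simp: corner_def)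
      ultimately have "last (?h ((x @ [d]) @ [c])) = c" "last (?h ((y @ [d]) @ [c])) \<noteq> c" by auto
      then show ?thesis using h xc(2)[OF x] xc(2)[OF y] by blast
    next
      case no: False
      \<comment> \<open>Now \<open>c\<close> is the only corner of \<open>D - {d}\<close>, which is
        a rectangle. Removing \<open>c\<close> from \<open>D\<close> makes its left or upper
        neighbour a corner comparable to \<open>c\<close>, contrary to the case assumption. The
        excluded positions of \<open>c\<close> are those where this neighbour is missing or still
        has \<open>d\<close> beside it.\<close>
      obtain p q i j where [simp]: "c = (p, q)" "d = (i, j)" by (cases c, cases d)
      have le: "k \<le> p \<and> l \<le> q" if "(k, l) \<in> D" "(k, l) \<noteq> d" for k l
      proof -
        have "(k, l) \<in> D - {d}" using that by blast
        then obtain f where "corner (D - {d}) f" "k \<le> fst f" "l \<le> snd f"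
          using corner_above[OF Dd] by (metis fst_conv snd_conv)
        then show ?thesis using no by (metis \<open>c = (p, q)\<close> fst_conv snd_conv)
      qed
      have mem: "(p, q) \<in> D" "(i, j) \<in> D" using c d by (auto simp: corner_def)
      have pos: "1 \<le> p" "1 \<le> q" "1 \<le> i" "1 \<le> j" using young_pos[OF D mem(1)] young_pos[OF D mem(2)]
        by simp_all
      have nc: False if "corner (D - {c}) (k, l)" "k \<le> p" "l \<le> q" for k l
      proof -
        have "incmp (k, l) c" using False that(1) by blast
        then show False using that(2,3) by (simp add: incmp_def)
      qed
      have inc: "incmp (p, q) (i, j)" using corner_incmp[OF D c d dc[symmetric]] by simp
      then consider "i < p" "q < j" | "p < i" "j < q" unfolding incmp_def by auto
      then have False
      proof cases
        case 1
        show False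
        proof (cases "q = 1")
          case True
          then have "p \<ge> 3" using less.prems(5) pos by auto
          then obtain r where r: "p = Suc r" "r \<ge> 2" by (cases p) auto
          have "(1, 2) \<in> D" using youngD[OF D mem(2), of 1 2] 1 pos True by simp
          then have "d = (1, 2)" using le[of 1 2] True by fastforce
          then have "(r, 2) \<notin> D" using le[of r 2] True r by force
          moreover have "(r, 1) \<in> D" using youngD[OF D mem(1), of r 1] r True by simp
          ultimately have "corner (D - {c}) (r, 1)"
            unfolding corner_iff[OF Dc] using r True by (simp add: numeral_2_eq_2)
          then show False using nc[of r 1] r True by simp
        next
          case False
          then obtain s where s: "q = Suc s" "s \<ge> 1" using pos by (cases q) auto
          have "(Suc p, s) \<notin> D" using le[of "Suc p" s] 1 by force
          moreover have "(p, s) \<in> D" using youngD[OF D mem(1), of p s] s pos by simp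
          ultimately have "corner (D - {c}) (p, s)"
            unfolding corner_iff[OF Dc] using s by simp
          then show False using nc[of p s] s by simp
        qed
      next
        case 2
        show False
        proof (cases "p = 1")
          case True
          then have "q \<ge> 3" using less.prems(5) pos by auto
          then obtain s where s: "q = Suc s" "s \<ge> 2" by (cases q) auto
          have "(2, 1) \<in> D" using youngD[OF D mem(2), of 2 1] 2 pos True by simp
          then have "d = (2, 1)" using le[of 2 1] True by fastforce
          then have "(2, s) \<notin> D" using le[of 2 s] True s by force
          moreover have "(1, s) \<in> D" using youngD[OF D mem(1), of 1 s] s True by simp
          ultimately have "corner (D - {c}) (1, s)"
            unfolding corner_iff[OF Dc] using s True by (simp add: numeral_2_eq_2)
          then show False using nc[of 1 s] s True by simp
        next
          case False
          then obtain r where r: "p = Suc r" "r \<ge> 1" using pos by (cases p) auto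
          have "(r, Suc q) \<notin> D" using le[of r "Suc q"] 2 by force
          moreover have "(r, q) \<in> D" using youngD[OF D mem(1), of r q] r pos by simp
          ultimately have "corner (D - {c}) (r, q)"
            unfolding corner_iff[OF Dc] using r by simp
          then show False using nc[of r q] r by simp
        qed
      qed
      then show ?thesis ..
    qed
  qed
qed

section \<open>Lifting 3-cycles from a smaller shape\<close>

definition triv :: "(box list \<Rightarrow> box list) \<Rightarrow> box set \<Rightarrow> bool" where
  "triv g D \<longleftrightarrow> (\<forall>xs\<in>LE D. g xs = xs)"

definition full :: "box set \<Rightarrow> bool" where
  "full D \<longleftrightarrow> (\<forall>x\<in>LE D. \<forall>y\<in>LE D. \<forall>z\<in>LE D. x \<noteq> y \<longrightarrow> y \<noteq> z \<longrightarrow> x \<noteq> z \<longrightarrow>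
     (\<exists>g\<in>G (card D). cyc g (LE D) x y z))"

text \<open>\<open>h\<close> never moves the last box, so it acts on \<open>LE D\<close> separately
  for each last box \<open>k\<close>, through its action on \<open>LE (D - {k})\<close>.\<close>

lemma cyc_lift:
  assumes D: "young D" and c: "corner D c" and h: "h \<in> G (card D - 1)" "cyc h (LE (D - {c})) x y z"
    and triv: "\<And>k. corner D k \<Longrightarrow> k \<noteq> c \<Longrightarrow> triv h (D - {k})"
  shows "cyc h (LE D) (x @ [c]) (y @ [c]) (z @ [c])"
proof -
  note p = cyc_points[OF h(2)]
  have ap: "h (u @ [k]) = h u @ [k]" if "corner D k" "u \<in> LE (D - {k})" for u k
    using G_snoc[OF h(1) that(2)] card_remove[OF D that(1)] by simp
  have "h v = v" if v: "v \<in> LE D" "v \<noteq> x @ [c]" "v \<noteq> y @ [c]" "v \<noteq> z @ [c]" for v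
  proof -
    have "D \<noteq> {}" using c by (auto simp: corner_def)
    then obtain u k where u: "v = u @ [k]" "corner D k" "u \<in> LE (D - {k})"
      using LE_snocE[OF v(1)] by metis
    have "h u = u"
    proof (cases "k = c")
      case True
      then show ?thesis using cyc_fixes[OF h(2)] u v by auto
    next
      case False
      then show ?thesis using triv[OF u(2)] u(3) by (auto simp: triv_def)
    qed
    then show ?thesis using ap u by simp
  qed
  then show ?thesis
    unfolding cyc_def using p ap[OF c] LE_snocI[OF D c] by auto
qed

lemma avoid_points:
  assumes "card S > length xs"
  obtains v where "v \<in> S" "v \<notin> set xs"
proof -
  have "\<not> S \<subseteq> set xs"
    using assms card_mono[of "set xs" S] card_length[of xs] by auto
  then show ?thesis using that by blast
qed

text \<open>The linked class of \<open>x0 @ [c]\<close> contains all tableaux ending in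
  \<open>c\<close> and, as these are no block, one ending in another corner \<open>k\<close>.
  Transitivity below a fixed last box adds everything ending in \<open>k\<close>, and the last
  involution carries the class to any further corner \<open>l\<close>.\<close>

lemma full_step:
  assumes D: "young D" "(2, 2) \<in> D" and c: "corner D c" and three: "card (LE (D - {c})) \<ge> 3"
    and h: "\<And>x y z. x \<in> LE (D - {c}) \<Longrightarrow> y \<in> LE (D - {c}) \<Longrightarrow> z \<in> LE (D - {c}) \<Longrightarrow>
      x \<noteq> y \<Longrightarrow> y \<noteq> z \<Longrightarrow> x \<noteq> z \<Longrightarrow> \<exists>h\<in>G (card D). cyc h (LE D) (x @ [c]) (y @ [c]) (z @ [c])"
  shows "full D"
proof -
  interpret perm_group "G (card D)" "LE D" by (rule perm_group_G)
  have ne: "D \<noteq> {}" using D by auto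
  have lc: "linked (x @ [c]) (y @ [c])" if xy: "x \<in> LE (D - {c})" "y \<in> LE (D - {c})" for x y
  proof (cases "x = y")
    case False
    obtain z where "z \<in> LE (D - {c})" "z \<noteq> x" "z \<noteq> y" 
      using avoid_points[of "[x, y]" "LE (D - {c})"] three by auto
    then show ?thesis using h[OF xy] False unfolding linked_def by metis
  qed (simp add: linked_def)
  obtain x0 where x0: "x0 \<in> LE (D - {c})" using LE_nonempty corner_young[OF c] by blast
  have all: "linked (x0 @ [c]) u" if u: "u \<in> LE D" for u
  proof (cases "\<exists>d. corner D d \<and> d \<noteq> c")
    case False
    then show ?thesis using LE_snocE[OF u ne] lc[OF x0] by metis
  next
    case True
    then obtain d where d: "corner D d" "d \<noteq> c" by blast
    have "c \<notin> {(1, 1), (1, 2), (2, 1)}"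
      using c D unfolding corner_iff[OF D(1)]
      using youngD[OF D, of 1 2] youngD[OF D, of 2 1] by (auto simp: numeral_2_eq_2)
    then obtain g x y where g: "g \<in> G (card D)" and xy: "x \<in> LE (D - {c})" "y \<in> LE (D - {c})"
      "last (g (x @ [c])) = c" "last (g (y @ [c])) \<noteq> c"
      using last_box_not_block[OF D(1) c d] by blast
    have gc: "g (v @ [c]) \<in> LE D" if "v \<in> LE (D - {c})" for v
      using G_LE[OF g LE_snocI[OF D(1) c that]] .
    obtain x' where x': "g (x @ [c]) = x' @ [c]" "x' \<in> LE (D - {c})"
      using LE_snocE[OF gc[OF xy(1)] ne] xy(3) by (metis last_snoc)
    obtain y' k where y': "g (y @ [c]) = y' @ [k]" "corner D k" "y' \<in> LE (D - {k})" "k \<noteq> c"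
      using LE_snocE[OF gc[OF xy(2)] ne] xy(4) by (metis last_snoc)
    have lk: "linked (x0 @ [c]) (y' @ [k])"
      using linked_conj[OF lc[OF xy(1,2)] g] x' y' lc[OF x0 x'(2)] linked_trans by metis
    have spread: "linked (x0 @ [c]) (w @ [l])"
      if l: "corner D l" and vl: "v \<in> LE (D - {l})" "w \<in> LE (D - {l})"
        and v: "linked (x0 @ [c]) (v @ [l])" for l v w
    proof -
      obtain g where g: "g \<in> G (card D - 1)" "g v = w"
        using LE_transitive[OF vl] card_remove[OF D(1) l] by metis
      have "g (x0 @ [c]) = g x0 @ [c]" "g (v @ [l]) = w @ [l]"
        using G_snoc[OF g(1)] x0 vl(1) card_remove[OF D(1)] c l g(2) by auto
      then have "linked (g x0 @ [c]) (w @ [l])"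
        using linked_conj[OF v G_mono[OF g(1)]] by simp
      then show ?thesis
        using lc[OF x0 G_LE[OF g(1) x0]] linked_trans by blast
    qed
    let ?t = "bk (card D - 2)"
    have t: "?t \<in> G (card D)"
      using G_bk card_ge_two[OF D(1), of c d] c d by (auto simp: corner_def)
    have yz: "\<exists>v. v \<in> LE (D - {c} - {l})" if "corner D l" "l \<noteq> c" for l
      using LE_nonempty[OF corner_young[OF corner_remove[OF D(1) c that(1)]]] that by simp
    obtain z where z: "z \<in> LE (D - {c} - {k})" using yz y' by blast
    note zk = LE_snoc2[OF D(1) c y'(2) y'(4)[symmetric] z]
    have lz: "linked (x0 @ [c]) (z @ [c, k])"
      using spread[OF y'(2,3) zk(1) lk] by simp
    obtain u' l where u': "u = u' @ [l]" "corner D l" "u' \<in> LE (D - {l})"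
      using LE_snocE[OF u ne] .
    show ?thesis
    proof (cases "l = c")
      case True
      then show ?thesis using lc x0 u' by simp
    next
      case False
      obtain v where v: "v \<in> LE (D - {c} - {l})" using yz u' False by blast
      note vl = LE_snoc2[OF D(1) c u'(2) False[symmetric] v]
      \<comment> \<open>Applying the last involution to both sides makes \<open>l\<close> last on
        the left and \<open>c\<close> last on the right.\<close>
      have "linked (v @ [l, c]) (z @ [c, k])"
        using linked_trans[OF lc[OF vl(2) x0] lz] by simp
      then have "linked (v @ [c, l]) (z @ [k, c])"
        using linked_conj[OF _ t] bk_corners(2)[OF D(1) c u'(2) False[symmetric] v]
          bk_corners(1)[OF D(1) c y'(2) y'(4)[symmetric] z] by metis
      moreover have "linked (x0 @ [c]) (z @ [k, c])"
        using lc[OF x0 zk(2)] by simp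
      ultimately have "linked (x0 @ [c]) (v @ [c, l])"
        using linked_sym linked_trans by blast
      then show ?thesis
        using spread[OF u'(2) vl(1) u'(3)] u'(1) by simp
    qed
  qed
  show ?thesis
    unfolding full_def using all_linked_imp_cyc[OF all] by blast
qed

section \<open>Separating shapes\<close>

definition good :: "box set \<Rightarrow> bool" where
  "good D \<longleftrightarrow> young D \<and> (2, 2) \<in> D \<and> tr D \<noteq> D"

definition loc :: "box set \<Rightarrow> bool" where
  "loc D \<longleftrightarrow> (\<forall>x\<in>LE D. \<forall>y\<in>LE D. \<forall>z\<in>LE D. x \<noteq> y \<longrightarrow> y \<noteq> z \<longrightarrow> x \<noteq> z \<longrightarrow>
     (\<exists>g\<in>G (card D). cyc g (LE D) x y z \<and>
        (\<forall>E. young E \<longrightarrow> card E = card D \<longrightarrow> E \<noteq> D \<longrightarrow> E \<noteq> tr D \<longrightarrow> triv g E)))"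

text \<open>One 3-cycle and one other shape: \<open>sep_imp_cyc\<close> passes to all 3-cycles and
  \<open>loc_if_sep\<close> to all shapes at once, so \<open>loc\<close> reduces to pairs of
  shapes.\<close>

definition sep :: "box set \<Rightarrow> box set \<Rightarrow> bool" where
  "sep D E \<longleftrightarrow> (\<exists>g\<in>G (card D). \<exists>x y z. cyc g (LE D) x y z \<and> triv g E)"

lemma three_points:
  assumes "card S \<ge> 3"
  obtains x y z where "x \<in> S" "y \<in> S" "y \<noteq> x" "z \<in> S" "z \<noteq> x" "z \<noteq> y"
proof -
  obtain x where x: "x \<in> S" using avoid_points[of "[]" S] assms by auto
  obtain y where y: "y \<in> S" "y \<noteq> x" using avoid_points[of "[x]" S] assms by auto
  obtain z where "z \<in> S" "z \<noteq> x" "z \<noteq> y" using avoid_points[of "[x, y]" S] assms by auto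
  then show ?thesis using that x y by blast
qed

lemma map_swap_inj: "map prod.swap xs = map prod.swap ys \<longleftrightarrow> xs = ys"
  by (simp add: inj_map_eq_map)

lemma map_swap_swap [simp]: "map prod.swap (map prod.swap xs) = (xs :: box list)"
  by (simp add: comp_def)

section \<open>Words that are trivial on a given shape\<close>

lemma triv_tr:
  assumes "g \<in> G m"
  shows "triv g (tr E) \<longleftrightarrow> triv g E"
proof -
  have "triv g (tr E)" if "triv g E" for E
    unfolding triv_def
  proof
    fix xs assume "xs \<in> LE (tr E)"
    then have "map prod.swap xs \<in> LE E" using LE_tr[of xs "tr E"] by simp
    then have "g (map prod.swap xs) = map prod.swap xs" using that by (simp add: triv_def)
    then show "g xs = xs" by (simp only: G_map_swap[OF assms] map_swap_inj)
  qed
  from this[of E] this[of "tr E"] show ?thesis by auto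
qed

lemma G_finv [simp]: "g \<in> G m \<Longrightarrow> finv g (g v) = v" "g \<in> G m \<Longrightarrow> g (finv g v) = v"
  using perm_group.inv_simps[OF perm_group_G] by blast+

lemma triv_inv: "g \<in> G m \<Longrightarrow> triv g E \<Longrightarrow> triv (finv g) E"
  unfolding triv_def by (metis G_finv(1))

lemma triv_comp: "triv g E \<Longrightarrow> triv h E \<Longrightarrow> triv (g \<circ> h) E"
  by (simp add: triv_def)

lemma triv_conj:
  assumes "g \<in> G m" "k \<in> G m" "triv g E"
  shows "triv (k \<circ> g \<circ> finv k) E"
  using assms G_LE[OF G_inv[OF assms(2)]] by (simp add: triv_def)

lemma triv_commutator:
  assumes "g \<in> G m" "k \<in> G m" "triv g E \<or> triv k E"
  shows "triv (g \<circ> k \<circ> finv g \<circ> finv k) E"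
  using assms(3)
proof
  assume "triv g E"
  then have "triv (finv g) E" using triv_inv assms(1) by blast
  then show ?thesis
    using \<open>triv g E\<close> G_LE[OF G_inv[OF assms(2)]] assms(2) by (simp add: triv_def)
next
  assume "triv k E"
  then have "triv (finv k) E" using triv_inv assms(2) by blast
  then show ?thesis
    using \<open>triv k E\<close> G_LE[OF G_inv[OF assms(1)]] assms(1) by (simp add: triv_def)
qed

lemma triv_commutator_disjoint:
  assumes g: "g \<in> G m" and k: "k \<in> G m" and "\<And>v. v \<in> LE E \<Longrightarrow> g v = v \<or> k v = v"
  shows "triv (g \<circ> k \<circ> finv g \<circ> finv k) E"
  unfolding triv_def
proof
  fix v assume v: "v \<in> LE E"
  have com: "g (k u) = k (g u)" if "u \<in> LE E" for u
    using disjoint_supports_commute[OF G_bij[OF g] G_bij[OF k] G_LE[OF g] G_LE[OF k] assms(3) that] .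
  show "(g \<circ> k \<circ> finv g \<circ> finv k) v = v"
    using com[of "finv g (finv k v)"] G_LE[OF G_inv[OF g]] G_LE[OF G_inv[OF k]] v g k by simp
qed

lemma perm_group_triv: "perm_group {g \<in> G m. triv g E} (LE D)"
  by (rule perm_group.intro)
    (auto intro: G_id G_comp G_inv G_bij G_LE triv_comp triv_inv, simp add: triv_def)

text \<open>The words trivial on \<open>E\<close> are closed under conjugation. From the 3-cycle
  through \<open>a, b, c\<close>, a fifth tableau \<open>v\<close> gives a conjugator through
  \<open>b, u, v\<close> that fixes \<open>a\<close> and \<open>c\<close>, hence the 3-cycle through
  \<open>a, u, c\<close>.\<close>

lemma sep_imp_cyc:
  assumes full: "full D" and five: "card (LE D) \<ge> 5" and sep: "sep D E"
    and xyz: "x \<in> LE D" "y \<in> LE D" "z \<in> LE D" "x \<noteq> y" "y \<noteq> z" "x \<noteq> z"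
  shows "\<exists>g\<in>G (card D). cyc g (LE D) x y z \<and> triv g E"
proof -
  interpret perm_group "{g \<in> G (card D). triv g E}" "LE D" by (rule perm_group_triv)
  obtain g a b c where g: "g \<in> G (card D)" "cyc g (LE D) a b c" "triv g E"
    using sep by (auto simp: sep_def)
  note abc = cyc_points[OF g(2)]
  have "linked a u" if u: "u \<in> LE D" for u
  proof (cases "u \<in> {a, b, c}")
    case True
    then show ?thesis
      using g cyc_rot[OF cyc_inv[OF G_bij[OF g(1)] g(2)]] cyc_inv[OF G_bij[OF g(1)] g(2)]
        G_inv[OF g(1)] triv_inv[OF g(1,3)] unfolding linked_def by blast
  next
    case False
    obtain v where v: "v \<in> LE D" "v \<notin> set [a, b, c, u]"
      using avoid_points[of "[a, b, c, u]" "LE D"] five by auto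
    then obtain k where k: "k \<in> G (card D)" "cyc k (LE D) b u v"
      using full abc u False unfolding full_def by (metis insertCI list.set(2))
    have "k a = a" "k c = c" "k b = u"
      using cyc_points[OF k(2)] cyc_fixes[OF k(2)] abc v False by auto
    then have "cyc (k \<circ> g \<circ> finv k) (LE D) a u c"
      using perm_group.conj_mem(2)[OF perm_group_G k(1) g(1,2)] by simp
    moreover have "k \<circ> g \<circ> finv k \<in> {g \<in> G (card D). triv g E}"
      using triv_conj[OF g(1) k(1) g(3)] G_comp G_inv k g by blast
    ultimately show ?thesis unfolding linked_def by blast
  qed
  then show ?thesis using all_linked_imp_cyc[of a x y z] xyz by blast
qed

lemma young_bounded:
  assumes E: "young E" and "(i, j) \<in> E"
  shows "i \<le> card E" "j \<le> card E"
proof -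
  have "(\<lambda>k. (k, j)) ` {1..i} \<subseteq> E" "(\<lambda>k. (i, k)) ` {1..j} \<subseteq> E"
    using youngD[OF E assms(2)] young_pos[OF E assms(2)] by auto
  then have "card ((\<lambda>k. (k, j)) ` {1..i}) \<le> card E" "card ((\<lambda>k. (i, k)) ` {1..j}) \<le> card E"
    using card_mono young_finite[OF E] by blast+
  then show "i \<le> card E" "j \<le> card E"
    by (simp_all add: card_image inj_on_def)
qed

lemma finite_young_card: "finite {E. young E \<and> card E = n}"
proof (rule finite_subset)
  show "{E. young E \<and> card E = n} \<subseteq> Pow ({..n} \<times> {..n})"
    using young_bounded by fastforce
qed simp

text \<open>There are finitely many shapes, added one at a time: a 3-cycle trivial on
  \<open>F\<close> and one trivial on \<open>E\<close> that meet only in \<open>x\<close> have a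
  commutator trivial on both. Together they occupy five tableaux.\<close>

lemma loc_if_sep:
  assumes full: "full D" and five: "card (LE D) \<ge> 5"
    and sep: "\<And>E. young E \<Longrightarrow> card E = card D \<Longrightarrow> E \<noteq> D \<Longrightarrow> E \<noteq> tr D \<Longrightarrow> sep D E"
  shows "loc D"
proof -
  have *: "\<forall>x\<in>LE D. \<forall>y\<in>LE D. \<forall>z\<in>LE D. x \<noteq> y \<longrightarrow> y \<noteq> z \<longrightarrow> x \<noteq> z \<longrightarrow>
     (\<exists>g\<in>G (card D). cyc g (LE D) x y z \<and> (\<forall>E\<in>F. triv g E))"
    if "finite F" "\<And>E. E \<in> F \<Longrightarrow> sep D E" for F
    using that
  proof (induction F rule: finite_induct)
    case empty
    then show ?case using full by (simp add: full_def)
  next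
    case (insert E F)
    show ?case
    proof (intro ballI impI)
      fix x b c assume xbc: "x \<in> LE D" "b \<in> LE D" "c \<in> LE D" "x \<noteq> b" "b \<noteq> c" "x \<noteq> c"
      obtain z where z: "z \<in> LE D" "z \<notin> set [x, b, c]"
        using avoid_points[of "[x, b, c]" "LE D"] five by auto
      obtain w where w: "w \<in> LE D" "w \<notin> set [x, b, c, z]"
        using avoid_points[of "[x, b, c, z]" "LE D"] five by auto
      have "\<exists>g\<in>G (card D). cyc g (LE D) x b z \<and> (\<forall>E\<in>F. triv g E)"
        using insert xbc z by auto
      then obtain a where a: "a \<in> G (card D)" "cyc a (LE D) x b z" "\<forall>E\<in>F. triv a E" by blast
      have "\<exists>g\<in>G (card D). cyc g (LE D) x c w \<and> triv g E"
        using sep_imp_cyc[OF full five, of E x c w] insert.prems xbc w by auto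
      then obtain a' where a': "a' \<in> G (card D)" "cyc a' (LE D) x c w" "triv a' E" by blast
      let ?f = "a \<circ> a' \<circ> finv a \<circ> finv a'"
      have "cyc ?f (LE D) x b c"
        using cyc_commutator[OF G_bij[OF a(1)] G_bij[OF a'(1)] a(2) a'(2)] xbc z w by auto
      moreover have "\<forall>E\<in>insert E F. triv ?f E"
        using triv_commutator[OF a(1) a'(1)] a(3) a'(3) by blast
      moreover have "?f \<in> G (card D)" using a(1) a'(1) by (intro G_comp G_inv)
      ultimately show "\<exists>g\<in>G (card D). cyc g (LE D) x b c \<and> (\<forall>E\<in>insert E F. triv g E)" by blast
    qed
  qed
  let ?F = "{E. young E \<and> card E = card D} - {D, tr D}"
  have "finite ?F" "\<And>E. E \<in> ?F \<Longrightarrow> sep D E"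
    using finite_young_card sep by auto
  from *[OF this] show ?thesis unfolding loc_def by fastforce
qed

text \<open>Correct \<open>h\<close> on \<open>E\<close> by a 3-cycle that is invisible on \<open>D\<close>.\<close>

lemma sep_flip:
  assumes "\<And>x y z. x \<in> LE E \<Longrightarrow> y \<in> LE E \<Longrightarrow> z \<in> LE E \<Longrightarrow> x \<noteq> y \<Longrightarrow> y \<noteq> z \<Longrightarrow> x \<noteq> z \<Longrightarrow>
      \<exists>k\<in>G (card D). cyc k (LE E) x y z \<and> triv k D"
    and h: "h \<in> G (card D)" "cyc h (LE D) x y z" "cyc h (LE E) x' y' z'"
  shows "sep D E"
proof -
  note p = cyc_points[OF h(3)]
  obtain k where k: "k \<in> G (card D)" "cyc k (LE E) x' z' y'" "triv k D"
    using assms(1)[of x' z' y'] p by metis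
  have "triv (h \<circ> k) E"
    unfolding triv_def
  proof
    fix v assume "v \<in> LE E"
    then show "(h \<circ> k) v = v"
      using p cyc_points[OF k(2)] cyc_fixes[OF h(3), of v] cyc_fixes[OF k(2), of v]
      by (cases "v = x' \<or> v = y' \<or> v = z'") auto
  qed
  moreover have "cyc (h \<circ> k) (LE D) x y z"
    using h(2) k(3) unfolding cyc_def triv_def by simp
  ultimately show ?thesis
    unfolding sep_def using G_comp[OF h(1) k(1)] by blast
qed

text \<open>\<open>c\<close> survives in \<open>D - {k}\<close>, so its mirror image lies in
  \<open>D\<close>; but that box is missing from the transpose of \<open>D - {c}\<close>, so it is
  \<open>k\<close>. Hence, if \<open>D\<close> is not self-transpose, the exempted shape
  \<open>tr (D - {c})\<close> never occurs among the other \<open>D - {k}\<close>.\<close>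

lemma cover_eq_tr_cover:
  assumes "c \<in> D" "k \<in> D" "k \<noteq> c" "D - {k} = tr (D - {c})"
  shows "k = prod.swap c" "tr D = D"
proof -
  obtain p q where [simp]: "c = (p, q)" by (cases c)
  have e: "D - {k} = tr D - {(q, p)}" using assms(4) by auto
  have "(p, q) \<in> D - {k}" using assms(1,3) by simp
  then have "(p, q) \<in> tr D" unfolding e by blast
  then have "(q, p) \<in> D" by simp
  then have k: "k = (q, p)" using e by blast
  then show "k = prod.swap c" by simp
  have "(q, p) \<in> D" "(q, p) \<in> tr D" using assms(1,2) k by simp_all
  then have "insert (q, p) (D - {(q, p)}) = D" "insert (q, p) (tr D - {(q, p)}) = tr D"
    by (simp_all only: insert_Diff)
  then show "tr D = D" using e k by metis
qed

lemma loc_lift: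
  assumes D: "young D" and c: "corner D c" and loc: "loc (D - {c})" and nt: "tr D \<noteq> D"
    and xyz: "x \<in> LE (D - {c})" "y \<in> LE (D - {c})" "z \<in> LE (D - {c})" "x \<noteq> y" "y \<noteq> z" "x \<noteq> z"
  shows "\<exists>h\<in>G (card D - 1). cyc h (LE D) (x @ [c]) (y @ [c]) (z @ [c]) \<and> cyc h (LE (D - {c})) x y z \<and>
    (\<forall>E. young E \<longrightarrow> card E = card D - 1 \<longrightarrow> E \<noteq> D - {c} \<longrightarrow> E \<noteq> tr (D - {c}) \<longrightarrow> triv h E)"
proof -
  note cd = card_remove[OF D c]
  obtain h where h: "h \<in> G (card D - 1)" "cyc h (LE (D - {c})) x y z"
    "\<forall>E. young E \<longrightarrow> card E = card D - 1 \<longrightarrow> E \<noteq> D - {c} \<longrightarrow> E \<noteq> tr (D - {c}) \<longrightarrow> triv h E"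
    using loc xyz unfolding loc_def cd by metis
  have "triv h (D - {k})" if k: "corner D k" "k \<noteq> c" for k
  proof -
    have "c \<in> D" "k \<in> D" using c k by (auto simp: corner_def)
    then have "D - {k} \<noteq> D - {c}" "D - {k} \<noteq> tr (D - {c})"
      using k(2) cover_eq_tr_cover(2)[of c D k] nt by auto
    then show ?thesis using h(3) card_remove[OF D k(1)] corner_young[OF k(1)] by blast
  qed
  then have "cyc h (LE D) (x @ [c]) (y @ [c]) (z @ [c])"
    using cyc_lift[OF D c h(1,2)] by blast
  then show ?thesis using h by blast
qed

text \<open>Apart from \<open>N - {c}\<close>, the word \<open>h\<close> can be non-trivial only on
  \<open>tr (N - {c})\<close>, which arises by removing \<open>prod.swap c\<close> from a
  self-transpose \<open>N\<close>. There it acts by mirror images, hence the second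
  alternative.\<close>

lemma loc_support:
  assumes N: "young N" and c: "corner N c" and h: "h \<in> G (card N - 1)" "cyc h (LE (N - {c})) x y z"
    "\<And>E. young E \<Longrightarrow> card E = card N - 1 \<Longrightarrow> E \<noteq> N - {c} \<Longrightarrow> E \<noteq> tr (N - {c}) \<Longrightarrow> triv h E"
    and T: "T \<in> LE N" "h T \<noteq> T"
  shows "T \<in> {x @ [c], y @ [c], z @ [c]} \<or> map prod.swap T \<in> {x @ [c], y @ [c], z @ [c]}"
proof -
  have "N \<noteq> {}" using c by (auto simp: corner_def)
  then obtain u k where u: "T = u @ [k]" "corner N k" "u \<in> LE (N - {k})"
    using LE_snocE[OF T(1)] by metis
  have hu: "h u \<noteq> u"
    using T(2) u G_snoc[OF h(1) u(3) card_remove[OF N u(2)]] by auto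
  show ?thesis
  proof (cases "k = c")
    case True
    then show ?thesis using cyc_fixes[OF h(2)] u hu by auto
  next
    case False
    have "c \<in> N" "k \<in> N" using c u by (auto simp: corner_def)
    moreover have "N - {k} \<noteq> N - {c}" using False \<open>c \<in> N\<close> by auto
    then have e: "N - {k} = tr (N - {c})"
      using h(3)[OF corner_young[OF u(2)] card_remove[OF N u(2)]] hu u(3) by (auto simp: triv_def)
    ultimately have k: "k = prod.swap c" using cover_eq_tr_cover(1)[of c N k] False by blast
    have "map prod.swap u \<in> LE (N - {c})"
      using u(3) e LE_tr[of u "tr (N - {c})"] by simp
    moreover have "h (map prod.swap u) \<noteq> map prod.swap u"
      using hu by (simp only: G_map_swap[OF h(1)] map_swap_inj not_False_eq_True)
    ultimately have "map prod.swap u \<in> {x, y, z}" using cyc_fixes[OF h(2)] by blast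
    then show ?thesis using u(1) k by auto
  qed
qed

text \<open>\<open>L\<close>, \<open>M\<close>, \<open>N\<close> are \<lambda>, \<mu>, \<nu> of the
  overview. Generators below the last one ignore the last box, so the parts of \<open>LE L\<close>
  and \<open>LE N\<close> lying over \<open>M\<close> look alike to them. The difference is whether
  the last involution moves \<open>d, c\<close> and \<open>d, c'\<close> for a corner
  \<open>d\<close> of \<open>M\<close>.\<close>

locale cover_pair =
  fixes L N M :: "box set" and c c' :: box
  assumes yL: "young L" and yN: "young N" and cL: "corner L c" and cN: "corner N c'"
    and LM: "L - {c} = M" and NM: "N - {c'} = M" and ne: "c \<noteq> c'"
    and ntL: "tr L \<noteq> L" and locM: "loc M" and fullL: "full L" and five: "card (LE M) \<ge> 5"
begin

lemma mem: "c \<in> L" "c' \<in> N" "c \<notin> M" "c' \<notin> M" "c \<notin> N" "c' \<notin> L"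
  using cL cN LM NM ne by (auto simp: corner_def)

lemma L_def: "L = insert c M" and N_def: "N = insert c' M"
  using mem LM NM by auto

lemma yM: "young M"
  using corner_young[OF cL] LM by simp

lemma cards: "card L - 1 = card M" "card N = card L" "card L \<ge> 2"
proof -
  have fM: "finite M" using yM young_finite by blast
  then show "card L - 1 = card M" "card N = card L" using L_def N_def mem by simp_all
  have "M \<noteq> {}" using five by (auto simp: LE_empty)
  then show "card L \<ge> 2" using fM L_def mem by (cases "card M") auto
qed

abbreviation t where "t \<equiv> bk (card L - 2)"

lemma t: "t \<in> G (card L)"
  using cards by (intro G_bk) simp

lemma G_M: "g \<in> G (card L - 1) \<Longrightarrow> g \<in> G (card L)"
  using G_mono by simp

lemma t_image: "t T \<in> A \<Longrightarrow> T \<in> t ` A"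
  by (metis bk_bk image_eqI)

lemma commutator_mem: "g \<in> G m \<Longrightarrow> k \<in> G m \<Longrightarrow> g \<circ> k \<circ> finv g \<circ> finv k \<in> G m"
  by (intro G_comp G_inv)

lemma t_L:
  assumes "corner M d" "u \<in> LE (M - {d})"
  shows "t (u @ [d, c]) = (if incmp d c then u @ [c, d] else u @ [d, c])"
  using bk_last'[of u L c d] assms mem LM by (auto simp: corner_def)

lemma t_N:
  assumes "corner M d" "u \<in> LE (M - {d})"
  shows "t (u @ [d, c']) = (if incmp d c' then u @ [c', d] else u @ [d, c'])"
  using bk_last'[of u N c' d] assms mem NM cards(2) by (auto simp: corner_def)

lemma snoc_M: "corner M d \<Longrightarrow> u \<in> LE (M - {d}) \<Longrightarrow> u @ [d] \<in> LE M"
  using LE_snocI[OF yM] by blast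

text \<open>The word comes from \<open>loc M\<close>. On \<open>N\<close> it is confined to the
  tableaux over the same three of \<open>M\<close> and their mirror images. Mirror images arise only
  for self-transpose \<open>N\<close>, so an exact 3-cycle on \<open>N\<close> is claimed in the
  other case.\<close>

lemma exists_h:
  assumes "x \<in> LE M" "y \<in> LE M" "z \<in> LE M" "x \<noteq> y" "y \<noteq> z" "x \<noteq> z"
  shows "\<exists>h\<in>G (card L). cyc h (LE L) (x @ [c]) (y @ [c]) (z @ [c]) \<and>
    (\<forall>T\<in>LE N. h T \<noteq> T \<longrightarrow>
      T \<in> {x @ [c'], y @ [c'], z @ [c']} \<or> map prod.swap T \<in> {x @ [c'], y @ [c'], z @ [c']}) \<and>
    (tr N \<noteq> N \<longrightarrow> cyc h (LE N) (x @ [c']) (y @ [c']) (z @ [c']))"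
proof -
  obtain h where h: "h \<in> G (card L - 1)" "cyc h (LE L) (x @ [c]) (y @ [c]) (z @ [c])" "cyc h (LE M) x y z"
    and tv: "\<forall>E. young E \<longrightarrow> card E = card L - 1 \<longrightarrow> E \<noteq> M \<longrightarrow> E \<noteq> tr M \<longrightarrow> triv h E"
    using loc_lift[OF yL cL, unfolded LM, OF locM ntL assms] by blast
  have hN: "h \<in> G (card N - 1)" "cyc h (LE (N - {c'})) x y z" using h cards NM by auto
  have "T \<in> {x @ [c'], y @ [c'], z @ [c']} \<or> map prod.swap T \<in> {x @ [c'], y @ [c'], z @ [c']}"
    if "T \<in> LE N" "h T \<noteq> T" for T
    using loc_support[OF yN cN hN _ that] tv cards NM by metis
  moreover have "cyc h (LE N) (x @ [c']) (y @ [c']) (z @ [c'])" if "tr N \<noteq> N"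
  proof (rule cyc_lift[OF yN cN hN])
    fix k assume k: "corner N k" "k \<noteq> c'"
    have "k \<in> N" using k by (simp add: corner_def)
    then have "N - {k} \<noteq> M" "N - {k} \<noteq> tr M"
      using k(2) cover_eq_tr_cover(2)[of c' N k] that mem NM by auto
    then show "triv h (N - {k})"
      using tv card_remove[OF yN k(1)] corner_young[OF k(1)] cards by metis
  qed
  ultimately show ?thesis using G_M[OF h(1)] h(2) by blast
qed

lemma conj_t:
  assumes "h \<in> G (card L)" "cyc h (LE L) x y z"
  shows "t \<circ> h \<circ> t \<in> G (card L)" "cyc (t \<circ> h \<circ> t) (LE L) (t x) (t y) (t z)"
  using perm_group.conj_mem[OF perm_group_G t assms] by simp_all

text \<open>A corner \<open>d\<close> below \<open>c'\<close> only: the involution \<open>t\<close> commutes on \<open>N\<close> with 3-cycles ending in \<open>d, c'\<close>.\<close>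

lemma sep_below_other:
  assumes d: "corner M d" "incmp d c" "\<not> incmp d c'" and three: "card (LE (M - {d})) \<ge> 3"
  shows "sep L N"
proof -
  obtain x0 y0 z0 where x0: "x0 \<in> LE (M - {d})" and y0: "y0 \<in> LE (M - {d})" "y0 \<noteq> x0"
    and z0: "z0 \<in> LE (M - {d})" "z0 \<noteq> x0" "z0 \<noteq> y0"
    using three_points[OF three] .
  let ?x = "x0 @ [d]" and ?y = "y0 @ [d]" and ?z = "z0 @ [d]"
  have xyz: "?x \<in> LE M" "?y \<in> LE M" "?z \<in> LE M" using snoc_M d(1) x0 y0 z0 by auto
  have xyz_ne: "?x \<noteq> ?y" "?y \<noteq> ?z" "?x \<noteq> ?z" using y0 z0 by auto
  obtain h where h: "h \<in> G (card L)" "cyc h (LE L) (?x @ [c]) (?y @ [c]) (?z @ [c])"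
    and hN: "\<forall>T\<in>LE N. h T \<noteq> T \<longrightarrow>
      T \<in> {?x @ [c'], ?y @ [c'], ?z @ [c']} \<or> map prod.swap T \<in> {?x @ [c'], ?y @ [c'], ?z @ [c']}"
    using exists_h[OF xyz xyz_ne] by blast
  note hp = cyc_points[OF h(2)]
  have tf: "t (u @ [d, c']) = u @ [d, c']" if "u \<in> LE (M - {d})" for u
    using t_N[OF d(1) that] d(3) by simp
  have tm: "t (u @ [d, c]) = u @ [c, d]" "t (u @ [c, d]) = u @ [d, c]" if "u \<in> LE (M - {d})" for u
    using t_L[OF d(1) that] d(2) bk_bk[of "card L - 2" "u @ [d, c]"] by auto
  \<comment> \<open>On \<open>N\<close> this commutator is trivial, because \<open>t\<close> fixes
    what \<open>h\<close> moves. On \<open>L\<close> it is a product of two disjoint 3-cycles, on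
    tableaux ending in \<open>d, c\<close> and in \<open>c, d\<close>, so a further commutator is
    needed to isolate one 3-cycle.\<close>
  define k where "k = h \<circ> t \<circ> finv h \<circ> t"
  have kG: "k \<in> G (card L)" unfolding k_def using h(1) t by (intro G_comp G_inv)
  have "triv (h \<circ> t \<circ> finv h \<circ> finv t) N"
  proof (rule triv_commutator_disjoint[OF h(1) t])
    fix T assume T: "T \<in> LE N"
    have "t T = T" if "h T \<noteq> T"
      using hN[rule_format, OF T that]
    proof
      assume "T \<in> {?x @ [c'], ?y @ [c'], ?z @ [c']}"
      then show ?thesis using tf x0 y0(1) z0(1) by auto
    next
      assume "map prod.swap T \<in> {?x @ [c'], ?y @ [c'], ?z @ [c']}"
      then have "t (map prod.swap T) = map prod.swap T" using tf x0 y0(1) z0(1) by auto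
      then show ?thesis by (simp only: bk_map_swap map_swap_inj)
    qed
    then show "h T = T \<or> t T = T" by blast
  qed
  then have kN: "triv k N" by (simp add: k_def)
  obtain a where a: "a \<in> LE M" "a \<notin> set [?x, ?y, ?z]" using avoid_points[of "[?x, ?y, ?z]" "LE M"] five
    by auto
  obtain b where b: "b \<in> LE M" "b \<notin> set [?x, ?y, ?z, a]"
    using avoid_points[of "[?x, ?y, ?z, a]" "LE M"] five by auto
  let ?p = "x0 @ [c, d]" and ?q = "z0 @ [c, d]"
  have dc: "d \<noteq> c" using d(1) mem by (auto simp: corner_def)
  have LcL: "u @ [c] \<in> LE L" if "u \<in> LE M" for u using LE_snocI[OF yL cL] that LM by simp
  have hfix: "h v = v" if "v \<in> LE L" "v \<notin> {?x @ [c], ?y @ [c], ?z @ [c]}" for v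
    using cyc_fixes[OF h(2) that(1)] that(2) by blast
  have ifix: "finv h v = v" if "v \<in> LE L" "v \<notin> {?x @ [c], ?y @ [c], ?z @ [c]}" for v
    using hfix[OF that] G_finv(1)[OF h(1)] by metis
  have qL: "?p \<in> LE L" "?q \<in> LE L"
    using G_LE[OF t LcL[OF xyz(1)]] G_LE[OF t LcL[OF xyz(3)]] tm x0 z0(1) by auto
  have kp: "k ?p = ?q"
  proof -
    have "finv h (?x @ [c]) = ?z @ [c]" using hp(9) G_finv(1)[OF h(1), of "?z @ [c]"] by simp
    moreover have "h ?q = ?q" using hfix[OF qL(2)] dc by auto
    ultimately show ?thesis using tm x0 z0(1) by (simp add: k_def)
  qed
  have kf: "k (u @ [c]) = u @ [c]" if u: "u \<in> LE M" "u \<notin> {?x, ?y, ?z}" for u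
  proof -
    have tn: "t (u @ [c]) \<notin> {?x @ [c], ?y @ [c], ?z @ [c]}"
    proof
      assume "t (u @ [c]) \<in> {?x @ [c], ?y @ [c], ?z @ [c]}"
      then have "u @ [c] \<in> t ` {?x @ [c], ?y @ [c], ?z @ [c]}" by (rule t_image)
      then show False using tm x0 y0(1) z0(1) dc by auto
    qed
    have "finv h (t (u @ [c])) = t (u @ [c])" using ifix[OF G_LE[OF t LcL[OF u(1)]] tn] .
    moreover have "h (u @ [c]) = u @ [c]" using hfix[OF LcL[OF u(1)]] u(2) by blast
    ultimately show ?thesis by (simp add: k_def)
  qed
  have pa: "?p \<noteq> a @ [c]" "?p \<noteq> b @ [c]" using dc by auto
  \<comment> \<open>\<open>k\<close> moves \<open>?p\<close> to \<open>?q\<close> and fixes the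
    other two points of \<open>s\<close>, so \<open>k s k^-1 s^-1\<close> is a 3-cycle, still
    trivial on \<open>N\<close>.\<close>
  obtain s where s: "s \<in> G (card L)" "cyc s (LE L) ?p (a @ [c]) (b @ [c])"
    using fullL qL(1) LcL[OF a(1)] LcL[OF b(1)] pa a b unfolding full_def by fastforce
  have ks: "cyc (k \<circ> s \<circ> finv k) (LE L) ?q (a @ [c]) (b @ [c])"
    using perm_group.conj_mem(2)[OF perm_group_G kG s] kp kf a b by auto
  have "cyc ((k \<circ> s \<circ> finv k) \<circ> finv s) (LE L) (a @ [c]) ?p ?q"
    using cyc_comp_shared_pair[OF ks cyc_inv[OF G_bij[OF s(1)] s(2)]] z0(2) by simp
  moreover have "triv ((k \<circ> s \<circ> finv k) \<circ> finv s) N"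
    using triv_commutator[OF kG s(1)] kN by blast
  moreover have "(k \<circ> s \<circ> finv k) \<circ> finv s \<in> G (card L)"
    using commutator_mem[OF kG s(1)] .
  ultimately show ?thesis unfolding sep_def by blast
qed

lemma corner_L: "corner M d \<Longrightarrow> incmp d c \<Longrightarrow> corner L d"
  and corner_N: "corner M d \<Longrightarrow> incmp d c' \<Longrightarrow> corner N d"
  using corner_iff[OF yM, of d] corner_iff[OF yL, of d] corner_iff[OF yN, of d]
  by (auto simp: incmp_def L_def N_def)

text \<open>Conjugation by \<open>t\<close> turns a 3-cycle on tableaux ending in
  \<open>d, c\<close> into one on tableaux ending in \<open>c, d\<close>, that is, over
  \<open>L - {d}\<close>. It shares one point with a 3-cycle \<open>g\<close> lifted from
  \<open>L - {d}\<close>. On \<open>N\<close> the conjugate moves only tableaux over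
  \<open>N - {d}\<close> and mirror images of such, and there \<open>g\<close> is trivial.\<close>

lemma sep_below_neither:
  assumes d: "corner M d" "incmp d c" "incmp d c'" and three: "card (LE (M - {d})) \<ge> 3"
    and loc: "loc (L - {d})" and fiveL: "card (LE (L - {d})) \<ge> 5" and nt: "N - {d} \<noteq> tr (L - {d})"
  shows "sep L N"
proof -
  obtain x0 y0 z0 where x0: "x0 \<in> LE (M - {d})" and y0: "y0 \<in> LE (M - {d})" "y0 \<noteq> x0"
    and z0: "z0 \<in> LE (M - {d})" "z0 \<noteq> x0" "z0 \<noteq> y0"
    using three_points[OF three] .
  let ?x = "x0 @ [d]" and ?y = "y0 @ [d]" and ?z = "z0 @ [d]"
  have xyz: "?x \<in> LE M" "?y \<in> LE M" "?z \<in> LE M" using snoc_M d(1) x0 y0 z0 by auto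
  have xyz_ne: "?x \<noteq> ?y" "?y \<noteq> ?z" "?x \<noteq> ?z" using y0 z0 by auto
  obtain h where h: "h \<in> G (card L)" "cyc h (LE L) (?x @ [c]) (?y @ [c]) (?z @ [c])"
    and hN: "\<forall>T\<in>LE N. h T \<noteq> T \<longrightarrow>
      T \<in> {?x @ [c'], ?y @ [c'], ?z @ [c']} \<or> map prod.swap T \<in> {?x @ [c'], ?y @ [c'], ?z @ [c']}"
    using exists_h[OF xyz xyz_ne] by blast
  have dL: "corner L d" and dN: "corner N d" using corner_L corner_N d by auto
  have dc: "d \<noteq> c" "d \<noteq> c'" using d(1) mem by (auto simp: corner_def)
  have tm: "t (u @ [d, c]) = u @ [c, d]" "t (u @ [d, c']) = u @ [c', d]" if "u \<in> LE (M - {d})" for u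
    using t_L[OF d(1) that] t_N[OF d(1) that] d(2,3) by auto
  have Lc: "u @ [c] \<in> LE (L - {d})" if "u \<in> LE (M - {d})" for u
    using LE_snoc2(1)[OF yL cL dL dc(1)[symmetric]] that LM by simp
  have Nc: "u @ [c'] \<in> LE (N - {d})" if "u \<in> LE (M - {d})" for u
    using LE_snoc2(1)[OF yN cN dN dc(2)[symmetric]] that NM by simp
  let ?X = "x0 @ [c]" and ?Y = "y0 @ [c]" and ?Z = "z0 @ [c]"
  obtain v where v: "v \<in> LE (L - {d})" "v \<notin> set [?X, ?Y, ?Z]"
    using avoid_points[of "[?X, ?Y, ?Z]" "LE (L - {d})"] fiveL by auto
  obtain w where w: "w \<in> LE (L - {d})" "w \<notin> set [?X, ?Y, ?Z, v]"
    using avoid_points[of "[?X, ?Y, ?Z, v]" "LE (L - {d})"] fiveL by auto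
  obtain g where g: "g \<in> G (card L - 1)" "cyc g (LE L) (?X @ [d]) (v @ [d]) (w @ [d])"
    and tv: "\<forall>E. young E \<longrightarrow> card E = card L - 1 \<longrightarrow> E \<noteq> L - {d} \<longrightarrow> E \<noteq> tr (L - {d}) \<longrightarrow> triv g E"
    using loc_lift[OF yL dL loc ntL Lc[OF x0] v(1) w(1)] v(2) w(2) by auto
  have "N - {d} \<noteq> L - {d}" using mem dc by blast
  then have gN: "triv g (N - {d})"
    using tv corner_young[OF dN] card_remove[OF yN dN] cards nt by metis
  have "cyc (t \<circ> h \<circ> t) (LE L) (?X @ [d]) (?Y @ [d]) (?Z @ [d])"
    using conj_t(2)[OF h] tm x0 y0(1) z0(1) by simp
  note cy = cyc_commutator[OF G_bij[OF G_M[OF g(1)]] G_bij[OF conj_t(1)[OF h]] g(2) this]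
  let ?h = "t \<circ> h \<circ> t"
  let ?f = "g \<circ> ?h \<circ> finv g \<circ> finv ?h"
  have "cyc ?f (LE L) (?X @ [d]) (v @ [d]) (?Y @ [d])"
    using cy v(2) w(2) z0(3) by auto
  moreover have "triv ?f N"
  proof (rule triv_commutator_disjoint[OF G_M[OF g(1)] conj_t(1)[OF h]])
    fix T assume T: "T \<in> LE N"
    have fx: "g ((u @ [c']) @ [d]) = (u @ [c']) @ [d]" if "u \<in> LE (M - {d})" for u
    proof -
      have "g ((u @ [c']) @ [d]) = g (u @ [c']) @ [d]"
        using G_snoc[OF g(1) Nc[OF that]] card_remove[OF yN dN] cards by simp
      then show ?thesis using gN Nc[OF that] by (simp add: triv_def)
    qed
    have "g T = T" if "?h T \<noteq> T"
    proof -
      have "h (t T) \<noteq> t T"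
      proof
        assume "h (t T) = t T"
        then have "?h T = T" by simp
        then show False using that by blast
      qed
      from hN[rule_format, OF G_LE[OF t T] this] show ?thesis
      proof
        assume "t T \<in> {?x @ [c'], ?y @ [c'], ?z @ [c']}"
        then have "T \<in> t ` {?x @ [c'], ?y @ [c'], ?z @ [c']}" by (rule t_image)
        then show ?thesis using tm x0 y0(1) z0(1) fx by auto
      next
        assume "map prod.swap (t T) \<in> {?x @ [c'], ?y @ [c'], ?z @ [c']}"
        then have "map prod.swap T \<in> t ` {?x @ [c'], ?y @ [c'], ?z @ [c']}"
          unfolding bk_map_swap[symmetric] by (rule t_image)
        then have "g (map prod.swap T) = map prod.swap T" using tm x0 y0(1) z0(1) fx by auto
        then show ?thesis by (simp only: G_map_swap[OF g(1)] map_swap_inj)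
      qed
    qed
    then show "g T = T \<or> ?h T = T" by blast
  qed
  moreover have "?f \<in> G (card L)" using commutator_mem[OF G_M[OF g(1)] conj_t(1)[OF h]] .
  ultimately show ?thesis unfolding sep_def by blast
qed

text \<open>The 3-cycle through \<open>y, y1, y2\<close> and the \<open>t\<close>-conjugate of the
  one through \<open>y, z1, z2\<close> meet on \<open>L\<close> only in \<open>y @ [c]\<close>,
  which \<open>t\<close> fixes, and have disjoint supports on \<open>N\<close>. \<open>disj\<close>
  includes mirror images since \<open>N\<close> may be self-transpose.\<close>

lemma sep_two_cycles:
  assumes pts: "y \<in> LE M" "y1 \<in> LE M" "y2 \<in> LE M" "z1 \<in> LE M" "z2 \<in> LE M"
      "distinct [y, y1, y2]" "distinct [y, z1, z2]"
    and ty: "t (y @ [c]) = y @ [c]"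
    and dist: "distinct [y1 @ [c], t (z1 @ [c]), y2 @ [c], t (z2 @ [c])]"
    and disj: "\<And>T T'. T \<in> {y @ [c'], y1 @ [c'], y2 @ [c']} \<Longrightarrow> T' \<in> {y @ [c'], z1 @ [c'], z2 @ [c']} \<Longrightarrow>
      T \<noteq> t T' \<and> T \<noteq> map prod.swap (t T')"
  shows "sep L N"
proof -
  have ne1: "y \<noteq> y1" "y1 \<noteq> y2" "y \<noteq> y2" and ne2: "y \<noteq> z1" "z1 \<noteq> z2" "y \<noteq> z2"
    using pts(6,7) by auto
  obtain a where a: "a \<in> G (card L)" "cyc a (LE L) (y @ [c]) (y1 @ [c]) (y2 @ [c])"
    and aN: "\<forall>T\<in>LE N. a T \<noteq> T \<longrightarrow>
      T \<in> {y @ [c'], y1 @ [c'], y2 @ [c']} \<or> map prod.swap T \<in> {y @ [c'], y1 @ [c'], y2 @ [c']}"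
    using exists_h[OF pts(1-3) ne1] by blast
  obtain b where b: "b \<in> G (card L)" "cyc b (LE L) (y @ [c]) (z1 @ [c]) (z2 @ [c])"
    and bN: "\<forall>T\<in>LE N. b T \<noteq> T \<longrightarrow>
      T \<in> {y @ [c'], z1 @ [c'], z2 @ [c']} \<or> map prod.swap T \<in> {y @ [c'], z1 @ [c'], z2 @ [c']}"
    using exists_h[OF pts(1,4,5) ne2] by blast
  let ?b = "t \<circ> b \<circ> t"
  let ?f = "a \<circ> ?b \<circ> finv a \<circ> finv ?b"
  note cb = conj_t[OF b]
  have "cyc ?f (LE L) (y @ [c]) (y1 @ [c]) (t (z1 @ [c]))"
    using cyc_commutator[OF G_bij[OF a(1)] G_bij[OF cb(1)] a(2) cb(2)[unfolded ty] dist] .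
  moreover have "triv ?f N"
  proof (rule triv_commutator_disjoint[OF a(1) cb(1)])
    fix T assume T: "T \<in> LE N"
    have False if "a T \<noteq> T" "?b T \<noteq> T"
    proof -
      have "b (t T) \<noteq> t T"
      proof
        assume "b (t T) = t T"
        then have "?b T = T" by simp
        then show False using that by blast
      qed
      from bN[rule_format, OF G_LE[OF t T] this] aN[rule_format, OF T that(1)] show False
        using disj[of T "t T"] disj[of T "map prod.swap (t T)"] disj[of "map prod.swap T" "t T"]
          disj[of "map prod.swap T" "map prod.swap (t T)"]
        by (auto simp only: bk_map_swap bk_bk map_swap_swap)
    qed
    then show "a T = T \<or> ?b T = T" by blast
  qed
  moreover have "?f \<in> G (card L)" using commutator_mem[OF a(1) cb(1)] .
  ultimately show ?thesis unfolding sep_def by blast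
qed

text \<open>\<open>t\<close> fixes what ends in \<open>d, c\<close>, but on \<open>N\<close> it
  takes \<open>c'\<close> away from the last place in all three tableaux of the second cycle. A
  mirror image has \<open>prod.swap c'\<close> in the last place but one, where the first cycle has
  \<open>d\<close>; \<open>de\<close> keeps these apart.\<close>

lemma sep_below_first:
  assumes d: "corner M d" "\<not> incmp d c" "incmp d c'" and de: "d \<noteq> prod.swap c'"
    and e: "corner M e" "e \<noteq> d" "incmp e c'"
    and "card (LE (M - {d})) \<ge> 3" "card (LE (M - {e})) \<ge> 2"
  shows "sep L N"
proof -
  obtain x0 x1 x2 where x0: "x0 \<in> LE (M - {d})" and x1: "x1 \<in> LE (M - {d})" "x1 \<noteq> x0"
    and x2: "x2 \<in> LE (M - {d})" "x2 \<noteq> x0" "x2 \<noteq> x1"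
    using three_points[OF assms(8)] .
  obtain w1 where w1: "w1 \<in> LE (M - {e})" using avoid_points[of "[]" "LE (M - {e})"] assms(9) by auto
  obtain w2 where w2: "w2 \<in> LE (M - {e})" "w2 \<noteq> w1" using avoid_points[of "[w1]" "LE (M - {e})"] assms(9)
    by auto
  have dc: "d \<noteq> c" "d \<noteq> c'" "e \<noteq> c" "e \<noteq> c'" using d(1) e(1) mem by (auto simp: corner_def)
  have td: "t (u @ [d, c]) = u @ [d, c]" "t (u @ [d, c']) = u @ [c', d]" if "u \<in> LE (M - {d})" for u
    using t_L[OF d(1) that] t_N[OF d(1) that] d(2,3) by auto
  have te: "t (u @ [e, c]) = (if incmp e c then u @ [c, e] else u @ [e, c])" "t (u @ [e, c']) = u @ [c', e]"
    if "u \<in> LE (M - {e})" for u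
    using t_L[OF e(1) that] t_N[OF e(1) that] e(3) by auto
  have sw: "prod.swap c' \<noteq> d" using de by simp
  show ?thesis
  proof (rule sep_two_cycles[of "x0 @ [d]" "x1 @ [d]" "x2 @ [d]" "w1 @ [e]" "w2 @ [e]"])
    show "distinct [(x1 @ [d]) @ [c], t ((w1 @ [e]) @ [c]), (x2 @ [d]) @ [c], t ((w2 @ [e]) @ [c])]"
      using te[OF w1] te[OF w2(1)] x2(3) w2(2) e(2) dc by auto
    fix T T' assume "T \<in> {(x0 @ [d]) @ [c'], (x1 @ [d]) @ [c'], (x2 @ [d]) @ [c']}"
      and "T' \<in> {(x0 @ [d]) @ [c'], (w1 @ [e]) @ [c'], (w2 @ [e]) @ [c']}"
    then have "T \<in> {x0 @ [d, c'], x1 @ [d, c'], x2 @ [d, c']}"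
      and "t T' \<in> {x0 @ [c', d], w1 @ [c', e], w2 @ [c', e]}"
      using td(2)[OF x0] te(2)[OF w1] te(2)[OF w2(1)] by auto
    then show "T \<noteq> t T' \<and> T \<noteq> map prod.swap (t T')"
      using dc sw by auto
  qed (use snoc_M[OF d(1)] snoc_M[OF e(1)] x0 x1 x2 w1 w2 e(2) td in auto)
qed

text \<open>The case \<open>d = prod.swap c'\<close> left out by \<open>sep_below_first\<close>.
  Both cycles use the same three tableaux, two of them ending in a corner \<open>f\<close> adjacent
  to neither \<open>c\<close> nor \<open>c'\<close>. The only possible collision is that of
  \<open>y0 @ [e, c']\<close> with the mirror image of \<open>y0 @ [c', e]\<close>.\<close>

lemma sep_below_first_transposed:
  assumes c'e: "e = prod.swap c'" and e: "corner M e" "\<not> incmp e c" "incmp e c'"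
    and f: "corner M f" "f \<noteq> e" "incmp f c" "incmp f c'"
    and two: "card (LE (M - {f})) \<ge> 2" and box: "(2, 2) \<in> M"
  shows "sep L N"
proof -
  obtain y0 where y0: "y0 \<in> LE (M - {e})" using LE_nonempty[OF corner_young[OF e(1)]] by blast
  obtain w1 where w1: "w1 \<in> LE (M - {f})" using avoid_points[of "[]" "LE (M - {f})"] two by auto
  obtain w2 where w2: "w2 \<in> LE (M - {f})" "w2 \<noteq> w1" using avoid_points[of "[w1]" "LE (M - {f})"] two by auto
  have dc: "e \<noteq> c" "e \<noteq> c'" "f \<noteq> c" "f \<noteq> c'" using e(1) f(1) mem by (auto simp: corner_def)
  have te: "t (y0 @ [e, c]) = y0 @ [e, c]" "t (y0 @ [e, c']) = y0 @ [c', e]"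
    using t_L[OF e(1) y0] t_N[OF e(1) y0] e(2,3) by auto
  have tf: "t (u @ [f, c]) = u @ [c, f]" "t (u @ [f, c']) = u @ [c', f]" if "u \<in> LE (M - {f})" for u
    using t_L[OF f(1) that] t_N[OF f(1) that] f(3,4) by auto
  have sw: "prod.swap e = c'" "prod.swap f \<noteq> c'" "prod.swap c' = e" using c'e f(2) by auto
  \<comment> \<open>\<open>y0\<close> contains (1, 2) or (2, 1), and neither box is its own mirror
    image.\<close>
  have y0t: "map prod.swap y0 \<noteq> y0"
  proof
    assume eq: "map prod.swap y0 = y0"
    have "(1, 2) \<in> M" "(2, 1) \<in> M" using youngD[OF yM box, of 1 2] youngD[OF yM box, of 2 1] by simp_all
    then have "(1, 2) \<in> M - {e} \<or> (2, 1) \<in> M - {e}" by (cases "e = (1, 2)") simp_all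
    moreover have "set y0 = M - {e}" using y0 by (simp add: LE_def)
    ultimately have "(1, 2) \<in> set y0 \<or> (2, 1) \<in> set y0" by (simp only:)
    moreover have "map prod.swap y0 = map id y0" using eq by (simp only: list.map_id)
    then have fixd: "\<forall>b\<in>set y0. prod.swap b = b" by (simp only: map_eq_conv id_apply)
    have "(1, 2) \<notin> set y0"
    proof
      assume "(1, 2) \<in> set y0"
      then have "prod.swap (1, 2) = (1::nat, 2::nat)" using fixd by (rule bspec[rotated])
      then show False by simp
    qed
    moreover have "(2, 1) \<notin> set y0"
    proof
      assume "(2, 1) \<in> set y0"
      then have "prod.swap (2, 1) = (2::nat, 1::nat)" using fixd by (rule bspec[rotated])
      then show False by simp
    qed
    ultimately show False by blast
  qed
  show ?thesis
  proof (rule sep_two_cycles[of "y0 @ [e]" "w1 @ [f]" "w2 @ [f]" "w1 @ [f]" "w2 @ [f]"])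
    show "distinct [(w1 @ [f]) @ [c], t ((w1 @ [f]) @ [c]), (w2 @ [f]) @ [c], t ((w2 @ [f]) @ [c])]"
      using tf[OF w1] tf[OF w2(1)] w2(2) dc by auto
    fix T T' assume "T \<in> {(y0 @ [e]) @ [c'], (w1 @ [f]) @ [c'], (w2 @ [f]) @ [c']}"
      and "T' \<in> {(y0 @ [e]) @ [c'], (w1 @ [f]) @ [c'], (w2 @ [f]) @ [c']}"
    then have "T \<in> {y0 @ [e, c'], w1 @ [f, c'], w2 @ [f, c']}"
      and "t T' \<in> {y0 @ [c', e], w1 @ [c', f], w2 @ [c', f]}"
      using te(2) tf(2)[OF w1] tf(2)[OF w2(1)] by auto
    then show "T \<noteq> t T' \<and> T \<noteq> map prod.swap (t T')"
      using dc sw y0t f(2) by auto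
  qed (use snoc_M[OF e(1)] snoc_M[OF f(1)] y0 w1 w2 f(2) te in auto)
qed

end

section \<open>Small shapes\<close>

abbreviation square :: "box set" where
  "square \<equiv> {(1, 1), (1, 2), (2, 1), (2, 2)}"

abbreviation lam32 :: "box set" where
  "lam32 \<equiv> {(1, 1), (1, 2), (1, 3), (2, 1), (2, 2)}"

lemma young_insert:
  assumes A: "young A" and "1 \<le> i" "1 \<le> j" "i = 1 \<or> (i - 1, j) \<in> A" "j = 1 \<or> (i, j - 1) \<in> A"
  shows "young (insert (i, j) A)"
  unfolding young_def
proof (intro conjI allI impI)
  show "finite (insert (i, j) A)" using young_finite[OF A] by simp
  fix k l assume kl: "(k, l) \<in> insert (i, j) A"
  then show "1 \<le> k" "1 \<le> l" using young_pos[OF A, of k l] assms(2,3) by auto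
  fix k' l' assume le: "1 \<le> k' \<and> k' \<le> k \<and> 1 \<le> l' \<and> l' \<le> l"
  show "(k', l') \<in> insert (i, j) A"
  proof (cases "(k, l) \<in> A")
    case True
    then show ?thesis using youngD[OF A True] le by blast
  next
    case False
    then have [simp]: "k = i" "l = j" using kl by auto
    consider "k' = i" "l' = j" | "k' \<le> i - 1" "i \<noteq> 1" | "l' \<le> j - 1" "j \<noteq> 1" using le by fastforce
    then show ?thesis
    proof cases
      case 2
      then show ?thesis using youngD[OF A, of "i - 1" j k' l'] assms(4) le by auto
    next
      case 3
      then show ?thesis using youngD[OF A, of i "j - 1" k' l'] assms(5) le by auto
    qed simp
  qed
qed

text \<open>Recursion over the last box with the corner condition spelled out as membership, so that
  the simplifier can enumerate the tableaux of small shapes.\<close>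

lemma LE_unfold:
  assumes "young D" "D \<noteq> {}"
  shows "LE D = (\<Union>c\<in>D. if (Suc (fst c), snd c) \<notin> D \<and> (fst c, Suc (snd c)) \<notin> D
    then (\<lambda>xs. xs @ [c]) ` LE (D - {c}) else {})" (is "_ = ?R")
proof
  show "LE D \<subseteq> ?R"
  proof
    fix ys assume "ys \<in> LE D"
    then obtain xs c where "ys = xs @ [c]" "corner D c" "xs \<in> LE (D - {c})"
      using LE_snocE assms(2) by metis
    then show "ys \<in> ?R" unfolding corner_iff[OF assms(1)] by auto
  qed
  show "?R \<subseteq> LE D"
    using LE_snocI[OF assms(1)] corner_iff[OF assms(1)] by (auto split: if_splits)
qed

lemma young_small:
  "young {(1, 1)}" "young {(1, 1), (1, 2)}" "young {(1, 1), (2, 1)}" "young {(1, 1), (1, 2), (2, 1)}"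
  "young {(1, 1), (1, 2), (1, 3)}" "young {(1, 1), (1, 2), (1, 3), (2, 1)}" "young square" "young lam32"
proof -
  show 1: "young {(1, 1)}" using young_insert[of "{}" 1 1] by simp
  have "young (insert (1, 2) {(1, 1)})" using young_insert[OF 1, of 1 2] by simp
  then show 2: "young {(1, 1), (1, 2)}" by (simp add: insert_commute)
  have "young (insert (2, 1) {(1, 1)})" using young_insert[OF 1, of 2 1] by simp
  then show "young {(1, 1), (2, 1)}" by (simp add: insert_commute)
  have "young (insert (2, 1) {(1, 1), (1, 2)})" using young_insert[OF 2, of 2 1] by simp
  then show 3: "young {(1, 1), (1, 2), (2, 1)}" by (simp add: insert_commute)
  have "young (insert (1, 3) {(1, 1), (1, 2)})" using young_insert[OF 2, of 1 3] by simp
  then show "young {(1, 1), (1, 2), (1, 3)}" by (simp add: insert_commute)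
  have "young (insert (1, 3) {(1, 1), (1, 2), (2, 1)})" using young_insert[OF 3, of 1 3] by simp
  then show 4: "young {(1, 1), (1, 2), (1, 3), (2, 1)}" by (simp add: insert_commute)
  have "young (insert (2, 2) {(1, 1), (1, 2), (2, 1)})" using young_insert[OF 3, of 2 2] by simp
  then show "young square" by (simp add: insert_commute)
  have "young (insert (2, 2) {(1, 1), (1, 2), (1, 3), (2, 1)})" using young_insert[OF 4, of 2 2] by simp
  then show "young lam32" by (simp add: insert_commute)
qed

lemma LE_1: "LE {(1, 1)} = {[(1, 1)]}"
  by (subst LE_unfold[OF young_small(1)]) (simp_all add: LE_empty)

lemma LE_2: "LE {(1, 1), (1, 2)} = {[(1, 1), (1, 2)]}" "LE {(1, 1), (2, 1)} = {[(1, 1), (2, 1)]}"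
  by (subst LE_unfold[OF young_small(2)], simp, simp add: LE_1 insert_Diff_if del: One_nat_def)
    (subst LE_unfold[OF young_small(3)], simp, simp add: LE_1 insert_Diff_if del: One_nat_def)

lemma LE_21: "LE {(1, 1), (1, 2), (2, 1)} = {[(1, 1), (1, 2), (2, 1)], [(1, 1), (2, 1), (1, 2)]}"
  by (subst LE_unfold[OF young_small(4)]) (auto simp add: LE_2 insert_Diff_if simp del: One_nat_def)

lemma LE_3: "LE {(1, 1), (1, 2), (1, 3)} = {[(1, 1), (1, 2), (1, 3)]}"
  by (subst LE_unfold[OF young_small(5)]) (simp_all add: LE_2 insert_Diff_if del: One_nat_def)

lemma LE_31: "LE {(1, 1), (1, 2), (1, 3), (2, 1)} =
  {[(1, 1), (1, 2), (1, 3), (2, 1)], [(1, 1), (1, 2), (2, 1), (1, 3)], [(1, 1), (2, 1), (1, 2), (1, 3)]}"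
  by (subst LE_unfold[OF young_small(6)]) (auto simp add: LE_21 LE_3 insert_Diff_if simp del: One_nat_def)

lemma LE_22: "LE square = {[(1, 1), (1, 2), (2, 1), (2, 2)], [(1, 1), (2, 1), (1, 2), (2, 2)]}"
  by (subst LE_unfold[OF young_small(7)]) (auto simp add: LE_21 insert_Diff_if simp del: One_nat_def)

lemma LE_32: "LE lam32 =
  {[(1, 1), (1, 2), (1, 3), (2, 1), (2, 2)], [(1, 1), (1, 2), (2, 1), (1, 3), (2, 2)],
   [(1, 1), (2, 1), (1, 2), (1, 3), (2, 2)], [(1, 1), (1, 2), (2, 1), (2, 2), (1, 3)],
   [(1, 1), (2, 1), (1, 2), (2, 2), (1, 3)]}"
proof -
  have "LE lam32 = (\<lambda>xs. xs @ [(2, 2)]) ` LE {(1, 1), (1, 2), (1, 3), (2, 1)} \<union>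
      (\<lambda>xs. xs @ [(1, 3)]) ` LE square"
    by (subst LE_unfold[OF young_small(8)]) (auto simp add: insert_Diff_if simp del: One_nat_def)
  then show ?thesis
    by (simp only: LE_31 LE_22 image_insert image_empty Un_insert_left Un_empty_left append.simps)
qed

section \<open>Lower bounds for the number of tableaux\<close>

lemma card_tr: "card (tr D) = card D"
  by (rule card_image) (auto simp: inj_on_def)

lemma card_LE_tr: "card (LE (tr D)) = card (LE D)"
proof -
  have "bij_betw (map prod.swap) (LE D) (LE (tr D))"
    by (rule bij_betw_byWitness[where f' = "map prod.swap"]) (use LE_tr[of _ D] LE_tr[of _ "tr D"] in auto)
  then show ?thesis using bij_betw_same_card by metis
qed

lemma card_five_not_square: "card D \<ge> 5 \<Longrightarrow> D \<noteq> square"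
  by (rule notI) simp

lemma row_or_column_three:
  assumes D: "young D" and "card D \<ge> 4" "D \<noteq> square"
  shows "(1, 3) \<in> D \<or> (3, 1) \<in> D"
proof (rule ccontr)
  assume n: "\<not> ?thesis"
  have "D \<subseteq> square"
  proof
    fix b assume b: "b \<in> D"
    obtain i j where [simp]: "b = (i, j)" by (cases b)
    have "1 \<le> i" "1 \<le> j" using young_pos[OF D] b by auto
    moreover have "j < 3" using youngD[OF D, of i j 1 3] b n calculation by force
    moreover have "i < 3" using youngD[OF D, of i j 3 1] b n calculation by force
    ultimately have "(i = 1 \<or> i = 2) \<and> (j = 1 \<or> j = 2)" by auto
    then show "b \<in> square" by auto
  qed
  moreover have "card D \<le> 4" using card_mono[OF _ calculation] by simp
  ultimately show False using card_subset_eq[of square D] assms(2,3) by simp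
qed

lemma square_subset:
  assumes "young D" "(2, 2) \<in> D"
  shows "square \<subseteq> D"
  using youngD[OF assms, of 1 1] youngD[OF assms, of 1 2] youngD[OF assms, of 2 1] assms(2) by simp

lemma contains_lam32:
  assumes D: "young D" "(2, 2) \<in> D" "card D \<ge> 5"
  shows "lam32 \<subseteq> D \<or> lam32 \<subseteq> tr D"
proof -
  have "(1, 3) \<in> D \<or> (3, 1) \<in> D"
    using row_or_column_three[OF D(1) _ card_five_not_square[OF D(3)]] D(3) by linarith
  then show ?thesis
    using square_subset[OF D(1,2)] by auto
qed

text \<open>Five is the number of tableaux of \<open>lam32\<close>, which every such shape contains
  up to transposition.\<close>

lemma card_LE_five:
  assumes D: "young D" "(2, 2) \<in> D" "card D \<ge> 5"
  shows "card (LE D) \<ge> 5"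
proof -
  have "card (LE lam32) = 5" unfolding LE_32 by simp
  then show ?thesis
    using contains_lam32[OF D] card_LE_mono[OF young_small(8) D(1)]
      card_LE_mono[OF young_small(8), of "tr D"] D(1) card_LE_tr[of D] by auto
qed

text \<open>Up to transposition the shape contains the hook with rows 3 and 1, which has three
  tableaux; the square has only two.\<close>

lemma card_LE_three:
  assumes D: "young D" "(1, 2) \<in> D" "(2, 1) \<in> D" "card D \<ge> 4" "D \<noteq> square"
  shows "card (LE D) \<ge> 3"
proof -
  let ?K = "{(1, 1), (1, 2), (1, 3), (2, 1)} :: box set"
  have "(1, 1) \<in> D" using youngD[OF D(1,2), of 1 1] by simp
  then have "?K \<subseteq> D \<or> ?K \<subseteq> tr D"
    using row_or_column_three[OF D(1,4,5)] D(2,3) by auto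
  moreover have "card (LE ?K) = 3" unfolding LE_31 by simp
  ultimately show ?thesis
    using card_LE_mono[OF young_small(6) D(1)]
      card_LE_mono[OF young_small(6), of "tr D"] D(1) card_LE_tr[of D] by auto
qed

lemma card_LE_two:
  assumes D: "young D" "(1, 2) \<in> D" "(2, 1) \<in> D"
  shows "card (LE D) \<ge> 2"
proof -
  let ?K = "{(1, 1), (1, 2), (2, 1)} :: box set"
  have "(1, 1) \<in> D" using youngD[OF D(1,2), of 1 1] by simp
  then have "?K \<subseteq> D" using D(2,3) by auto
  moreover have "card (LE ?K) = 2" unfolding LE_21 by simp
  ultimately show ?thesis using card_LE_mono[OF young_small(4) D(1)] by auto
qed

section \<open>The base case with five boxes\<close>

lemma bk_numeral:
  "bk 1 (a # b # c # xs) = (if incmp b c then a # c # b # xs else a # b # c # xs)"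
  "bk 2 (a # b # c # d # xs) = (if incmp c d then a # b # d # c # xs else a # b # c # d # xs)"
  "bk 3 (a # b # c # d # e # xs) = (if incmp d e then a # b # c # e # d # xs else a # b # c # d # e # xs)"
  using bk_decomp[of "[a]" b c xs] apply simp
  using bk_decomp[of "[a, b]" c d xs] apply (simp add: numeral_2_eq_2)
  using bk_decomp[of "[a, b, c]" d e xs] apply (simp add: numeral_3_eq_3)
  done

text \<open>On the first four boxes this is the identity unless they form the \<open>2 \<times> 2\<close> square.\<close>

definition square_flip :: "box list \<Rightarrow> box list" where
  "square_flip = bk 1 \<circ> (bk 2 \<circ> (bk 1 \<circ> (bk 2 \<circ> (bk 1 \<circ> bk 2))))"

lemma square_flip_mem: "square_flip \<in> G 5"
  unfolding square_flip_def by (intro G_comp G_bk) simp_all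

lemma square_flip_hook:
  assumes E: "young E" "card E = 5" "(2, 2) \<notin> E"
  shows "triv square_flip E"
  unfolding triv_def
proof
  fix xs assume xs: "xs \<in> LE E"
  have "length xs = 5" using LE_length[OF xs] E(2) by simp
  then obtain a b c d e where xs': "xs = [a, b, c, d, e]"
    by (auto simp: numeral_eq_Suc length_Suc_conv)
  have a: "a = (1, 1)" using LE_first[OF xs xs'] .
  have mem: "b \<in> E" "c \<in> E" "d \<in> E" and ne: "b \<noteq> a" "c \<noteq> a" "d \<noteq> a"
    using xs by (auto simp: LE_def xs')
  have ty: "(fst x = 1 \<and> snd x \<ge> 2) \<or> (snd x = 1 \<and> fst x \<ge> 2)" if "x \<in> E" "x \<noteq> a" for x
  proof -
    obtain i j where [simp]: "x = (i, j)" by (cases x)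
    have "\<not> (i \<ge> 2 \<and> j \<ge> 2)" using youngD[OF E(1), of i j 2 2] that(1) E(3) by auto
    then show ?thesis using young_pos[OF E(1), of i j] that a by fastforce
  qed
  \<comment> \<open>In a hook only the label arm or leg of a box matters. \<open>bk 1\<close> and
    \<open>bk 2\<close> act on the labels at places 1 to 3, counted from 0, as adjacent
    transpositions, and the braid relation says that the cube of their product is the
    identity.\<close>
  have inc: "incmp x y \<longleftrightarrow> (fst x = 1) \<noteq> (fst y = 1)" if "x \<in> E" "x \<noteq> a" "y \<in> E" "y \<noteq> a" for x y
    using ty[OF that(1,2)] ty[OF that(3,4)] unfolding incmp_def by auto
  show "square_flip xs = xs"
    unfolding square_flip_def xs' using mem ne
    by (cases "fst b = 1"; cases "fst c = 1"; cases "fst d = 1") (simp_all add: bk_numeral inc del: One_nat_def)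
qed

lemma good_card_five:
  assumes "young E" "(2, 2) \<in> E" "card E = 5"
  shows "E = lam32 \<or> E = tr lam32"
proof -
  have "card lam32 = 5" by simp
  moreover have "card (tr E) = 5" using assms(3) card_tr by simp
  ultimately have "lam32 \<subseteq> E \<Longrightarrow> lam32 = E" "lam32 \<subseteq> tr E \<Longrightarrow> lam32 = tr E"
    using card_subset_eq[of E lam32] card_subset_eq[of "tr E" lam32] young_finite[OF assms(1)] assms(3)
    by auto
  moreover have "lam32 \<subseteq> E \<or> lam32 \<subseteq> tr E"
    by (rule contains_lam32[OF assms(1,2)]) (simp only: assms(3))
  ultimately show ?thesis using tr_tr[of E] by metis
qed

lemma loc_lam32: "loc lam32"
proof -
  let ?A1 = "[(1, 1), (1, 2), (1, 3), (2, 1), (2, 2)] :: box list"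
  let ?A2 = "[(1, 1), (1, 2), (2, 1), (1, 3), (2, 2)] :: box list"
  let ?A3 = "[(1, 1), (2, 1), (1, 2), (1, 3), (2, 2)] :: box list"
  let ?A4 = "[(1, 1), (1, 2), (2, 1), (2, 2), (1, 3)] :: box list"
  let ?A5 = "[(1, 1), (2, 1), (1, 2), (2, 2), (1, 3)] :: box list"
  \<comment> \<open>On \<open>lam32\<close>, \<open>square_flip\<close> exchanges \<open>?A4\<close>
    and \<open>?A5\<close>, whose first four boxes form the square. Conjugation by
    \<open>bk 3\<close> gives the transposition of \<open>?A2\<close> and \<open>?A3\<close>, a
    further one by \<open>bk 2\<close> that of \<open>?A1\<close> and \<open>?A3\<close>;
    \<open>g\<close> is their product.\<close>
  define v where "v = bk 3 \<circ> square_flip \<circ> finv (bk 3)"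
  define g where "g = v \<circ> (bk 2 \<circ> v \<circ> finv (bk 2))"
  have b: "bk 2 \<in> G 5" "bk 3 \<in> G 5" by (auto intro: G_bk)
  have vG: "v \<in> G 5" unfolding v_def using square_flip_mem b by (intro G_comp G_inv)
  have gG: "g \<in> G 5" unfolding g_def using vG b by (intro G_comp G_inv)
  have c5: "card lam32 = 5" by simp
  have cg: "cyc g (LE lam32) ?A1 ?A2 ?A3"
    unfolding cyc_def LE_32 g_def v_def square_flip_def
    by (simp add: bk_numeral incmp_def del: One_nat_def)
  interpret perm_group "G 5" "LE lam32" by (rule perm_group_G)
  have "cyc (bk 3 \<circ> g \<circ> finv (bk 3)) (LE lam32) (bk 3 ?A1) (bk 3 ?A2) (bk 3 ?A3)"
    using conj_mem(2)[OF b(2) gG cg] .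
  then have cg': "cyc (bk 3 \<circ> g \<circ> finv (bk 3)) (LE lam32) ?A1 ?A4 ?A5"
    by (simp add: bk_numeral incmp_def del: One_nat_def)
  have "linked ?A1 ?A2" using gG cg unfolding linked_def by blast
  moreover have "linked ?A1 ?A3"
    using cyc_inv[OF G_bij[OF gG] cg] G_inv[OF gG] unfolding linked_def by blast
  moreover have "linked ?A1 ?A4" using conj_mem(1)[OF b(2) gG cg] cg' unfolding linked_def by blast
  moreover have "linked ?A1 ?A5"
    using cyc_inv[OF G_bij[OF conj_mem(1)[OF b(2) gG cg]] cg'] G_inv[OF conj_mem(1)[OF b(2) gG cg]]
    unfolding linked_def by blast
  moreover have "linked ?A1 ?A1" unfolding linked_def by (rule disjI1) (rule refl)
  ultimately have "linked ?A1 u" if "u \<in> LE lam32" for u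
    using that unfolding LE_32 by blast
  then have full: "full lam32"
    unfolding full_def c5 using all_linked_imp_cyc by blast
  show ?thesis
  proof (rule loc_if_sep[OF full])
    show "5 \<le> card (LE lam32)" unfolding LE_32 by simp
    fix E assume E: "young E" "card E = card lam32" "E \<noteq> lam32" "E \<noteq> tr lam32"
    have E5: "card E = 5" using E(2) c5 by (rule trans)
    \<comment> \<open>All remaining shapes with five boxes are hooks.\<close>
    have "(2, 2) \<notin> E" using good_card_five[OF E(1) _ E5] E(3,4) by blast
    then have "triv square_flip E" by (rule square_flip_hook[OF E(1) E5])
    then have "triv v E" unfolding v_def by (rule triv_conj[OF square_flip_mem b(2)])
    then have "triv g E" unfolding g_def using triv_comp triv_conj[OF vG b(1)] by blast
    then show "sep lam32 E" unfolding sep_def c5 using gG cg by blast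
  qed
qed

lemma loc_tr:
  assumes "loc D"
  shows "loc (tr D)"
proof -
  have "\<exists>g\<in>G (card D). cyc g (LE (tr D)) x y z \<and>
      (\<forall>E. young E \<longrightarrow> card E = card D \<longrightarrow> E \<noteq> tr D \<longrightarrow> E \<noteq> D \<longrightarrow> triv g E)"
    if xyz: "x \<in> LE (tr D)" "y \<in> LE (tr D)" "z \<in> LE (tr D)" "x \<noteq> y" "y \<noteq> z" "x \<noteq> z" for x y z
  proof -
    let ?s = "map prod.swap :: box list \<Rightarrow> box list"
    have sD: "?s u \<in> LE D" if "u \<in> LE (tr D)" for u using LE_tr[OF that] by simp
    have "?s x \<noteq> ?s y" "?s y \<noteq> ?s z" "?s x \<noteq> ?s z" using xyz(4-6) map_swap_inj by blast+
    then obtain g where g: "g \<in> G (card D)" "cyc g (LE D) (?s x) (?s y) (?s z)"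
      "\<forall>E. young E \<longrightarrow> card E = card D \<longrightarrow> E \<noteq> D \<longrightarrow> E \<noteq> tr D \<longrightarrow> triv g E"
      using assms sD[OF xyz(1)] sD[OF xyz(2)] sD[OF xyz(3)] unfolding loc_def by metis
    have gs: "g u = ?s (g (?s u))" for u
      using G_map_swap[OF g(1), of "?s u"] by simp
    note p = cyc_points[OF g(2)]
    have "g x = y" "g y = z" "g z = x" using gs[of x] gs[of y] gs[of z] p by simp_all
    moreover have "g v = v" if "v \<in> LE (tr D)" "v \<noteq> x" "v \<noteq> y" "v \<noteq> z" for v
      using gs[of v] cyc_fixes[OF g(2) sD[OF that(1)]] that(2-4) map_swap_inj by (metis map_swap_swap)
    ultimately have "cyc g (LE (tr D)) x y z" unfolding cyc_def using xyz by blast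
    then show ?thesis using g by blast
  qed
  then show ?thesis unfolding loc_def card_tr tr_tr by blast
qed

section \<open>Corners and addable boxes\<close>

lemma addable_pred:
  assumes "young (insert (i, j) A)" "(i, j) \<notin> A"
  shows "1 \<le> i" "1 \<le> j" "i = 1 \<or> (i - 1, j) \<in> A" "j = 1 \<or> (i, j - 1) \<in> A"
proof -
  show p: "1 \<le> i" "1 \<le> j" using young_pos[OF assms(1), of i j] by simp_all
  show "i = 1 \<or> (i - 1, j) \<in> A" using youngD[OF assms(1), of i j "i - 1" j] p by fastforce
  show "j = 1 \<or> (i, j - 1) \<in> A" using youngD[OF assms(1), of i j i "j - 1"] p by fastforce
qed

lemma addable_Suc:
  assumes "young (insert c A)" "c \<notin> A"
  shows "c = (Suc i, j) \<Longrightarrow> 1 \<le> i \<Longrightarrow> (i, j) \<in> A" "c = (i, Suc j) \<Longrightarrow> 1 \<le> j \<Longrightarrow> (i, j) \<in> A"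
  using addable_pred[of "fst c" "snd c" A] assms by auto

text \<open>\<open>b\<close> is weakly north-west of \<open>c\<close>. If \<open>c\<close> were not
  a neighbour of \<open>b\<close>, the box to the right of or below \<open>b\<close> would be among
  those that \<open>c\<close> requires in \<open>M\<close>.\<close>

lemma comparable_corner_addable:
  assumes M: "young M" and b: "corner M b" and c: "young (insert c M)" "c \<notin> M" and ni: "\<not> incmp b c"
  shows "c = (fst b, Suc (snd b)) \<or> c = (Suc (fst b), snd b)"
proof -
  obtain k l i j where bc [simp]: "b = (k, l)" "c = (i, j)" by (cases b, cases c)
  have bM: "(k, l) \<in> M" "(Suc k, l) \<notin> M" "(k, Suc l) \<notin> M" using b corner_iff[OF M] by auto
  have pos: "1 \<le> i" "1 \<le> j" using addable_pred[of i j M] c by auto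
  have posb: "1 \<le> k" "1 \<le> l" using young_pos[OF M bM(1)] by auto
  have "\<not> (i \<le> k \<and> j \<le> l)" using youngD[OF M bM(1), of i j] pos c(2) by auto
  then have le: "k \<le> i" "l \<le> j" using ni unfolding incmp_def by auto
  have ne: "(i, j) \<noteq> (k, l)" using bM(1) c(2) by auto
  have cy: "(i', j') \<in> M" if "1 \<le> i'" "i' \<le> i" "1 \<le> j'" "j' \<le> j" "(i', j') \<noteq> (i, j)" for i' j'
    using youngD[OF c(1), of i j i' j'] that by auto
  have "\<not> (Suc k \<le> i \<and> (Suc k, l) \<noteq> (i, j))" using cy[of "Suc k" l] bM(2) posb le by auto
  moreover have "\<not> (Suc l \<le> j \<and> (k, Suc l) \<noteq> (i, j))" using cy[of k "Suc l"] bM(3) posb le by auto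
  moreover have "i = k \<or> Suc k \<le> i" "j = l \<or> Suc l \<le> j" using le by linarith+
  ultimately have "(i, j) = (k, Suc l) \<or> (i, j) = (Suc k, l)" using ne by metis
  then show ?thesis by simp
qed

lemma tr_insert_fixed:
  assumes "d \<in> M" "prod.swap d = d" "tr (M - {d}) = M - {d}"
  shows "tr M = M"
proof -
  have M: "M = insert d (M - {d})" using assms(1) by blast
  then have "tr M = insert (prod.swap d) (tr (M - {d}))" by (metis image_insert)
  also have "\<dots> = M" using M by (simp only: assms(2,3))
  finally show ?thesis .
qed

text \<open>The removed box \<open>c\<close> lies on the diagonal: its mirror image is in
  \<open>L\<close> by symmetry of \<open>L - {k}\<close>, and if it differed from \<open>c\<close>,
  symmetry of \<open>L - {c}\<close> would put \<open>c\<close> back. So a shape that is not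
  self-transpose has at most one self-transpose \<open>L - {c}\<close>.\<close>

lemma self_transpose_unique:
  assumes "c \<in> L" "k \<in> L" "c \<noteq> k" "tr (L - {c}) = L - {c}" "tr (L - {k}) = L - {k}"
  shows "tr L = L"
proof -
  have *: "prod.swap a = a" if "a \<in> L" "a \<noteq> b" "tr (L - {a}) = L - {a}" "tr (L - {b}) = L - {b}" for a b
  proof (rule ccontr)
    assume ne: "prod.swap a \<noteq> a"
    have "a \<in> L - {b}" using that by blast
    then have "prod.swap a \<in> L - {b}" using that(4) by blast
    then have "prod.swap a \<in> L - {a}" using ne by blast
    then have "prod.swap (prod.swap a) \<in> L - {a}" using that(3) by blast
    then show False by simp
  qed
  have "prod.swap c = c" using *[of c k] assms by auto
  then show ?thesis by (rule tr_insert_fixed[OF assms(1) _ assms(4)])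
qed

text \<open>\<open>M\<close> is a rectangle. Removing its corner leaves the first row and the first
  column complete, so their lengths agree.\<close>

lemma single_corner_self_transpose:
  assumes M: "young M" "(2, 2) \<in> M" and d: "d \<in> M" and le: "\<And>b. b \<in> M \<Longrightarrow> fst b \<le> fst d \<and> snd b \<le> snd d"
    and st: "tr (M - {d}) = M - {d}"
  shows "tr M = M"
proof -
  obtain p q where [simp]: "d = (p, q)" by (cases d)
  have pq: "p \<ge> 2" "q \<ge> 2" using le[OF M(2)] by auto
  have sw: "(j, i) \<in> M - {d}" if "(i, j) \<in> M - {d}" for i j
    using st that mem_tr[of j i "M - {d}"] by blast
  have "\<not> p < q"
  proof
    assume "p < q"
    have "(1, q) \<in> M - {d}" using youngD[OF M(1), of p q 1 q] d pq by auto
    then have "(q, 1) \<in> M" using sw by blast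
    then show False using le[of "(q, 1)"] \<open>p < q\<close> by auto
  qed
  moreover have "\<not> q < p"
  proof
    assume "q < p"
    have "(p, 1) \<in> M - {d}" using youngD[OF M(1), of p q p 1] d pq by auto
    then have "(1, p) \<in> M" using sw by blast
    then show False using le[of "(1, p)"] \<open>q < p\<close> by auto
  qed
  ultimately have "prod.swap d = d" by simp
  then show ?thesis by (rule tr_insert_fixed[OF d _ st])
qed

lemma all_below_single_corner:
  assumes "young M" "\<And>f. corner M f \<Longrightarrow> f = d" "b \<in> M"
  shows "fst b \<le> fst d \<and> snd b \<le> snd d"
  using corner_above[OF assms(1,3)] assms(2) by metis

lemma row_corner:
  assumes L: "young L" "corner L (2, 2)" "(1, 3) \<in> L"
  shows "\<exists>f. corner L f \<and> fst f = 1 \<and> 3 \<le> snd f"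
proof -
  obtain f where f: "corner L f" "1 \<le> fst f" "3 \<le> snd f"
    using corner_above[OF L(1,3)] by (metis fst_conv snd_conv)
  have "f \<noteq> (2, 2)" using f(3) by auto
  then have "incmp f (2, 2)" using corner_incmp[OF L(1) f(1) L(2)] by blast
  then have "fst f = 1" using f(2,3) unfolding incmp_def by simp
  then show ?thesis using f by blast
qed

lemma column_corner:
  assumes L: "young L" "corner L (2, 2)" "(3, 1) \<in> L"
  shows "\<exists>f. corner L f \<and> snd f = 1 \<and> 3 \<le> fst f"
proof -
  have "young (tr L)" "corner (tr L) (2, 2)" "(1, 3) \<in> tr L"
    using L corner_tr[of L "(2, 2)"] by simp_all
  then obtain f where f: "corner (tr L) f" "fst f = 1" "3 \<le> snd f" using row_corner by blast
  then have "corner L (prod.swap f)" using corner_tr[of "tr L" f] tr_tr[of L] by metis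
  then show ?thesis using f(2,3) by (intro exI[of _ "prod.swap f"]) simp
qed

text \<open>If no corner works, every corner other than (2, 2) leaves a self-transpose shape, so
  there is at most one. If (2, 2) is not a corner, \<open>L\<close> is a rectangle and hence
  self-transpose. Otherwise boxes are added to the square in the first row only or in the first
  column only, and symmetry after removing the outer corner leaves just the square, too few
  boxes.\<close>

lemma good_cover_exists:
  assumes L: "good L" and big: "card L \<ge> 6"
  obtains c where "corner L c" "good (L - {c})"
proof -
  have yL: "young L" and box: "(2, 2) \<in> L" and nt: "tr L \<noteq> L" using L by (auto simp: good_def)
  have "\<exists>c. corner L c \<and> good (L - {c})"
  proof (rule ccontr)
    assume no: "\<not> ?thesis"
    have bad: "tr (L - {c}) = L - {c}" if "corner L c" "c \<noteq> (2, 2)" for c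
    proof -
      have "\<not> good (L - {c})" using no that(1) by blast
      moreover have "young (L - {c})" "(2, 2) \<in> L - {c}" using corner_young[OF that(1)] box that(2)
        by simp_all
      ultimately show ?thesis unfolding good_def by blast
    qed
    have uniq: "c = k" if "corner L c" "c \<noteq> (2, 2)" "corner L k" "k \<noteq> (2, 2)" for c k
    proof (rule ccontr)
      assume "c \<noteq> k"
      moreover have "c \<in> L" "k \<in> L" using that by (simp_all add: corner_def)
      ultimately have "tr L = L"
        using self_transpose_unique[OF _ _ _ bad[OF that(1,2)] bad[OF that(3,4)]] by blast
      then show False using nt by blast
    qed
    obtain c1 where c1: "corner L c1" "2 \<le> fst c1" "2 \<le> snd c1"
      using corner_above[OF yL box] by (metis fst_conv snd_conv)
    show False
    proof (cases "corner L (2, 2)")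
      case False
      then have c1n: "c1 \<noteq> (2, 2)" using c1(1) by blast
      have "f = c1" if "corner L f" for f
      proof -
        have "f \<noteq> (2, 2)" using that False by blast
        then show ?thesis using uniq[OF c1(1) c1n that] by blast
      qed
      then have "fst b \<le> fst c1 \<and> snd b \<le> snd c1" if "b \<in> L" for b
        using all_below_single_corner[OF yL _ that] by blast
      then show False
        using single_corner_self_transpose[OF yL box _ _ bad[OF c1(1) c1n]] c1(1) nt
        unfolding corner_def by blast
    next
      case True
      have "L \<noteq> square" using card_five_not_square[of L] big by linarith
      then have 3: "(1, 3) \<in> L \<or> (3, 1) \<in> L"
        using row_or_column_three[OF yL _ \<open>L \<noteq> square\<close>] big by linarith
      have c13: "\<exists>f. corner L f \<and> f \<noteq> (2, 2) \<and> fst f = 1" if "(1, 3) \<in> L"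
        using row_corner[OF yL True that] by force
      have c31: "\<exists>f. corner L f \<and> f \<noteq> (2, 2) \<and> snd f = 1" if "(3, 1) \<in> L"
        using column_corner[OF yL True that] by force
      have sub: "L - {f} \<subseteq> square" if f: "corner L f" "f \<noteq> (2, 2)"
        and x: "(1, 3) \<notin> L - {f} \<or> (3, 1) \<notin> L - {f}" for f
      proof -
        have "(1, 3) \<notin> L - {f}" "(3, 1) \<notin> L - {f}"
          using x bad[OF f] mem_tr[of 1 3 "L - {f}"] mem_tr[of 3 1 "L - {f}"] by metis+
        then have "L - {f} = square"
          using row_or_column_three[OF corner_young[OF f(1)]] card_remove[OF yL f(1)] big by linarith
        then show ?thesis by (rule equalityD1)
      qed
      have small: False if f: "corner L f" "L - {f} \<subseteq> square" for f
        using card_mono[OF _ f(2)] card_remove[OF yL f(1)] big by simp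
      show False
      proof (cases "(1, 3) \<in> L \<and> (3, 1) \<in> L")
        case True
        then obtain f g where "corner L f" "f \<noteq> (2, 2)" "fst f = 1" "corner L g" "g \<noteq> (2, 2)" "snd g = 1"
          using c13 c31 by blast
        then have "corner L (1, 1)" using uniq[of f g] by (metis prod.collapse)
        then have "(1, 2) \<notin> L" using corner_iff[OF yL, of "(1, 1)"] by (simp add: numeral_2_eq_2)
        then show False using square_subset[OF yL box] by blast
      next
        case False
        then obtain f where "corner L f" "f \<noteq> (2, 2)" using 3 c13 c31 by blast
        then show False using sub[of f] small[of f] False by blast
      qed
    qed
  qed
  then show ?thesis using that by blast
qed

text \<open>\<open>M\<close> is \<open>lam32\<close> or its transpose, and up to transposition
  \<open>c\<close> and \<open>c'\<close> are (1, 4) and (2, 3). Over the square there are too few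
  tableaux for a 3-cycle; the corner (2, 2) replaces \<open>d\<close>, being adjacent to exactly one
  of the two boxes.\<close>

lemma square_cover_mixed_corner:
  assumes M: "young M" and d: "corner M d" "M - {d} = square"
    and c: "young (insert c M)" "c \<notin> M" "tr (insert c M) \<noteq> insert c M"
    and c': "young (insert c' M)" "c' \<notin> M" "tr (insert c' M) \<noteq> insert c' M" and "c \<noteq> c'"
  shows "corner M (2, 2)" "M - {(2, 2)} \<noteq> square" "incmp (2, 2) c \<noteq> incmp (2, 2) c'"
proof -
  have dM: "M = insert d square" "d \<notin> square" using d by (auto simp: corner_def)
  obtain i j where [simp]: "d = (i, j)" by (cases d)
  have "young (insert (i, j) square)" using M dM by simp
  moreover have "(i, j) \<notin> square" using dM(2) by (simp only: \<open>d = (i, j)\<close> not_False_eq_True)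
  ultimately have "d = (1, 3) \<or> d = (3, 1)"
    using addable_pred[of i j square] by auto
  then consider "M = insert (1, 3) square" | "M = insert (3, 1) square" using dM(1) by blast
  then have "corner M (2, 2) \<and> M - {(2, 2)} \<noteq> square \<and> incmp (2, 2) c \<noteq> incmp (2, 2) c'"
  proof cases
    case 1
    have *: "a = (1, 4) \<or> a = (2, 3)"
      if a: "young (insert a M)" "a \<notin> M" "tr (insert a M) \<noteq> insert a M" for a
    proof -
      obtain k l where [simp]: "a = (k, l)" by (cases a)
      have "a = (1, 4) \<or> a = (2, 3) \<or> a = (3, 1)"
        using addable_pred[of k l M] a(1,2) 1 by auto
      then show ?thesis using a(3) 1 by auto
    qed
    have "corner M (2, 2)" unfolding corner_iff[OF M] using 1 by simp
    moreover have "M - {(2, 2)} \<noteq> square"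
    proof
      assume "M - {(2, 2)} = square"
      moreover have "(1, 3) \<in> M - {(2, 2)}" using 1 by simp
      ultimately have "(1, 3) \<in> square" by (simp only:)
      then show False by simp
    qed
    moreover have "incmp (2, 2) c \<noteq> incmp (2, 2) c'"
      using *[OF c] *[OF c'] \<open>c \<noteq> c'\<close> by (elim disjE) (simp_all add: incmp_def)
    ultimately show ?thesis by blast
  next
    case 2
    have *: "a = (4, 1) \<or> a = (3, 2)"
      if a: "young (insert a M)" "a \<notin> M" "tr (insert a M) \<noteq> insert a M" for a
    proof -
      obtain k l where [simp]: "a = (k, l)" by (cases a)
      have p: "1 \<le> k" "1 \<le> l" "k = 1 \<or> (k - 1, l) \<in> M" "l = 1 \<or> (k, l - 1) \<in> M"
        using addable_pred[of k l M] a(1,2) by simp_all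
      obtain k' l' where kl: "k = Suc k'" "l = Suc l'" using p(1,2) by (metis Suc_le_D One_nat_def)
      have q: "k' = 0 \<or> (k', l) \<in> M" "l' = 0 \<or> (k, l') \<in> M" using p(3,4) kl by simp_all
      have "a = (4, 1) \<or> a = (3, 2) \<or> a = (1, 3)"
      proof (cases "l' = 0")
        case True
        then show ?thesis using q(1) a(2) kl unfolding 2 by auto
      next
        case False
        then have "(k, l') \<in> M" using q(2) by blast
        then have "(k = 3 \<and> l' = 1) \<or> (k = 1 \<and> l' = 1) \<or> (k = 1 \<and> l' = 2) \<or> (k = 2 \<and> l' = 1) \<or> (k = 2 \<and>
            l' = 2)"
          unfolding 2 by simp
        then show ?thesis using q(1) a(2) kl unfolding 2 by (elim disjE) simp_all
      qed
      moreover have "a \<noteq> (1, 3)"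
      proof
        assume "a = (1, 3)"
        then have "tr (insert a M) = insert a M" unfolding 2 by (simp add: insert_commute)
        then show False using a(3) by contradiction
      qed
      ultimately show ?thesis by blast
    qed
    have "corner M (2, 2)" unfolding corner_iff[OF M] using 2 by simp
    moreover have "M - {(2, 2)} \<noteq> square"
    proof
      assume "M - {(2, 2)} = square"
      moreover have "(3, 1) \<in> M - {(2, 2)}" using 2 by simp
      ultimately have "(3, 1) \<in> square" by (simp only:)
      then show False by simp
    qed
    moreover have "incmp (2, 2) c \<noteq> incmp (2, 2) c'"
      using *[OF c] *[OF c'] \<open>c \<noteq> c'\<close> by (elim disjE) (simp_all add: incmp_def)
    ultimately show ?thesis by blast
  qed
  then show "corner M (2, 2)" "M - {(2, 2)} \<noteq> square" "incmp (2, 2) c \<noteq> incmp (2, 2) c'" by blast+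
qed

section \<open>Possible configurations of corners\<close>

lemma tr_remove: "tr (A - {c}) = tr A - {prod.swap c}"
  by (cases c) auto

lemma corner_insert:
  assumes "young M" "young (insert c M)" "corner M d" "incmp d c"
  shows "corner (insert c M) d"
proof -
  have "(Suc (fst d), snd d) \<noteq> c" "(fst d, Suc (snd d)) \<noteq> c" using assms(4) by (auto simp: incmp_def)
  then show ?thesis
    using corner_iff[OF assms(1), of d] corner_iff[OF assms(2), of d] assms(3) by blast
qed

lemma addable_same_row:
  assumes "young (insert c' M)" "c \<notin> M" "c \<noteq> c'" "1 \<le> fst c" "1 \<le> snd c" "fst c \<le> fst c'"
  shows "\<not> snd c \<le> snd c'"
proof
  assume "snd c \<le> snd c'"
  then have "(fst c, snd c) \<in> insert c' M"
    using youngD[OF assms(1), of "fst c'" "snd c'" "fst c" "snd c"] assms by simp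
  then show False using assms(2,3) by simp
qed

text \<open>
  The next two lemmas exclude the configurations of corners of \<open>M\<close> to which no separation lemma of
  \<open>cover_pair\<close> applies.
\<close>

lemma geometry_non_self_transpose:
  assumes M: "young M" and box: "(2, 2) \<in> M" and ntM: "tr M \<noteq> M" and big: "card M \<ge> 5"
    and c: "young (insert c M)" "c \<notin> M" and c': "young (insert c' M)" "c' \<notin> M" and ne: "c \<noteq> c'"
    and same: "\<And>d. corner M d \<Longrightarrow> incmp d c \<longleftrightarrow> incmp d c'"
    and bad: "\<And>d. corner M d \<Longrightarrow> incmp d c \<Longrightarrow> incmp d c' \<Longrightarrow>
      (\<not> good (insert c M - {d}) \<and> \<not> good (insert c' M - {d})) \<or> insert c' M - {d} = tr (insert c M - {d})"
  shows False
proof -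
  have pos: "1 \<le> fst c" "1 \<le> snd c" "1 \<le> fst c'" "1 \<le> snd c'"
    using young_pos[OF c(1), of "fst c" "snd c"] young_pos[OF c'(1), of "fst c'" "snd c'"] by simp_all
  note cc' = addable_same_row[OF c'(1) c(2) ne pos(1,2)]
  note c'c = addable_same_row[OF c(1) c'(2) ne[symmetric] pos(3,4)]
  \<comment> \<open>Two shapes that are not good are impossible. For \<open>d = (2, 2)\<close>,
    \<open>c\<close> and \<open>c'\<close> prolong the first row and the first column, and a corner
    there violates \<open>same\<close>. Otherwise both shapes are self-transpose, which puts both
    addable boxes on the diagonal.\<close>
  have step1: "insert c' M - {d} = tr (insert c M - {d})" if d: "corner M d" "incmp d c" "incmp d c'" for d
  proof (rule ccontr)
    assume "\<not> ?thesis"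
    then have b: "\<not> good (insert c M - {d})" "\<not> good (insert c' M - {d})" using bad[OF d] by auto
    show False
    proof (cases "d = (2, 2)")
      case True
      have "(1, 3) \<in> M \<or> (3, 1) \<in> M"
        using row_or_column_three[OF M _ card_five_not_square[OF big]] big by linarith
      then obtain f where f: "corner M f" "fst f = 1 \<and> 3 \<le> snd f \<or> snd f = 1 \<and> 3 \<le> fst f"
        using row_corner[OF M] column_corner[OF M] d(1) True by blast
      have "fst c = 1 \<and> 3 \<le> snd c \<or> snd c = 1 \<and> 3 \<le> fst c"
        using d(2) pos unfolding True incmp_def by auto
      moreover have "fst c' = 1 \<and> 3 \<le> snd c' \<or> snd c' = 1 \<and> 3 \<le> fst c'"
        using d(3) pos unfolding True incmp_def by auto
      moreover have "\<not> (fst c = 1 \<and> fst c' = 1)" using cc' c'c by linarith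
      moreover have "\<not> (snd c = 1 \<and> snd c' = 1)" using cc' c'c by linarith
      ultimately consider "fst c = 1" "3 \<le> snd c" "snd c' = 1" "3 \<le> fst c'" | "fst c' = 1" "3 \<le> snd c'" "snd c = 1" "3 \<le> fst c"
        by blast
      then show False
        using same[OF f(1)] f(2) unfolding incmp_def by cases auto
    next
      case False
      have "young (insert c M - {d})" "young (insert c' M - {d})"
        using corner_young corner_insert[OF M c(1) d(1,2)] corner_insert[OF M c'(1) d(1,3)] by blast+
      moreover have "(2, 2) \<in> insert c M - {d}" "(2, 2) \<in> insert c' M - {d}" using False box by auto
      ultimately have t: "tr (insert c M - {d}) = insert c M - {d}" "tr (insert c' M - {d}) = insert c' M - {d}"
        using b unfolding good_def by blast+
      have sw: "prod.swap a = a"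
        if "tr (insert a M - {d}) = insert a M - {d}" "tr (insert b M - {d}) = insert b M - {d}"
        "a \<notin> M" "a \<noteq> b" "a \<noteq> d" for a b
      proof (rule ccontr)
        assume n: "prod.swap a \<noteq> a"
        have "a \<in> insert a M - {d}" using that by blast
        then have "prod.swap a \<in> insert a M - {d}" using that(1) by blast
        then have "prod.swap a \<in> insert b M - {d}" using n by blast
        then have "prod.swap (prod.swap a) \<in> insert b M - {d}" using that(2) by blast
        then show False using that(3,4) by simp
      qed
      have dc: "c \<noteq> d" "c' \<noteq> d" using d(1) c(2) c'(2) by (auto simp: corner_def)
      have "prod.swap c = c" "prod.swap c' = c'"
        using sw[OF t c(2) ne dc(1)] sw[OF t(2,1) c'(2) ne[symmetric] dc(2)] by blast+
      then have "fst c = snd c" "fst c' = snd c'" by (metis fst_swap)+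
      then show False using cc' c'c by linarith
    qed
  qed
  have step2: "c' = prod.swap c" "tr (M - {d}) = M - {d}" if d: "corner M d" "incmp d c" "incmp d c'" for d
  proof -
    note e = step1[OF d]
    have dc: "c \<noteq> d" "c' \<noteq> d" "c' \<notin> M" "c \<notin> M" using d(1) c(2) c'(2) by (auto simp: corner_def)
    show s: "c' = prod.swap c"
    proof (rule ccontr)
      assume n: "c' \<noteq> prod.swap c"
      have "prod.swap c \<in> tr (insert c M - {d})" using dc(1) by blast
      then have "prod.swap c \<in> insert c' M - {d}" using e by (simp only:)
      then have "prod.swap c \<in> insert c M - {d}" using n by blast
      then have "prod.swap (prod.swap c) \<in> tr (insert c M - {d})" by blast
      then have "prod.swap (prod.swap c) \<in> insert c' M - {d}" using e by (simp only:)
      then show False using ne dc(4) by simp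
    qed
    have "M - {d} = (insert c' M - {d}) - {c'}" using dc(3) by blast
    also have "\<dots> = tr (insert c M - {d}) - {prod.swap c}" by (subst e, subst s) (rule refl)
    also have "\<dots> = tr ((insert c M - {d}) - {c})" by (simp only: tr_remove)
    also have "(insert c M - {d}) - {c} = M - {d}" using dc(4) by blast
    finally show "tr (M - {d}) = M - {d}" by (rule sym)
  qed
  have uniqN: "d = f" if "corner M d" "incmp d c" "corner M f" "incmp f c" for d f
  proof (rule ccontr)
    assume "d \<noteq> f"
    moreover have "d \<in> M" "f \<in> M" using that by (simp_all add: corner_def)
    moreover have "tr (M - {d}) = M - {d}" "tr (M - {f}) = M - {f}"
      using step2(2) same that by blast+
    ultimately show False using self_transpose_unique[of d M f] ntM by blast
  qed
  \<comment> \<open>By \<open>same\<close>, a corner adjacent to one of \<open>c\<close> and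
    \<open>c'\<close> is adjacent to both, and this determines it.\<close>
  have adjB: "{c, c'} = {(fst b, Suc (snd b)), (Suc (fst b), snd b)}" if b: "corner M b" "\<not> incmp b c" for b
    using comparable_corner_addable[OF M b(1) c b(2)]
      comparable_corner_addable[OF M b(1) c'] same[OF b(1)] b(2) ne by auto
  have uniqB: "b = f" if "corner M b" "\<not> incmp b c" "corner M f" "\<not> incmp f c" for b f
  proof -
    obtain k l i j where [simp]: "b = (k, l)" "f = (i, j)" by (cases b, cases f)
    have "{(k, Suc l), (Suc k, l)} = {(i, Suc j), (Suc i, j)}"
      using adjB[OF that(1,2)] adjB[OF that(3,4)] by simp
    then show ?thesis by (auto simp: doubleton_eq_iff)
  qed
  have Bpos: "2 \<le> fst b \<and> 2 \<le> snd b" if b: "corner M b" "\<not> incmp b c" and "fst b = snd b" for b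
  proof -
    have "b \<noteq> (1, 1)"
    proof
      assume "b = (1, 1)"
      then have "(1, 2) \<notin> M" using corner_iff[OF M, of b] b(1) by (simp add: numeral_2_eq_2)
      then show False using square_subset[OF M box] by blast
    qed
    moreover have "1 \<le> fst b" "1 \<le> snd b" using young_pos[OF M, of "fst b" "snd b"] b(1)
      by (simp_all add: corner_def)
    ultimately show ?thesis using that(3) by (cases b) auto
  qed
  show False
  proof (cases "\<exists>d. corner M d \<and> incmp d c")
    case False
    obtain b where b: "corner M b" "2 \<le> fst b" "2 \<le> snd b" using corner_above[OF M box]
      by (metis fst_conv snd_conv)
    have "f = b" if "corner M f" for f using uniqB[OF that _ b(1)] False b(1) that by blast
    then have le: "fst a \<le> fst b \<and> snd a \<le> snd b" if "a \<in> M" for a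
      using all_below_single_corner[OF M _ that] by blast
    have "(fst b, Suc (snd b)) \<in> {c, c'}" using adjB[OF b(1)] False b(1) by blast
    then have "young (insert (fst b, Suc (snd b)) M)" using c(1) c'(1) by blast
    then have "(fst b - 1, Suc (snd b)) \<in> M"
      using addable_pred(3)[of "fst b" "Suc (snd b)" M] le[of "(fst b, Suc (snd b))"] b(2) by auto
    then show False using le by force
  next
    case True
    then obtain d where d: "corner M d" "incmp d c" by blast
    note dd = step2[OF d same[THEN iffD1, OF d]]
    show False
    proof (cases "\<exists>b. corner M b \<and> \<not> incmp b c")
      case False
      have "f = d" if "corner M f" for f using uniqN[OF that _ d] False that by blast
      then have "fst a \<le> fst d \<and> snd a \<le> snd d" if "a \<in> M" for a
        using all_below_single_corner[OF M _ that] by blast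
      then have "tr M = M"
        using single_corner_self_transpose[OF M box _ _ dd(2)] d(1) by (simp add: corner_def)
      then show False using ntM by contradiction
    next
      case True
      then obtain b where b: "corner M b" "\<not> incmp b c" by blast
      obtain k l where bk: "b = (k, l)" by (cases b)
      have kl: "{c, prod.swap c} = {(k, Suc l), (Suc k, l)}" using adjB[OF b] dd(1) bk by simp
      have "k = l"
      proof -
        have "c = (k, Suc l) \<and> prod.swap c = (Suc k, l) \<or> c = (Suc k, l) \<and> prod.swap c = (k, Suc l)"
          using kl unfolding doubleton_eq_iff .
        then show ?thesis by (metis Suc_inject fst_conv snd_conv fst_swap)
      qed
      then obtain r where r: "k = Suc r" "l = Suc r" "1 \<le> r"
        using Bpos[OF b] bk by (cases k) auto
      \<comment> \<open>Both outer neighbours of the diagonal corner \<open>b\<close> are addable,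
        so \<open>M\<close> reaches beyond \<open>b\<close> to the right and downwards. This takes
        two further corners, but only \<open>d\<close> is left.\<close>
      have "(k, Suc l) \<in> {c, c'}" "(Suc k, l) \<in> {c, c'}" using kl dd(1) by blast+
      then have "(r, Suc l) \<in> M" "(Suc k, r) \<in> M"
        using addable_Suc[OF c] addable_Suc[OF c'] r by auto
      then obtain f g where fg: "corner M f" "Suc l \<le> snd f" "corner M g" "Suc k \<le> fst g"
        using corner_above[OF M] by (metis fst_conv snd_conv)
      have "a = b \<or> a = d" if "corner M a" for a
        using uniqN[OF that _ d] uniqB[OF that _ b] by blast
      then have "f = b \<or> f = d" "g = b \<or> g = d" using fg by blast+
      then have "f = d" "g = d" using fg(2,4) bk by auto
      then have "Suc l \<le> snd d" "Suc k \<le> fst d" using fg(2,4) by blast+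
      moreover have "d \<noteq> b" using b(2) d(2) by blast
      then have "incmp b d" using corner_incmp[OF M b(1) d(1)] by blast
      ultimately show False using bk unfolding incmp_def by simp
    qed
  qed
qed

lemma geometry_self_transpose:
  assumes M: "young M" and box: "(2, 2) \<in> M" and ntM: "tr M \<noteq> M"
    and c: "young (insert c M)" "c \<notin> M" "tr (insert c M) \<noteq> insert c M"
    and c': "young (insert c' M)" "c' \<notin> M" "tr (insert c' M) = insert c' M" and ne: "c \<noteq> c'"
    and e: "e = prod.swap c'" "corner M e" "incmp e c'"
    and S1: "\<And>d. corner M d \<Longrightarrow> incmp d c \<Longrightarrow> incmp d c'"
    and S2: "\<And>d. corner M d \<Longrightarrow> incmp d c \<Longrightarrow> incmp d c' \<Longrightarrow> \<not> good (insert c M - {d})"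
    and S3: "\<And>d f. corner M d \<Longrightarrow> \<not> incmp d c \<Longrightarrow> incmp d c' \<Longrightarrow> corner M f \<Longrightarrow> f \<noteq> d \<Longrightarrow> \<not> incmp f c'"
  shows False
proof -
  obtain p q where pq: "c' = (q, p)" "e = (p, q)" using e(1) by (cases c') auto
  \<comment> \<open>With \<open>e\<close> as its only corner, \<open>M\<close> would be a p by q
    rectangle, to which \<open>c'\<close> = (q, p) cannot be added.\<close>
  have other: "\<exists>f. corner M f \<and> f \<noteq> e"
  proof (rule ccontr)
    assume "\<not> ?thesis"
    then have le: "fst a \<le> p \<and> snd a \<le> q" if "a \<in> M" for a
      using all_below_single_corner[OF M _ that, of e] pq by auto
    have eM: "(p, q) \<in> M" using e(2) pq by (simp add: corner_def)
    have pq2: "2 \<le> p" "2 \<le> q" using le[OF box] by auto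
    have "\<not> (q \<le> p \<and> p \<le> q)" using eM c'(2) pq by auto
    moreover have "q \<le> p" using addable_pred(4)[of q p M] c' pq le[of "(q, p - 1)"] pq2 by auto
    moreover have "p \<le> q" using addable_pred(3)[of q p M] c' pq le[of "(q - 1, p)"] pq2 by auto
    ultimately show False by blast
  qed
  have both: "c = (fst f, Suc (snd f)) \<and> c' = (Suc (fst f), snd f) \<or> c = (Suc (fst f), snd f) \<and>
      c' = (fst f, Suc (snd f))"
    if f: "corner M f" "\<not> incmp f c" "\<not> incmp f c'" for f
    using comparable_corner_addable[OF M f(1) c(1,2) f(2)] comparable_corner_addable[OF M f(1) c'(1,2) f(3)] ne by auto
  show False
  proof (cases "incmp e c")
    case False
    obtain f where f: "corner M f" "f \<noteq> e" using other by blast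
    have "\<not> incmp f c'" using S3[OF e(2) False e(3) f] .
    then have "\<not> incmp f c" using S1[OF f(1)] by blast
    \<comment> \<open>As neighbours of \<open>f\<close>, the boxes \<open>c\<close> and
      \<open>c'\<close> have equal coordinate sums. But \<open>c\<close> is also a neighbour of
      \<open>e\<close>, the mirror image of \<open>c'\<close>, so its sum is larger by one.\<close>
    note b = both[OF f(1) this \<open>\<not> incmp f c'\<close>]
    obtain k l where fk: "f = (k, l)" by (cases f)
    have "c = (p, Suc q) \<or> c = (Suc p, q)"
      using comparable_corner_addable[OF M e(2) c(1,2) False] pq by simp
    then show False using b pq f(2) fk by auto
  next
    case True
    have e2: "e \<noteq> (2, 2)" using e(3) pq by (auto simp: incmp_def)
    have ec: "e \<noteq> c" using e(2) c(2) by (auto simp: corner_def)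
    have "young (insert c M - {e})" using corner_young[OF corner_insert[OF M c(1) e(2) True]] .
    moreover have "(2, 2) \<in> insert c M - {e}" using box e2 by blast
    ultimately have Le: "tr (insert c M - {e}) = insert c M - {e}"
      using S2[OF e(2) True e(3)] unfolding good_def by blast
    \<comment> \<open>Otherwise the mirror image of \<open>c\<close> lies in the self-transpose
      shape \<open>insert c' M\<close>, which does not contain \<open>c\<close>.\<close>
    have sc: "prod.swap c = c"
    proof (rule ccontr)
      assume n: "prod.swap c \<noteq> c"
      have "c \<in> insert c M - {e}" using ec by blast
      then have "prod.swap c \<in> insert c M - {e}" using Le by blast
      then have "prod.swap c \<in> insert c' M" using n by blast
      then have "prod.swap (prod.swap c) \<in> insert c' M" using c'(3) by blast
      then show False using c(2) ne by simp
    qed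
    have "snd c = fst c" using arg_cong[OF sc, of fst] by simp
    then obtain k where k: "c = (k, k)" by (metis prod.collapse)
    have k3: "3 \<le> k"
    proof -
      have "(1, 1) \<in> M" using square_subset[OF M box] by blast
      then have "k \<noteq> 1" "k \<noteq> 2" "1 \<le> k" using c(2) k box young_pos[OF c(1), of k k] by auto
      then show ?thesis by simp
    qed
    \<comment> \<open>Every corner but \<open>e\<close> is adjacent to both \<open>c\<close> and
      \<open>c'\<close>: a second self-transpose removal is impossible, and \<open>S3\<close>
      applied to \<open>d\<close> and \<open>e\<close> excludes the rest.\<close>
    have B: "\<not> incmp d c \<and> \<not> incmp d c'" if d: "corner M d" "d \<noteq> e" for d
    proof -
      have "\<not> incmp d c"
      proof
        assume i: "incmp d c"
        have i': "incmp d c'" using S1[OF d(1) i] .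
        have "d \<noteq> (2, 2)" using i k k3 by (auto simp: incmp_def)
        then have "(2, 2) \<in> insert c M - {d}" using box by blast
        moreover have "young (insert c M - {d})" using corner_young[OF corner_insert[OF M c(1) d(1) i]] .
        ultimately have "tr (insert c M - {d}) = insert c M - {d}"
          using S2[OF d(1) i i'] unfolding good_def by blast
        moreover have "d \<in> insert c M" "e \<in> insert c M" using d(1) e(2) by (simp_all add: corner_def)
        ultimately show False using self_transpose_unique[of d "insert c M" e] Le d(2) c(3) by blast
      qed
      moreover have "\<not> incmp d c'"
      proof
        assume "incmp d c'"
        then have "\<not> incmp e c'" using S3[OF d(1) calculation _ e(2)] d(2) by blast
        then show False using e(3) by contradiction
      qed
      ultimately show ?thesis by blast
    qed
    obtain d where d: "corner M d" "d \<noteq> e" using other by blast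
    obtain r where r: "k = Suc (Suc r)" "1 \<le> r" using k3
      by (metis Suc_le_D Suc_le_mono numeral_3_eq_3 One_nat_def)
    \<comment> \<open>\<open>c'\<close> lies beyond \<open>d\<close>, away from the diagonal. The
      box of \<open>M\<close> that supports it on the other side forces a corner still further out,
      which is neither \<open>e\<close> nor adjacent to \<open>c\<close>.\<close>
    have "d = (Suc r, k) \<and> c' = (Suc r, Suc k) \<or> d = (k, Suc r) \<and> c' = (Suc k, Suc r)"
      using both[OF d(1)] B[OF d] k r by (cases d) auto
    then show False
    proof
      assume h: "d = (Suc r, k) \<and> c' = (Suc r, Suc k)"
      then have "(r, Suc k) \<in> M" using addable_Suc(1)[OF c'(1,2)] r(2) by blast
      then obtain f where f: "corner M f" "r \<le> fst f" "Suc k \<le> snd f" using corner_above[OF M]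
        by (metis fst_conv snd_conv)
      have "f \<noteq> e" using f(3) h e(1) r by auto
      then have "\<not> incmp f c" using B[OF f(1)] by blast
      then have "snd c = snd f \<or> snd c = Suc (snd f)"
        using comparable_corner_addable[OF M f(1) c(1,2)] by auto
      then show False using f(3) k by auto
    next
      assume h: "d = (k, Suc r) \<and> c' = (Suc k, Suc r)"
      then have "(Suc k, r) \<in> M" using addable_Suc(2)[OF c'(1,2)] r(2) by blast
      then obtain f where f: "corner M f" "Suc k \<le> fst f" "r \<le> snd f" using corner_above[OF M]
        by (metis fst_conv snd_conv)
      have "f \<noteq> e" using f(2) h e(1) r by auto
      then have "\<not> incmp f c" using B[OF f(1)] by blast
      then have "fst c = fst f \<or> fst c = Suc (fst f)"
        using comparable_corner_addable[OF M f(1) c(1,2)] by auto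
      then show False using f(2) k by auto
    qed
  qed
qed

section \<open>The induction on shapes\<close>

text \<open>Whatever last box of \<open>N\<close> is removed, the 3-cycle lifted from
  \<open>L - {c}\<close> is trivial on the remaining shape.\<close>

lemma sep_direct:
  assumes L: "young L" "corner L c" "loc (L - {c})" "tr L \<noteq> L" and three: "card (LE (L - {c})) \<ge> 3"
    and N: "young N" "card N = card L" "N \<noteq> {}"
    and no: "\<And>k. corner N k \<Longrightarrow> N - {k} \<noteq> L - {c} \<and> N - {k} \<noteq> tr (L - {c})"
  shows "sep L N"
proof -
  obtain x y z where x: "x \<in> LE (L - {c})" and y: "y \<in> LE (L - {c})" "y \<noteq> x"
    and z: "z \<in> LE (L - {c})" "z \<noteq> x" "z \<noteq> y"
    using three_points[OF three] .
  obtain h where h: "h \<in> G (card L - 1)" "cyc h (LE L) (x @ [c]) (y @ [c]) (z @ [c])"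
    and tv: "\<forall>E. young E \<longrightarrow> card E = card L - 1 \<longrightarrow> E \<noteq> L - {c} \<longrightarrow> E \<noteq> tr (L - {c}) \<longrightarrow> triv h E"
    using loc_lift[OF L x y(1) z(1)] y(2) z(2,3) by metis
  have "triv h N"
    unfolding triv_def
  proof
    fix T assume "T \<in> LE N"
    then obtain u k where u: "T = u @ [k]" "corner N k" "u \<in> LE (N - {k})" using LE_snocE N(3) by metis
    have ck: "card (N - {k}) = card L - 1" using card_remove[OF N(1) u(2)] N(2) by simp
    then have "triv h (N - {k})" using tv no[OF u(2)] corner_young[OF u(2)] by blast
    then show "h T = T" using G_snoc[OF h(1) u(3) ck] u by (simp add: triv_def)
  qed
  moreover have "h \<in> G (card L)" using G_mono[OF h(1)] by simp
  ultimately show ?thesis unfolding sep_def using h(2) by blast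
qed

locale cover_pair_step = cover_pair +
  assumes big: "card L \<ge> 6" and goodM: "good M" and IH: "\<And>D. good D \<Longrightarrow> card D = card L - 1 \<Longrightarrow> loc D"
begin

lemma boxM: "(2, 2) \<in> M" and ntM: "tr M \<noteq> M"
  using goodM by (auto simp: good_def)

lemma inserts: "young (insert c M)" "young (insert c' M)" "tr (insert c M) \<noteq> insert c M"
  using yL yN ntL L_def N_def by simp_all

lemma small_boxes:
  assumes "corner M d"
  shows "(1, 2) \<in> M - {d}" "(2, 1) \<in> M - {d}"
proof -
  have "\<not> corner M (1, 2)" "\<not> corner M (2, 1)"
    using corner_iff[OF yM, of "(1, 2)"] corner_iff[OF yM, of "(2, 1)"] boxM
    by (simp_all del: One_nat_def)
  then have "d \<noteq> (1, 2)" "d \<noteq> (2, 1)" using assms by blast+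
  then show "(1, 2) \<in> M - {d}" "(2, 1) \<in> M - {d}" using square_subset[OF yM boxM] by blast+
qed

lemma three_M: "corner M d \<Longrightarrow> M - {d} \<noteq> square \<Longrightarrow> card (LE (M - {d})) \<ge> 3"
  using card_LE_three[OF corner_young small_boxes] card_remove[OF yM] cards big by simp

lemma two_M: "corner M d \<Longrightarrow> card (LE (M - {d})) \<ge> 2"
  using card_LE_two[OF corner_young small_boxes] by blast

text \<open>If nothing separates, the corners of \<open>M\<close> satisfy
  \<open>geometry_self_transpose\<close>: \<open>S1\<close> comes from
  \<open>sep_below_other\<close>, \<open>S2\<close> from \<open>sep_direct\<close> for
  \<open>L - {d}\<close>, and \<open>S3\<close> from \<open>sep_below_first\<close> or, when the
  mirror image of \<open>c'\<close> interferes, from its transposed variant.\<close>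

lemma sep_self_transpose:
  assumes tN: "tr N = N"
  shows "sep L N"
proof (rule ccontr)
  assume ns: "\<not> sep L N"
  define e where "e = prod.swap c'"
  have eN: "corner N e" using corner_tr[of N c'] cN tN unfolding e_def by simp
  have ec: "e \<noteq> c'"
  proof
    assume "e = c'"
    then have "tr M = M" using tr_remove[of N c'] NM tN unfolding e_def by simp
    then show False using ntM by contradiction
  qed
  have eM: "corner M e" using corner_remove[OF yN cN eN] ec NM by auto
  have ei: "incmp e c'" using corner_incmp[OF yN eN cN ec] .
  have notsq: "M - {d} \<noteq> square" if "corner M d" "d \<noteq> e" for d
  proof
    assume sq: "M - {d} = square"
    have "e \<in> M - {d}" using eM that(2) by (auto simp: corner_def)
    then have "e \<in> square" unfolding sq .
    then have "c' \<in> square" unfolding e_def by (cases c') auto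
    then show False using mem(4) square_subset[OF yM boxM] by blast
  qed
  show False
  proof (rule geometry_self_transpose[OF yM boxM ntM inserts(1) mem(3) inserts(3) inserts(2) mem(4) _ ne e_def eM ei])
    show "tr (insert c' M) = insert c' M" using tN unfolding N_def[symmetric] .
  next
    fix d assume d: "corner M d" "incmp d c"
    show "incmp d c'"
    proof (rule ccontr)
      assume n: "\<not> incmp d c'"
      then have "d \<noteq> e" using ei by blast
      then show False using sep_below_other[OF d n three_M[OF d(1) notsq[OF d(1)]]] ns by blast
    qed
  next
    fix d assume d: "corner M d" "incmp d c" "incmp d c'"
    show "\<not> good (insert c M - {d})"
    proof
      assume "good (insert c M - {d})"
      then have g: "good (L - {d})" unfolding L_def .
      have dL: "corner L d" using corner_L[OF d(1,2)] .
      have cd: "card (L - {d}) = card L - 1" using card_remove[OF yL dL] .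
      have "card (LE (L - {d})) \<ge> 5"
        by (rule card_LE_five) (use g cd big in \<open>auto simp: good_def\<close>)
      then have three: "card (LE (L - {d})) \<ge> 3" by simp
      have cL': "c \<in> L - {d}" using mem(1,3) d(1) by (auto simp: corner_def)
      have "sep L N"
      proof (rule sep_direct[OF yL dL IH[OF g cd] ntL three yN cards(2)])
        show "N \<noteq> {}" using mem(2) by blast
        fix k
        \<comment> \<open>\<open>c\<close> belongs to \<open>L - {d}\<close>, while \<open>N\<close>
          equals its transpose and omits \<open>c\<close>.\<close>
        show "N - {k} \<noteq> L - {d} \<and> N - {k} \<noteq> tr (L - {d})"
        proof
          show "N - {k} \<noteq> L - {d}" using cL' mem(5) by blast
          show "N - {k} \<noteq> tr (L - {d})"
          proof
            assume "N - {k} = tr (L - {d})"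
            then have "tr (tr (L - {d})) \<subseteq> tr N" by (metis Diff_subset image_mono)
            then have "L - {d} \<subseteq> N" unfolding tr_tr tN .
            then show False using cL' mem(5) by blast
          qed
        qed
      qed
      then show False using ns by contradiction
    qed
  next
    fix d f assume d: "corner M d" "\<not> incmp d c" "incmp d c'" and f: "corner M f" "f \<noteq> d"
    show "\<not> incmp f c'"
    proof
      assume fi: "incmp f c'"
      consider "d \<noteq> e" | "d = e" "\<not> incmp f c" | "d = e" "incmp f c" by blast
      then show False
      proof cases
        case 1
        then show False
          using sep_below_first[OF d _ f fi three_M[OF d(1) notsq[OF d(1) 1]] two_M[OF f(1)]] ns
          unfolding e_def by blast
      next
        case 2
        then have fe: "f \<noteq> e" using f(2) by blast
        show False
          using sep_below_first[OF f(1) 2(2) fi _ eM _ ei three_M[OF f(1) notsq[OF f(1) fe]] two_M[OF eM]] fe ns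
          unfolding e_def by blast
      next
        case 3
        have fe: "f \<noteq> e" using 3 f(2) by blast
        have "\<not> incmp e c" using 3 d(2) by blast
        then show False
          using sep_below_first_transposed[OF e_def eM _ ei f(1) fe 3(2) fi two_M[OF f(1)] boxM] ns by blast
      qed
    qed
  qed
qed

text \<open>\<open>N\<close> is full too, so the roles can be exchanged: separating \<open>N\<close>
  from \<open>L\<close> gives 3-cycles invisible on \<open>L\<close> that cancel the action of
  \<open>h\<close> on \<open>N\<close>. Hence the separation lemmas are available in both
  directions.\<close>

lemma sep_not_self_transpose:
  assumes tN: "tr N \<noteq> N" and fullN: "full N"
  shows "sep L N"
proof (rule ccontr)
  assume ns: "\<not> sep L N"
  interpret sw: cover_pair N L M c' c
    by unfold_locales (use yL yN cL cN LM NM ne tN locM fullN five in auto)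
  have yM5: "card M \<ge> 5" using cards big by simp
  have fiveN: "card (LE N) \<ge> 5"
    by (rule card_LE_five[OF yN]) (use boxM N_def cards big in auto)
  have ns': "\<not> sep N L"
  proof
    assume s: "sep N L"
    have "card (LE M) \<ge> 3" using five by simp
    then obtain x y z where x: "x \<in> LE M" and y: "y \<in> LE M" "y \<noteq> x"
      and z: "z \<in> LE M" "z \<noteq> x" "z \<noteq> y"
      by (rule three_points)
    obtain h where h: "h \<in> G (card L)" "cyc h (LE L) (x @ [c]) (y @ [c]) (z @ [c])"
      "cyc h (LE N) (x @ [c']) (y @ [c']) (z @ [c'])"
      using exists_h[OF x y(1) z(1)] y(2) z(2,3) tN by metis
    have "sep L N"
      using sep_flip[OF sep_imp_cyc[OF fullN fiveN s, unfolded cards(2)] h] by blast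
    then show False using ns by contradiction
  qed
  have mixed: "incmp d c \<longleftrightarrow> incmp d c'" if d: "corner M d" "M - {d} \<noteq> square" for d
    using sep_below_other[OF d(1) _ _ three_M[OF d]] sw.sep_below_other[OF d(1) _ _ three_M[OF d]] ns ns'
      by blast
  have nosq: "M - {d} \<noteq> square" if d: "corner M d" for d
  proof
    assume "M - {d} = square"
    note s = square_cover_mixed_corner[OF yM d this inserts(1) mem(3) inserts(3) inserts(2) mem(4) tN[unfolded N_def] ne]
    show False using mixed[OF s(1,2)] s(3) by blast
  qed
  show False
  proof (rule geometry_non_self_transpose[OF yM boxM ntM yM5 inserts(1) mem(3) inserts(2) mem(4) ne])
    fix d assume "corner M d"
    then show "incmp d c \<longleftrightarrow> incmp d c'" using mixed nosq by blast
  next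
    fix d assume d: "corner M d" "incmp d c" "incmp d c'"
    have dL: "corner L d" "corner N d" using corner_L corner_N d by blast+
    have cd: "card (L - {d}) = card L - 1" "card (N - {d}) = card L - 1"
      using card_remove[OF yL dL(1)] card_remove[OF yN dL(2)] cards(2) by simp_all
    have f: "card (LE E) \<ge> 5" if "good E" "card E = card L - 1" for E
      by (rule card_LE_five) (use that big in \<open>auto simp: good_def\<close>)
    note three = three_M[OF d(1) nosq[OF d(1)]]
    have "N - {d} = tr (L - {d})" if "good (L - {d})"
      using sep_below_neither[OF d three IH[OF that cd(1)] f[OF that cd(1)]] ns by blast
    moreover have "N - {d} = tr (L - {d})" if "good (N - {d})"
      using sw.sep_below_neither[OF d(1,3,2) three IH[OF that cd(2)] f[OF that cd(2)]] ns' tr_tr[of "N - {d}"] by metis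
    ultimately show "\<not> good (insert c M - {d}) \<and> \<not> good (insert c' M - {d}) \<or>
        insert c' M - {d} = tr (insert c M - {d})"
      unfolding L_def[symmetric] N_def[symmetric] by blast
  qed
qed

end

theorem good_imp_loc:
  assumes "good D" "card D \<ge> 5"
  shows "loc D"
  using assms
proof (induction "card D" arbitrary: D rule: less_induct)
  case (less D)
  have yD: "young D" "(2, 2) \<in> D" "tr D \<noteq> D" using less.prems(1) by (auto simp: good_def)
  show ?case
  proof (cases "card D = 5")
    case True
    then show ?thesis using good_card_five[OF yD(1,2)] loc_lam32 loc_tr[OF loc_lam32] by blast
  next
    case False
    then have big: "card D \<ge> 6" using less.prems(2) by simp
    have IH: "loc E" if "good E" "card E = card D - 1" for E
      using less.hyps[of E] that big by simp
    \<comment> \<open>Stated for all good shapes of this size, since \<open>N\<close> must be full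
      as well in \<open>sep_not_self_transpose\<close>.\<close>
    have cover: "full E \<and> (\<exists>c. corner E c \<and> good (E - {c}))" if E: "good E" "card E = card D" for E
    proof -
      have yE: "young E" "(2, 2) \<in> E" "tr E \<noteq> E" using E(1) by (auto simp: good_def)
      obtain c where c: "corner E c" "good (E - {c})" using good_cover_exists[OF E(1)] E(2) big by auto
      have cc: "card (E - {c}) = card D - 1" using card_remove[OF yE(1) c(1)] E(2) by simp
      have "card (LE (E - {c})) \<ge> 5"
        by (rule card_LE_five) (use c(2) cc big in \<open>auto simp: good_def\<close>)
      then have three: "card (LE (E - {c})) \<ge> 3" by simp
      have "full E"
      proof (rule full_step[OF yE(1,2) c(1) three])
        fix x y z assume "x \<in> LE (E - {c})" "y \<in> LE (E - {c})" "z \<in> LE (E - {c})" "x \<noteq> y" "y \<noteq> z" "x \<noteq> z"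
        then obtain h where "h \<in> G (card E - 1)" "cyc h (LE E) (x @ [c]) (y @ [c]) (z @ [c])"
          using loc_lift[OF yE(1) c(1) IH[OF c(2) cc] yE(3)] by blast
        then show "\<exists>h\<in>G (card E). cyc h (LE E) (x @ [c]) (y @ [c]) (z @ [c])"
          using G_mono[of h "card E - 1" "card E"] by auto
      qed
      then show ?thesis using c by blast
    qed
    have full: "full D" using cover[OF less.prems(1)] by simp
    obtain c where c: "corner D c" "good (D - {c})" using cover[OF less.prems(1)] by blast
    have cc: "card (D - {c}) = card D - 1" using card_remove[OF yD(1) c(1)] .
    have five: "card (LE (D - {c})) \<ge> 5"
      by (rule card_LE_five) (use c(2) cc big in \<open>auto simp: good_def\<close>)
    have pair: "sep D N" if N: "young N" "N \<noteq> D" "corner N k" "N - {k} = D - {c}" "card N = card D" for N k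
    proof -
      have kc: "k \<noteq> c" using N(2-4) c(1) unfolding corner_def by blast
      interpret cover_pair_step D N "D - {c}" c k
        using yD N c kc full IH[OF c(2) cc] five big IH
        by (intro cover_pair_step.intro cover_pair.intro cover_pair_step_axioms.intro) auto
      show ?thesis
      proof (cases "tr N = N")
        case True
        then show ?thesis by (rule sep_self_transpose)
      next
        case False
        have "(2, 2) \<in> N" using boxM N_def by blast
        then have "good N" using N(1) False by (simp add: good_def)
        then have "full N" using cover N(5) by blast
        then show ?thesis by (rule sep_not_self_transpose[OF False])
      qed
    qed
    show ?thesis
    proof (rule loc_if_sep[OF full])
      show "card (LE D) \<ge> 5" using card_LE_five[OF yD(1,2) less.prems(2)] .
      fix N assume N: "young N" "card N = card D" "N \<noteq> D" "N \<noteq> tr D"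
      have ne: "N \<noteq> {}" using N(2) big by auto
      consider k where "corner N k" "N - {k} = D - {c}" | k where "corner N k" "N - {k} = tr (D - {c})"
        | "\<And>k. corner N k \<Longrightarrow> N - {k} \<noteq> D - {c} \<and> N - {k} \<noteq> tr (D - {c})" by blast
      then show "sep D N"
      proof cases
        case 1
        then show ?thesis using pair N by blast
      next
        case 2
        \<comment> \<open>Words commute with transposition, so \<open>N\<close> may be replaced by
          its transpose.\<close>
        have "tr N - {prod.swap k} = D - {c}" using 2(2) tr_remove[of N k] tr_tr[of "D - {c}"] by simp
        moreover have "corner (tr N) (prod.swap k)" using 2(1) by simp
        moreover have "tr N \<noteq> D" using N(4) by auto
        ultimately have "sep D (tr N)" using pair[of "tr N" "prod.swap k"] N(1,2) card_tr[of N] by simp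
        then show ?thesis unfolding sep_def using triv_tr by blast
      next
        case 3
        have "card (LE (D - {c})) \<ge> 3" using five by simp
        then show ?thesis using sep_direct[OF yD(1) c(1) IH[OF c(2) cc] yD(3) _ N(1,2) ne 3] by blast
      qed
    qed
  qed
qed

section \<open>Evacuation as a product of Bender--Knuth involutions\<close>

text \<open>The values form a separate list because jeu de taquin does not renumber: after a slide
  the entries no longer start at 1.\<close>

primrec fill :: "box list \<Rightarrow> nat list \<Rightarrow> filling" where
  "fill [] vs = (\<lambda>b. 0)"
| "fill (x # xs) vs = (fill xs (tl vs))(x := hd vs)"

text \<open>
  The hole of the jeu de taquin slide travels through the list: it is swapped with a following
  box that is incomparable to it, and moves on to a following box that is adjacent to it.
\<close>

primrec bubble :: "box \<Rightarrow> box list \<Rightarrow> box list" where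
  "bubble p [] = [p]"
| "bubble p (b # ys) = (if incmp p b then b # bubble p ys else p # bubble b ys)"

text \<open>The product of \<open>bk i\<close>, ..., \<open>bk (i + k - 1)\<close> with
  \<open>bk i\<close> applied first. For \<open>i = 0\<close> this is Schuetzenberger's promotion on
  \<open>k + 1\<close> boxes, and evacuation iterates it on shrinking prefixes.\<close>

primrec promote :: "nat \<Rightarrow> nat \<Rightarrow> box list \<Rightarrow> box list" where
  "promote i 0 = id"
| "promote i (Suc k) = promote (Suc i) k \<circ> bk i"

primrec evacuate :: "nat \<Rightarrow> box list \<Rightarrow> box list" where
  "evacuate 0 = id"
| "evacuate (Suc m) = evacuate m \<circ> promote 0 m"

lemma fill_outside: "b \<notin> set xs \<Longrightarrow> fill xs vs b = 0"
  by (induction xs arbitrary: vs) auto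

lemma fill_mem: "b \<in> set xs \<Longrightarrow> length xs = length vs \<Longrightarrow> fill xs vs b \<in> set vs"
proof (induction xs arbitrary: vs)
  case (Cons x xs)
  then obtain v vs' where "vs = v # vs'" by (cases vs) auto
  then show ?case using Cons by auto
qed simp

lemma fill_nth: "distinct xs \<Longrightarrow> i < length xs \<Longrightarrow> length xs = length vs \<Longrightarrow> fill xs vs (xs ! i) = vs ! i"
proof (induction xs arbitrary: vs i)
  case (Cons x xs)
  then obtain v vs' where "vs = v # vs'" by (cases vs) auto
  then show ?case using Cons by (cases i) auto
qed simp

lemma fill_append:
  "length xs = length vs \<Longrightarrow> fill (xs @ ys) (vs @ ws) b = (if b \<in> set xs then fill xs vs b else fill ys ws b)"
proof (induction xs arbitrary: vs)
  case (Cons x xs)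
  then obtain v vs' where "vs = v # vs'" by (cases vs) auto
  then show ?case using Cons by auto
qed simp

lemma bubble_nonempty [simp]: "bubble p ys \<noteq> []"
  by (cases ys) auto

lemma set_bubble: "set (bubble p ys) = insert p (set ys)"
  by (induction ys arbitrary: p) auto

lemma promote_bubble: "promote (length us) (length ys) (us @ p # ys) = us @ bubble p ys"
proof (induction ys arbitrary: us p)
  case (Cons b ys)
  show ?case
    using Cons[of "us @ [b]" p] Cons[of "us @ [p]" b] by (simp add: bk_decomp)
qed simp

lemma promote_Suc: "promote i (Suc k) = bk (i + k) \<circ> promote i k"
proof (induction k arbitrary: i)
  case (Suc k)
  have "promote i (Suc (Suc k)) = promote (Suc i) (Suc k) \<circ> bk i" by simp
  also have "\<dots> = bk (Suc i + k) \<circ> promote (Suc i) k \<circ> bk i" by (simp only: Suc)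
  finally show ?case by (simp add: comp_assoc)
qed simp

lemma promote_mem: "i + k < m \<Longrightarrow> promote i k \<in> G m"
proof (induction k arbitrary: i)
  case (Suc k)
  then show ?case using G_comp[OF Suc.IH[of "Suc i"] G_bk[of i m]] by (simp only: promote.simps)
qed (simp only: promote.simps G_id)

lemma evacuate_mem: "evacuate m \<in> G m"
proof (induction m)
  case (Suc m)
  have "evacuate m \<circ> promote 0 m \<in> G (Suc m)"
    by (rule G_comp[OF G_mono[OF Suc] promote_mem]) simp_all
  then show ?case by (simp only: evacuate.simps)
qed (simp only: evacuate.simps G_id)

section \<open>Jeu de taquin as a walk through the list of boxes\<close>

locale sliding =
  fixes xs :: "box list" and vs :: "nat list" and T :: filling
  assumes pre: "\<And>k. young (set (take k xs))" and dist: "distinct xs" and len: "length xs = length vs"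
    and inc: "sorted_wrt (<) vs" and pos: "0 \<notin> set vs" and T: "T = fill xs vs"
begin

lemma T_nth: "i < length xs \<Longrightarrow> T (xs ! i) = vs ! i"
  using fill_nth[OF dist _ len] T by simp

lemma T_zero: "T b = 0 \<longleftrightarrow> b \<notin> set xs"
  using fill_outside[of b xs vs] fill_mem[of b xs vs] len pos T by metis

lemma T_less:
  assumes "xs = As @ Bs" "a \<in> set As" "b \<in> set Bs"
  shows "T a < T b"
proof -
  obtain i where i: "i < length As" "As ! i = a" using assms(2) by (auto simp: in_set_conv_nth)
  obtain j where j: "j < length Bs" "Bs ! j = b" using assms(3) by (auto simp: in_set_conv_nth)
  have "xs ! i = a" "xs ! (length As + j) = b" using assms(1) i j by (auto simp: nth_append)
  moreover have "vs ! i < vs ! (length As + j)"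
    using sorted_wrt_nth_less[OF inc, of i "length As + j"] i j assms(1) len by simp
  ultimately show ?thesis using T_nth[of i] T_nth[of "length As + j"] assms(1) i j by simp
qed

abbreviation right :: "box \<Rightarrow> box" where "right b \<equiv> (fst b, Suc (snd b))"
abbreviation down :: "box \<Rightarrow> box" where "down b \<equiv> (Suc (fst b), snd b)"

definition path :: "box \<Rightarrow> box set" where
  "path p = range (\<lambda>k. (slide_next T ^^ k) p)"

lemma path_rec: "path p = insert p (path (slide_next T p))"
proof -
  have "(slide_next T ^^ k) p \<in> insert p (path (slide_next T p))" for k
    unfolding path_def by (cases k) (auto simp: funpow_swap1)
  moreover have "(slide_next T ^^ k) (slide_next T p) = (slide_next T ^^ Suc k) p" for k
    by (simp add: funpow_swap1)
  then have "(slide_next T ^^ k) (slide_next T p) \<in> path p" for k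
    unfolding path_def by (metis rangeI)
  moreover have "p \<in> path p" unfolding path_def by (metis funpow_0 rangeI)
  ultimately show ?thesis unfolding path_def by blast
qed

lemma path_fix: "slide_next T p = p \<Longrightarrow> path p = {p}"
proof -
  assume "slide_next T p = p"
  then have "(slide_next T ^^ k) p = p" for k by (induction k) auto
  then show ?thesis unfolding path_def by auto
qed

text \<open>The invariant of the slide: the boxes \<open>As\<close> have been passed and the hole
  \<open>p\<close> is a corner of their shape, so only entries of \<open>ys\<close> can move into
  it.\<close>

definition hole :: "box \<Rightarrow> box list \<Rightarrow> box list \<Rightarrow> bool" where
  "hole p As ys \<longleftrightarrow> xs = As @ ys \<and> p \<in> set As \<and> right p \<notin> set As \<and> down p \<notin> set As"

lemma hole_young: "hole p As ys \<Longrightarrow> young (set As)"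
  using pre[of "length As"] unfolding hole_def by auto

lemma hole_corner: "hole p As ys \<Longrightarrow> corner (set As) p"
  using corner_iff[OF hole_young, of p As ys p] unfolding hole_def by blast

lemma hole_skip: "hole p As (b # ys) \<Longrightarrow> incmp p b \<Longrightarrow> hole p (As @ [b]) ys"
  unfolding hole_def incmp_def by auto

text \<open>A box addable to \<open>As\<close> and comparable to its corner \<open>p\<close> is
  adjacent to \<open>p\<close>. The other neighbour of the hole is empty or comes later in the list,
  so \<open>b\<close> carries the smaller entry.\<close>

lemma hole_next:
  assumes h: "hole p As (b # ys)" and ni: "\<not> incmp p b"
  shows "hole b (As @ [b]) ys" "slide_next T p = b" "b \<noteq> p"
proof -
  have xs: "xs = As @ b # ys" using h unfolding hole_def by blast
  have bA: "b \<notin> set As" using dist xs by auto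
  have yb: "young (insert b (set As))" using pre[of "Suc (length As)"] xs by simp
  have pA: "p \<in> set As" using h unfolding hole_def by blast
  show bp: "b \<noteq> p" using pA bA by blast
  have adj: "b = right p \<or> b = down p"
    using comparable_corner_addable[OF hole_young[OF h] hole_corner[OF h] yb bA ni] .
  have bpos: "1 \<le> fst b" "1 \<le> snd b" using young_pos[OF yb, of "fst b" "snd b"] by simp_all
  have "right b \<notin> set As" "down b \<notin> set As"
    using youngD[OF hole_young[OF h], of "fst b" "Suc (snd b)" "fst b" "snd b"]
      youngD[OF hole_young[OF h], of "Suc (fst b)" "snd b" "fst b" "snd b"] bA bpos by auto
  moreover have "right b \<noteq> b" "down b \<noteq> b" by (metis fst_conv snd_conv n_not_Suc_n)+
  ultimately show "hole b (As @ [b]) ys" using xs unfolding hole_def by simp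
  have later: "T a = 0 \<or> T b < T a" if "a \<notin> set As" "a \<noteq> b" for a
  proof (cases "a \<in> set ys")
    case True
    then show ?thesis using T_less[of "As @ [b]" ys b a] xs by simp
  next
    case False
    then show ?thesis using T_zero[of a] that xs by simp
  qed
  have rd: "right p \<notin> set As" "down p \<notin> set As" using h unfolding hole_def by blast+
  have Tb: "T b \<noteq> 0" using T_zero[of b] xs by simp
  have rdn: "right p \<noteq> down p" by simp
  show "slide_next T p = b"
    using adj
  proof
    assume b: "b = right p"
    have "T (down p) = 0 \<or> T b < T (down p)" using later[OF rd(2)] b rdn by metis
    then show ?thesis using b Tb unfolding slide_next_def Let_def by auto
  next
    assume b: "b = down p"
    have "T (right p) = 0 \<or> T b < T (right p)" using later[OF rd(1)] b rdn by metis
    then show ?thesis using b Tb unfolding slide_next_def Let_def by auto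
  qed
qed

lemma hole_end: "hole p As [] \<Longrightarrow> slide_next T p = p"
  using T_zero[of "right p"] T_zero[of "down p"] unfolding hole_def slide_next_def Let_def by simp

lemma path_subset: "hole p As ys \<Longrightarrow> path p \<subseteq> insert p (set ys)"
proof (induction ys arbitrary: p As)
  case Nil
  then show ?case using path_fix[OF hole_end[OF Nil]] by simp
next
  case (Cons b ys)
  show ?case
  proof (cases "incmp p b")
    case True
    then show ?thesis using Cons.IH[OF hole_skip[OF Cons.prems True]] by auto
  next
    case False
    note n = hole_next[OF Cons.prems False]
    show ?thesis using Cons.IH[OF n(1)] path_rec[of p] n(2) by auto
  qed
qed

text \<open>After the slide, the box at place \<open>i\<close> of the bubbled list carries the entry
  that stood at place \<open>i\<close> of \<open>ys\<close>. The last box is the vacated one, hence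
  \<open>butlast\<close>.\<close>

lemma slide_bubble:
  assumes "hole p As ys" "length ws = length ys" "\<And>i. i < length ys \<Longrightarrow>
      T (ys ! i) = ws ! i" "a \<in> insert p (set ys)"
  shows "fill (butlast (bubble p ys)) ws a =
    (if a \<in> path p then (if slide_next T a = a then 0 else T (slide_next T a)) else T a)"
  using assms
proof (induction ys arbitrary: p As ws)
  case Nil
  then show ?case using path_fix[OF hole_end[OF Nil(1)]] hole_end[OF Nil(1)] by simp
next
  case (Cons b ys)
  obtain w ws' where ws: "ws = w # ws'" using Cons.prems(2) by (cases ws) auto
  have w: "T b = w" using Cons.prems(3)[of 0] ws by simp
  have ws': "length ws' = length ys" "\<And>i. i < length ys \<Longrightarrow> T (ys ! i) = ws' ! i"
    using Cons.prems(2) Cons.prems(3)[of "Suc i" for i] ws by auto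
  have d: "b \<notin> set ys" "p \<notin> set ys" "b \<noteq> p" using dist Cons.prems(1) unfolding hole_def by auto
  show ?case
  proof (cases "incmp p b")
    case True
    note h = hole_skip[OF Cons.prems(1) True]
    show ?thesis
    proof (cases "a = b")
      case a: True
      have "b \<notin> path p" using path_subset[OF h] d by blast
      then show ?thesis using a True ws w by simp
    next
      case False
      then show ?thesis using Cons.IH[OF h ws'] Cons.prems(4) True ws by simp
    qed
  next
    case False
    note n = hole_next[OF Cons.prems(1) False]
    show ?thesis
    proof (cases "a = p")
      case True
      have "p \<in> path p" using path_rec[of p] by blast
      then show ?thesis using True False ws w n(2,3) by simp
    next
      case ap: False
      then have "a \<in> path p \<longleftrightarrow> a \<in> path b" using path_rec[of p] n(2) by simp
      then show ?thesis using Cons.IH[OF n(1) ws'] Cons.prems(4) False ap ws by simp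
    qed
  qed
qed

lemma slide_eq:
  assumes xs: "xs = (1, 1) # ys"
  shows "slide T = fill (butlast (bubble (1, 1) ys)) (tl vs)"
proof
  fix a
  have h: "hole (1, 1) [(1, 1)] ys" using xs unfolding hole_def by simp
  have ws: "length (tl vs) = length ys" using len xs by simp
  have Tn: "T (ys ! i) = tl vs ! i" if "i < length ys" for i
    using T_nth[of "Suc i"] that xs ws by (simp add: nth_tl)
  have sp: "slide_path T = path (1, 1)" by (simp add: slide_path_def path_def)
  show "slide T a = fill (butlast (bubble (1, 1) ys)) (tl vs) a"
  proof (cases "a \<in> insert (1, 1) (set ys)")
    case True
    then show ?thesis using slide_bubble[OF h ws Tn True] unfolding slide_def sp by simp
  next
    case False
    then have "a \<notin> path (1, 1)" using path_subset[OF h] by blast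
    moreover have "T a = 0" using T_zero[of a] False xs by simp
    moreover have "a \<notin> set (butlast (bubble (1, 1) ys))"
      using False set_bubble[of "(1, 1)" ys] in_set_butlastD by fastforce
    ultimately show ?thesis unfolding slide_def sp using fill_outside by simp
  qed
qed

end

declare upt_Suc [simp del]

text \<open>\<open>vs\<close> is general because a slide drops its head and keeps the rest. The
  vacated box is the last box \<open>l\<close> of the promoted list, and all later steps leave it in
  place.\<close>

lemma evac_fill:
  assumes "xs \<in> LE D" "card D = m" "length vs = m" "sorted_wrt (<) vs" "0 \<notin> set vs"
  shows "evac m (fill xs vs) = fill (evacuate m xs) [1..<Suc m]"
  using assms
proof (induction m arbitrary: xs D vs)
  case 0
  then have "xs = []" using LE_length by fastforce
  then show ?case by simp
next
  case (Suc m)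
  have lx: "length xs = Suc m" using LE_length[OF Suc.prems(1)] Suc.prems(2) by simp
  then obtain p ys where xs: "xs = p # ys" using lx by (cases xs) auto
  have p: "p = (1, 1)" using LE_first[OF Suc.prems(1) xs] .
  interpret sliding xs vs "fill xs vs"
    using Suc.prems lx by unfold_locales (auto simp: LE_def)
  let ?B = "bubble (1, 1) ys"
  have sl: "slide (fill xs vs) = fill (butlast ?B) (tl vs)" using slide_eq xs p by simp
  have pB: "promote 0 m xs = ?B" 
  proof -
    have "length ys = m" using lx xs by simp
    then show ?thesis using promote_bubble[of "[]" ys p] xs p by (simp only: list.size append.simps)
  qed
  have BD: "?B \<in> LE D" using G_LE[OF promote_mem[of 0 m "Suc m"] Suc.prems(1)] pB by simp
  have ne: "D \<noteq> {}" using Suc.prems(2) by auto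
  obtain zs l where zl: "?B = zs @ [l]" "corner D l" "zs \<in> LE (D - {l})"
    using LE_snocE[OF BD ne] by metis
  have cz: "card (D - {l}) = m" using card_remove[OF LE_young[OF BD] zl(2)] Suc.prems(2) by simp
  have tl: "length (tl vs) = m" "sorted_wrt (<) (tl vs)" "0 \<notin> set (tl vs)"
    using Suc.prems(3-5) by (cases vs; auto)+
  note IH = Suc.IH[OF zl(3) cz tl]
  have bl: "butlast ?B = zs" using zl(1) by simp
  have lz: "length zs = m" using LE_length[OF zl(3)] cz by simp
  have ev: "evacuate (Suc m) xs = evacuate m zs @ [l]"
    using pB zl(1) G_append[OF evacuate_mem[of m] lz, of "[l]"] by simp
  have ez: "evacuate m zs \<in> LE (D - {l})" using G_LE[OF evacuate_mem zl(3)] .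
  have sx: "set xs = D" "set zs = D - {l}" "l \<in> D" "set (evacuate m zs) = D - {l}"
    using Suc.prems(1) zl ez by (auto simp: LE_def corner_def)
  have zpos: "fill zs (tl vs) b = 0 \<longleftrightarrow> b \<notin> set zs" for b
    using fill_outside[of b zs "tl vs"] fill_mem[of b zs "tl vs"] lz tl by metis
  show ?case
  proof
    fix b
    have r: "fill (evacuate (Suc m) xs) [1..<Suc (Suc m)] b =
        (if b \<in> D - {l} then fill (evacuate m zs) [1..<Suc m] b else if b = l then Suc m else 0)"
    proof -
      have "[1..<Suc (Suc m)] = [1..<Suc m] @ [Suc m]" by (simp add: upt_Suc_append)
      moreover have "length (evacuate m zs) = length [1..<Suc m]" using LE_length[OF ez] cz by simp
      ultimately show ?thesis
        using fill_append[of "evacuate m zs" "[1..<Suc m]" "[l]" "[Suc m]" b] sx(4) ev by simp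
    qed
    have "evac (Suc m) (fill xs vs) b =
        (if b \<in> D \<and> b \<notin> set zs then Suc m else fill (evacuate m zs) [1..<Suc m] b)"
      using IH T_zero[of b] zpos[of b] sx(1) unfolding evac.simps sl bl by simp
    also have "\<dots> = fill (evacuate (Suc m) xs) [1..<Suc (Suc m)] b"
      unfolding r using sx fill_outside[of b "evacuate m zs" "[1..<Suc m]"] by auto
    finally show "evac (Suc m) (fill xs vs) b = fill (evacuate (Suc m) xs) [1..<Suc (Suc m)] b" .
  qed
qed

section \<open>Lists as tableaux and partial evacuation\<close>

definition tableau :: "box list \<Rightarrow> filling" where
  "tableau xs = fill xs [1..<Suc (length xs)]"

lemma tableau_nth: "distinct xs \<Longrightarrow> i < length xs \<Longrightarrow> tableau xs (xs ! i) = Suc i"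
  using fill_nth[of xs i "[1..<Suc (length xs)]"] unfolding tableau_def by simp

lemma tableau_outside: "b \<notin> set xs \<Longrightarrow> tableau xs b = 0"
  using fill_outside unfolding tableau_def by blast

lemma upt_split: "j \<le> n \<Longrightarrow> [1..<Suc n] = [1..<Suc j] @ [Suc j..<Suc n]"
  using upt_add_eq_append[of 1 "Suc j" "n - j"] by simp

lemma evac_upto_tableau:
  assumes xs: "xs \<in> LE D" and j: "j \<le> card D"
  shows "evac_upto j (tableau xs) = tableau (evacuate j xs)"
proof
  fix b
  let ?n = "card D"
  have len: "length xs = ?n" using LE_length[OF xs] .
  let ?us = "take j xs" and ?ws = "drop j xs"
  have lu: "length ?us = j" using len j by simp
  have dist: "distinct xs" using xs by (simp add: LE_def)
  have ulE: "?us \<in> LE (set ?us)"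
    using xs by (auto simp: LE_def take_take)
  have cu: "card (set ?us) = j" using LE_length[OF ulE] lu by simp
  have T: "tableau xs b = (if b \<in> set ?us then fill ?us [1..<Suc j] b else fill ?ws [Suc j..<Suc ?n] b)" for b
  proof -
    have "tableau xs = fill (?us @ ?ws) ([1..<Suc j] @ [Suc j..<Suc ?n])"
      unfolding tableau_def len upt_split[OF j] by simp
    then show ?thesis using fill_append[of ?us "[1..<Suc j]" ?ws "[Suc j..<Suc ?n]" b] lu by simp
  qed
  have E: "evacuate j xs = evacuate j ?us @ ?ws" using G_append[OF evacuate_mem lu, of ?ws] by simp
  have eL: "evacuate j ?us \<in> LE (set ?us)" using G_LE[OF evacuate_mem ulE] .
  have le: "length (evacuate j ?us) = j" "set (evacuate j ?us) = set ?us" using LE_length[OF eL] cu eL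
    by (auto simp: LE_def)
  have lex: "length (evacuate j xs) = ?n" using E le lu len by simp
  have T': "tableau (evacuate j xs) b = (if b \<in> set ?us then fill (evacuate j ?us) [1..<Suc j] b else fill ?ws [Suc j..<Suc ?n] b)" for b
  proof -
    have "tableau (evacuate j xs) = fill (evacuate j ?us @ ?ws) ([1..<Suc j] @ [Suc j..<Suc ?n])"
      unfolding tableau_def lex upt_split[OF j] by (simp only: E)
    then show ?thesis using fill_append[of "evacuate j ?us" "[1..<Suc j]" ?ws "[Suc j..<Suc ?n]" b] le by simp
  qed
  \<comment> \<open>Empty boxes carry 0 and also pass the test in \<open>evac_upto\<close>.\<close>
  have le_iff: "tableau xs b \<le> j \<longleftrightarrow> b \<in> set ?us \<or> b \<notin> set xs" for b
  proof (cases "b \<in> set ?us")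
    case True
    then have "fill ?us [1..<Suc j] b \<in> set [1..<Suc j]" using fill_mem[of b ?us "[1..<Suc j]"] lu by simp
    then show ?thesis using T[of b] True by auto
  next
    case False
    show ?thesis
    proof (cases "b \<in> set xs")
      case True
      then have "b \<in> set ?ws" using False by (metis append_take_drop_id Un_iff set_append)
      then have "fill ?ws [Suc j..<Suc ?n] b \<in> set [Suc j..<Suc ?n]"
        using fill_mem[of b ?ws "[Suc j..<Suc ?n]"] len by simp
      then show ?thesis using T[of b] False True by auto
    next
      case out: False
      then show ?thesis using tableau_outside by simp
    qed
  qed
  have sub: "(\<lambda>c. if tableau xs c \<le> j then tableau xs c else 0) = fill ?us [1..<Suc j]"
  proof
    fix c
    show "(if tableau xs c \<le> j then tableau xs c else 0) = fill ?us [1..<Suc j] c"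
    proof (cases "c \<in> set ?us")
      case True
      then show ?thesis using le_iff[of c] T[of c] by (simp del: One_nat_def)
    next
      case False
      then show ?thesis
        using le_iff[of c] tableau_outside[of c xs] fill_outside[OF False, of "[1..<Suc j]"]
        by (cases "c \<in> set xs") (simp_all del: One_nat_def)
    qed
  qed
  have sorted: "sorted_wrt (<) [1..<Suc j]" "0 \<notin> set [1..<Suc j]" "length [1..<Suc j] = j" by simp_all
  have ev: "evac j (fill ?us [1..<Suc j]) = fill (evacuate j ?us) [1..<Suc j]"
    using evac_fill[OF ulE cu sorted(3,1,2)] .
  show "evac_upto j (tableau xs) b = tableau (evacuate j xs) b"
  proof (cases "b \<in> set ?us")
    case True
    then show ?thesis unfolding evac_upto_def sub ev using le_iff[of b] T'[of b] by simp
  next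
    case False
    show ?thesis
    proof (cases "b \<in> set xs")
      case True
      then show ?thesis unfolding evac_upto_def sub ev using le_iff[of b] T'[of b] T[of b] False by simp
    next
      case out: False
      then have "b \<notin> set ?ws" using in_set_dropD by metis
      then show ?thesis unfolding evac_upto_def sub ev
        using le_iff[of b] T'[of b] False out fill_outside[of b "evacuate j ?us"] fill_outside[of b ?ws] le(2) by simp
    qed
  qed
qed

section \<open>Tableaux of partition shape as linear extensions\<close>

lemma diagram_image:
  "diagram lam = (\<lambda>(i, j). (Suc i, Suc j)) ` (SIGMA i:{..<length lam}. {..<lam ! i})"
proof
  show "diagram lam \<subseteq> (\<lambda>(i, j). (Suc i, Suc j)) ` (SIGMA i:{..<length lam}. {..<lam ! i})"
  proof
    fix b assume "b \<in> diagram lam"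
    then obtain i j where b: "b = (i, j)" "1 \<le> i" "i \<le> length lam" "1 \<le> j" "j \<le> lam ! (i - 1)"
      by (auto simp: diagram_def)
    then show "b \<in> (\<lambda>(i, j). (Suc i, Suc j)) ` (SIGMA i:{..<length lam}. {..<lam ! i})"
      by (intro image_eqI[of _ _ "(i - 1, j - 1)"]) auto
  qed
qed (auto simp: diagram_def)

lemma card_diagram: "card (diagram lam) = sum_list lam"
proof -
  have "inj_on (\<lambda>(i, j). (Suc i, Suc j)) A" for A by (auto simp: inj_on_def)
  then have "card (diagram lam) = card (SIGMA i:{..<length lam}. {..<lam ! i})"
    unfolding diagram_image by (rule card_image)
  also have "\<dots> = (\<Sum>i<length lam. lam ! i)" by simp
  also have "\<dots> = sum_list lam" by (simp add: sum_list_sum_nth atLeast0LessThan)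
  finally show ?thesis .
qed

lemma young_diagram:
  assumes "partition_of n lam"
  shows "young (diagram lam)"
  unfolding young_def
proof (intro conjI allI impI)
  show "finite (diagram lam)" unfolding diagram_image by simp
  fix i j assume ij: "(i, j) \<in> diagram lam"
  then show "1 \<le> i" "1 \<le> j" by (auto simp: diagram_def)
  fix i' j' assume le: "1 \<le> i' \<and> i' \<le> i \<and> 1 \<le> j' \<and> j' \<le> j"
  have s: "sorted_wrt (\<ge>) lam" using assms by (simp add: partition_of_def)
  have b: "i \<le> length lam" "j \<le> lam ! (i - 1)" using ij by (auto simp: diagram_def)
  have "lam ! (i - 1) \<le> lam ! (i' - 1)"
  proof (cases "i' = i")
    case False
    then show ?thesis using sorted_wrt_nth_less[OF s, of "i' - 1" "i - 1"] le b by auto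
  qed simp
  then show "(i', j') \<in> diagram lam" using le b by (auto simp: diagram_def)
qed

lemma tableau_mem_SYT:
  assumes xs: "xs \<in> LE (diagram lam)"
  shows "tableau xs \<in> SYT lam"
proof -
  let ?D = "diagram lam"
  have d: "distinct xs" "set xs = ?D" and pre: "\<And>k. young (set (take k xs))" using xs by (auto simp: LE_def)
  have len: "length xs = sum_list lam" using LE_length[OF xs] card_diagram by simp
  have less: "tableau xs a < tableau xs b"
    if ab: "a \<in> ?D" "b \<in> ?D" "a \<noteq> b" "fst a \<le> fst b" "snd a \<le> snd b" for a b
  proof -
    obtain j where j: "j < length xs" "xs ! j = b" using ab(2) d(2) by (metis in_set_conv_nth)
    have "b \<in> set (take (Suc j) xs)" using j by (simp add: take_Suc_conv_app_nth)
    moreover have "1 \<le> fst a" "1 \<le> snd a" using ab(1) by (auto simp: diagram_def)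
    ultimately have "(fst a, snd a) \<in> set (take (Suc j) xs)"
      using youngD[OF pre, of "fst b" "snd b" "Suc j" "fst a" "snd a"] ab by simp
    then have "a \<in> set (take (Suc j) xs)" by simp
    then obtain i where i: "i < Suc j" "i < length xs" "xs ! i = a" by (auto simp: in_set_conv_nth)
    then have "i \<noteq> j" using j ab(3) by auto
    then have "i < j" using i(1) by simp
    then show ?thesis using tableau_nth[OF d(1) i(2)] tableau_nth[OF d(1) j(1)] i(3) j(2) by simp
  qed
  have "bij_betw (tableau xs) ?D {1..sum_list lam}"
  proof (rule bij_betw_imageI)
    show "inj_on (tableau xs) ?D"
    proof (rule inj_onI)
      fix a b assume ab: "a \<in> ?D" "b \<in> ?D" "tableau xs a = tableau xs b"
      obtain i where i: "i < length xs" "xs ! i = a" using ab(1) d(2) by (metis in_set_conv_nth)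
      obtain j where j: "j < length xs" "xs ! j = b" using ab(2) d(2) by (metis in_set_conv_nth)
      have "Suc i = Suc j" using tableau_nth[OF d(1) i(1)] tableau_nth[OF d(1) j(1)] ab(3) i(2) j(2) by simp
      then show "a = b" using i j by simp
    qed
    show "tableau xs ` ?D = {1..sum_list lam}"
    proof (intro equalityI subsetI)
      fix v assume "v \<in> tableau xs ` ?D"
      then obtain i where "i < length xs" "v = tableau xs (xs ! i)" using d(2)
        by (metis imageE in_set_conv_nth)
      then show "v \<in> {1..sum_list lam}" using tableau_nth[OF d(1)] len by simp
    next
      fix v assume "v \<in> {1..sum_list lam}"
      then have "v - 1 < length xs" "v = Suc (v - 1)" using len by auto
      then have "v = tableau xs (xs ! (v - 1))" "xs ! (v - 1) \<in> ?D" using tableau_nth[OF d(1)] d(2)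
        by (metis, metis nth_mem)
      then show "v \<in> tableau xs ` ?D" by (rule image_eqI)
    qed
  qed
  moreover have "\<forall>b. b \<notin> ?D \<longrightarrow> tableau xs b = 0" using tableau_outside d(2) by blast
  moreover have "\<forall>i j j'. (i, j) \<in> ?D \<and> (i, j') \<in> ?D \<and> j < j' \<longrightarrow> tableau xs (i, j) < tableau xs (i, j')"
    using less by force
  moreover have "\<forall>i i' j. (i, j) \<in> ?D \<and> (i', j) \<in> ?D \<and> i < i' \<longrightarrow> tableau xs (i, j) < tableau xs (i', j)"
    using less by force
  ultimately show ?thesis unfolding SYT_def by blast
qed

text \<open>List the boxes by their entries. Those with entry at most \<open>k\<close> form a
  diagram because entries increase along rows and columns.\<close>

lemma SYT_imp_tableau:
  assumes p: "partition_of n lam" and T: "T \<in> SYT lam"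
  shows "\<exists>xs\<in>LE (diagram lam). T = tableau xs"
proof -
  let ?D = "diagram lam" and ?n = "sum_list lam"
  have yD: "young ?D" using young_diagram[OF p] .
  have zero: "\<And>b. b \<notin> ?D \<Longrightarrow> T b = 0" and bij: "bij_betw T ?D {1..?n}"
    and row: "\<And>i j j'. (i, j) \<in> ?D \<Longrightarrow> (i, j') \<in> ?D \<Longrightarrow> j < j' \<Longrightarrow> T (i, j) < T (i, j')"
    and col: "\<And>i i' j. (i, j) \<in> ?D \<Longrightarrow> (i', j) \<in> ?D \<Longrightarrow> i < i' \<Longrightarrow> T (i, j) < T (i', j)"
    using T unfolding SYT_def by blast+
  define f where "f = inv_into ?D T"
  have Tf: "T (f v) = v" "f v \<in> ?D" if "v \<in> {1..?n}" for v
    using that bij unfolding f_def by (metis bij_betw_def f_inv_into_f, metis bij_betw_def inv_into_into)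
  have fT: "f (T b) = b" if "b \<in> ?D" for b
    using that bij unfolding f_def by (simp add: bij_betw_def)
  have TD: "T b \<in> {1..?n}" if "b \<in> ?D" for b using that bij bij_betwE by metis
  define xs where "xs = map f [1..<Suc ?n]"
  have dist: "distinct xs"
  proof -
    have "inj_on f {1..?n}" by (rule inj_on_inverseI[of _ T]) (rule Tf(1))
    then show ?thesis unfolding xs_def distinct_map by (simp add: atLeastLessThanSuc_atLeastAtMost)
  qed
  have tk: "set (take k xs) = {b \<in> ?D. T b \<le> k}" for k
  proof (intro equalityI subsetI)
    fix b assume "b \<in> set (take k xs)"
    then obtain i where "i < k" "i < ?n" "b = f (Suc i)"
      unfolding xs_def by (auto simp: in_set_conv_nth)
    then show "b \<in> {b \<in> ?D. T b \<le> k}" using Tf[of "Suc i"] by simp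
  next
    fix b assume b: "b \<in> {b \<in> ?D. T b \<le> k}"
    then have t: "T b \<in> {1..?n}" "T b \<le> k" "f (T b) = b" using TD fT by auto
    then have i: "T b - 1 < length xs" "T b - 1 < k" unfolding xs_def by auto
    have "xs ! (T b - 1) = f (T b)"
    proof -
      have "T b - 1 < length [1..<Suc ?n]" "[1..<Suc ?n] ! (T b - 1) = T b" using t(1) by auto
      then show ?thesis unfolding xs_def by (simp only: nth_map)
    qed
    then have "take k xs ! (T b - 1) = b" using t(3) i(2) by simp
    then show "b \<in> set (take k xs)" using i by (metis length_take min_less_iff_conj nth_mem)
  qed
  have le: "T (i', j') \<le> T (i, j)" if "(i, j) \<in> ?D" "1 \<le> i'" "i' \<le> i" "1 \<le> j'" "j' \<le> j" for i j i' j'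
  proof -
    have m: "(i', j') \<in> ?D" "(i', j) \<in> ?D" using youngD[OF yD that(1)] that by auto
    have "T (i', j') \<le> T (i', j)" using row[OF m] that(5) by (cases "j' = j") auto
    also have "\<dots> \<le> T (i, j)" using col[OF m(2) that(1)] that(3) by (cases "i' = i") auto
    finally show ?thesis .
  qed
  have pre: "young (set (take k xs))" for k
    unfolding tk young_def
  proof (intro conjI allI impI)
    show "finite {b \<in> ?D. T b \<le> k}" using young_finite[OF yD] by simp
    fix i j assume ij: "(i, j) \<in> {b \<in> ?D. T b \<le> k}"
    then show "1 \<le> i" "1 \<le> j" using young_pos[OF yD, of i j] by auto
    fix i' j' assume l: "1 \<le> i' \<and> i' \<le> i \<and> 1 \<le> j' \<and> j' \<le> j"
    have D: "(i, j) \<in> ?D" "T (i, j) \<le> k" using ij by auto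
    have "(i', j') \<in> ?D" using youngD[OF yD D(1)] l by blast
    moreover have "T (i', j') \<le> T (i, j)" using le[OF D(1)] l by blast
    ultimately show "(i', j') \<in> {b \<in> ?D. T b \<le> k}" using D(2) by simp
  qed
  have set: "set xs = ?D"
  proof -
    have "set xs = set (take ?n xs)" unfolding xs_def by simp
    also have "\<dots> = ?D" unfolding tk using TD by auto
    finally show ?thesis .
  qed
  have L: "xs \<in> LE ?D" unfolding LE_def using dist set pre by simp
  have "T = tableau xs"
  proof
    fix b
    show "T b = tableau xs b"
    proof (cases "b \<in> ?D")
      case False
      then show ?thesis using zero tableau_outside set by simp
    next
      case True
      then obtain i where i: "i < length xs" "xs ! i = b" using set by (metis in_set_conv_nth)
      then have "b = f (Suc i)" "Suc i \<in> {1..?n}" unfolding xs_def by auto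
      then have "T b = Suc i" using Tf by simp
      then show ?thesis using tableau_nth[OF dist i(1)] i(2) by simp
    qed
  qed
  then show ?thesis using L by blast
qed

section \<open>Groups containing all 3-cycles\<close>

lemma compose_restrict_permutes:
  assumes "q permutes E"
  shows "compose E (restrict p E) (restrict q E) = restrict (p \<circ> q) E"
  unfolding compose_def using permutes_in_image[OF assms] by (intro restrict_ext) simp

text \<open>The 3-cycles produce all products of two transpositions and so the alternating group; a
  single odd element then gives everything.\<close>

lemma all_cyc_imp_Alt_or_full:
  fixes E :: "'a set"
  assumes fin: "finite E" and sub: "subgroup \<Gamma> (BijGroup E)"
    and cyc: "\<And>x y z. x \<in> E \<Longrightarrow> y \<in> E \<Longrightarrow> z \<in> E \<Longrightarrow> x \<noteq> y \<Longrightarrow> y \<noteq> z \<Longrightarrow> x \<noteq> z \<Longrightarrow> \<exists>f\<in>\<Gamma>. cyc f E x y z"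
  shows "\<Gamma> = carrier (BijGroup E) \<or> \<Gamma> = Alt E"
proof -
  let ?\<tau> = "Transposition.transpose :: 'a \<Rightarrow> 'a \<Rightarrow> 'a \<Rightarrow> 'a"
  have carr: "carrier (BijGroup E) = Bij E" by (simp add: BijGroup_def)
  have sB: "\<Gamma> \<subseteq> Bij E" using subgroup.subset[OF sub] carr by simp
  have mult: "f \<otimes>\<^bsub>BijGroup E\<^esub> g = compose E f g" if "f \<in> Bij E" "g \<in> Bij E" for f g
    using that by (simp add: BijGroup_def)
  have comp: "compose E f g \<in> \<Gamma>" if "f \<in> \<Gamma>" "g \<in> \<Gamma>" for f g
  proof -
    have "f \<in> Bij E" "g \<in> Bij E" using that sB by blast+
    then show ?thesis using subgroup.m_closed[OF sub that] by (simp only: mult)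
  qed
  have one: "restrict id E \<in> \<Gamma>"
    using subgroup.one_closed[OF sub] by (simp add: BijGroup_def id_def)
  have perm\<tau>: "?\<tau> a b permutes E" if "a \<in> E" "b \<in> E" for a b using that by (rule permutes_swap_id)
  have comp': "restrict (p \<circ> q) E \<in> \<Gamma>" if "restrict p E \<in> \<Gamma>" "restrict q E \<in> \<Gamma>" "q permutes E" for p q
    using comp[OF that(1,2)] by (simp only: compose_restrict_permutes[OF that(3)])
  have adj: "restrict (?\<tau> a d \<circ> ?\<tau> a b) E \<in> \<Gamma>" if m: "a \<in> E" "b \<in> E" "d \<in> E" "a \<noteq> b" "a \<noteq> d" for a b d
  proof (cases "b = d")
    case True
    then have "?\<tau> a d \<circ> ?\<tau> a b = id" by simp
    then show ?thesis using one by (simp only:)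
  next
    case False
    obtain f where f: "f \<in> \<Gamma>" "cyc f E a b d" using cyc[of a b d] m False by blast
    have "restrict (?\<tau> a d \<circ> ?\<tau> a b) E = f"
    proof (rule extensionalityI[of _ E])
      show "f \<in> extensional E" using f(1) sB by (auto simp: Bij_def)
      fix x assume x: "x \<in> E"
      have "(?\<tau> a d \<circ> ?\<tau> a b) x = f x"
      proof (cases "x = a \<or> x = b \<or> x = d")
        case True
        then show ?thesis using cyc_points(4-9)[OF f(2)] by (auto simp: Transposition.transpose_def)
      next
        case False
        then show ?thesis using cyc_fixes[OF f(2) x] by (simp add: Transposition.transpose_def)
      qed
      then show "restrict (?\<tau> a d \<circ> ?\<tau> a b) E x = f x" using x by (simp only: restrict_apply if_True)
    qed simp
    then show ?thesis using f(1) by (simp only:)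
  qed
  have two: "restrict (?\<tau> c d \<circ> ?\<tau> a b) E \<in> \<Gamma>"
    if m: "a \<in> E" "b \<in> E" "c \<in> E" "d \<in> E" "a \<noteq> b" "c \<noteq> d" for a b c d
  proof (cases "a = c")
    case True
    then show ?thesis using adj[of a b d] m by simp
  next
    case False
    \<comment> \<open>Inserting the transposition of \<open>a\<close> and \<open>c\<close> twice
      splits the product into two factors covered by \<open>adj\<close>.\<close>
    have 1: "restrict (?\<tau> c d \<circ> ?\<tau> c a) E \<in> \<Gamma>" using adj[of c a d] m False by simp
    have 2: "restrict (?\<tau> a c \<circ> ?\<tau> a b) E \<in> \<Gamma>" using adj[of a b c] m False by simp
    have "(?\<tau> c d \<circ> ?\<tau> c a) \<circ> (?\<tau> a c \<circ> ?\<tau> a b) = ?\<tau> c d \<circ> (?\<tau> c a \<circ> ?\<tau> a c) \<circ> ?\<tau> a b"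
      by (simp only: comp_assoc)
    also have "?\<tau> c a \<circ> ?\<tau> a c = id" by (simp add: transpose_commute)
    finally have "(?\<tau> c d \<circ> ?\<tau> c a) \<circ> (?\<tau> a c \<circ> ?\<tau> a b) = ?\<tau> c d \<circ> ?\<tau> a b" by (simp only: comp_id)
    moreover have "?\<tau> a c \<circ> ?\<tau> a b permutes E"
      by (rule permutes_compose[OF perm\<tau> perm\<tau>]) (use m in simp_all)
    ultimately show ?thesis using comp'[OF 1 2] by (simp only:)
  qed
  \<comment> \<open>The induction adds one transposition at a time, so odd permutations are carried
    along in the form that becomes even after one more transposition.\<close>
  have even: "(evenperm p \<longrightarrow> restrict p E \<in> \<Gamma>) \<and>
      (\<not> evenperm p \<longrightarrow> (\<forall>a\<in>E. \<forall>b\<in>E. a \<noteq> b \<longrightarrow> restrict (?\<tau> a b \<circ> p) E \<in> \<Gamma>))" if "p permutes E" for p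
    using that fin
  proof (induction rule: permutes_induct)
    case id
    then show ?case using one evenperm_id by blast
  next
    case (swap a b p)
    have pE: "p permutes E" and ab: "a \<in> E" "b \<in> E" "a \<noteq> b" using swap by blast+
    have pp: "permutation p" by (rule permutes_imp_permutation[OF fin pE])
    have ev: "evenperm (?\<tau> a b \<circ> p) \<longleftrightarrow> \<not> evenperm p"
      using evenperm_comp[OF permutation_swap_id pp, of a b] ab(3) by (simp only: evenperm_swap simp_thms)
    show ?case
    proof (cases "evenperm p")
      case True
      then have p: "restrict p E \<in> \<Gamma>" using swap by blast
      have "restrict (?\<tau> c d \<circ> (?\<tau> a b \<circ> p)) E \<in> \<Gamma>" if "c \<in> E" "d \<in> E" "c \<noteq> d" for c d
        using comp'[OF two[OF ab(1,2) that(1,2) ab(3) that(3)] p pE] by (simp only: comp_assoc)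
      then show ?thesis using ev True by blast
    next
      case False
      then show ?thesis using ev swap ab by blast
    qed
  qed
  define ext where "ext f = (\<lambda>x. if x \<in> E then f x else x)" for f :: "'a \<Rightarrow> 'a"
  have ext: "ext f permutes E" "restrict (ext f) E = f" if "f \<in> Bij E" for f
  proof -
    have b: "bij_betw f E E" "f \<in> extensional E" using that by (auto simp: Bij_def)
    have "bij_betw (ext f) E E" using b(1) by (subst bij_betw_cong[of E _ f]) (simp_all add: ext_def)
    then show "ext f permutes E" by (rule bij_imp_permutes) (simp add: ext_def)
    show "restrict (ext f) E = f"
      by (rule extensionalityI[OF restrict_extensional b(2)]) (simp add: ext_def)
  qed
  have AltE: "Alt E = {f \<in> Bij E. evenperm (ext f)}" by (simp add: Alt_def ext_def)
  have sub1: "Alt E \<subseteq> \<Gamma>"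
  proof
    fix f assume f: "f \<in> Alt E"
    then have "f \<in> Bij E" "evenperm (ext f)" unfolding AltE by auto
    then show "f \<in> \<Gamma>" using even[OF ext(1)] ext(2) by metis
  qed
  show ?thesis
  proof (cases "\<Gamma> \<subseteq> Alt E")
    case True
    then show ?thesis using sub1 by blast
  next
    case False
    then obtain f where f: "f \<in> \<Gamma>" "f \<notin> Alt E" by blast
    have fB: "f \<in> Bij E" and fo: "\<not> evenperm (ext f)" using f sB unfolding AltE by auto
    interpret B: group "BijGroup E" by (rule group_BijGroup)
    have "g \<in> \<Gamma>" if g: "g \<in> Bij E" for g
    proof (cases "evenperm (ext g)")
      case True
      then show ?thesis using g sub1 unfolding AltE by auto
    next
      case False
      have pf: "ext f permutes E" "ext g permutes E" using ext(1) fB g by auto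
      have "evenperm (ext g \<circ> ext f)"
        using evenperm_comp[of "ext g" "ext f"] permutes_imp_permutation[OF fin] pf False fo by blast
      then have "restrict (ext g \<circ> ext f) E \<in> \<Gamma>" using even[OF permutes_compose[OF pf]] by blast
      moreover have "restrict (ext g \<circ> ext f) E = g \<otimes>\<^bsub>BijGroup E\<^esub> f"
        using compose_restrict_permutes[OF pf(1), of "ext g"] ext(2)[OF fB] ext(2)[OF g] mult[OF g fB] by simp
      ultimately have "g \<otimes>\<^bsub>BijGroup E\<^esub> f \<otimes>\<^bsub>BijGroup E\<^esub> (inv\<^bsub>BijGroup E\<^esub> f) \<in> \<Gamma>"
        using subgroup.m_closed[OF sub] subgroup.m_inv_closed[OF sub f(1)] by simp
      moreover have gc: "g \<in> carrier (BijGroup E)" and fc: "f \<in> carrier (BijGroup E)" using g fB carr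
        by simp_all
      then have "g \<otimes>\<^bsub>BijGroup E\<^esub> f \<otimes>\<^bsub>BijGroup E\<^esub> (inv\<^bsub>BijGroup E\<^esub> f) = g"
        using B.m_assoc[OF gc fc B.inv_closed[OF fc]] B.r_inv[OF fc] B.r_one[OF gc] by metis
      ultimately show ?thesis by (simp only:)
    qed
    then show ?thesis using sB carr by blast
  qed
qed

section \<open>The action of the cactus group\<close>

text \<open>The generators s_[1,j] act as \<open>evacuate j\<close>. The quotient of two consecutive
  evacuations is \<open>promote 0 j\<close>, and that of two consecutive promotions is
  \<open>bk i\<close>.\<close>

lemma action_contains_bk_group:
  assumes p: "partition_of n lam" and act: "schuetzenberger_action n lam \<phi>" and g: "g \<in> G n"
  shows "\<exists>\<gamma>\<in>carrier (cactus_group n). \<forall>xs\<in>LE (diagram lam). \<phi> \<gamma> (tableau xs) = tableau (g xs)"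
proof -
  let ?C = "cactus_group n" and ?D = "diagram lam"
  have cD: "card ?D = n" using card_diagram p by (simp add: partition_of_def)
  interpret group_action ?C "SYT lam" \<phi> using act by (simp add: schuetzenberger_action_def)
  interpret C: group ?C unfolding cactus_group_def by (rule group_presented_group)
  define real where "real g \<longleftrightarrow> (\<exists>\<gamma>\<in>carrier ?C. \<forall>xs\<in>LE ?D. \<phi> \<gamma> (tableau xs) = tableau (g xs))"
    for g :: "box list \<Rightarrow> box list"
  have comp: "real (g \<circ> h)" if "real g" "real h" "h \<in> G m" for g h m
  proof -
    obtain \<gamma> \<eta> where \<gamma>: "\<gamma> \<in> carrier ?C" "\<forall>xs\<in>LE ?D. \<phi> \<gamma> (tableau xs) = tableau (g xs)"
      and \<eta>: "\<eta> \<in> carrier ?C" "\<forall>xs\<in>LE ?D. \<phi> \<eta> (tableau xs) = tableau (h xs)"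
      using \<open>real g\<close> \<open>real h\<close> unfolding real_def by blast
    have "\<phi> (\<gamma> \<otimes>\<^bsub>?C\<^esub> \<eta>) (tableau xs) = tableau ((g \<circ> h) xs)" if "xs \<in> LE ?D" for xs
      using composition_rule[OF tableau_mem_SYT[OF that] \<gamma>(1) \<eta>(1)] \<gamma>(2) \<eta>(2) that G_LE[OF \<open>h \<in> G m\<close> that] by simp
    then show ?thesis unfolding real_def using C.m_closed[OF \<gamma>(1) \<eta>(1)] by blast
  qed
  have inv: "real (finv g)" if "real g" "g \<in> G m" for g m
  proof -
    obtain \<gamma> where \<gamma>: "\<gamma> \<in> carrier ?C" "\<forall>xs\<in>LE ?D. \<phi> \<gamma> (tableau xs) = tableau (g xs)"
      using \<open>real g\<close> unfolding real_def by blast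
    have "\<phi> (inv\<^bsub>?C\<^esub> \<gamma>) (tableau xs) = tableau (finv g xs)" if xs: "xs \<in> LE ?D" for xs
    proof -
      have L: "finv g xs \<in> LE ?D" using G_LE[OF G_inv[OF \<open>g \<in> G m\<close>] xs] .
      have "\<phi> \<gamma> (tableau (finv g xs)) = tableau xs" using \<gamma>(2) L \<open>g \<in> G m\<close> by simp
      then show ?thesis using orbit_sym_aux[OF \<gamma>(1) tableau_mem_SYT[OF L]] by blast
    qed
    then show ?thesis unfolding real_def using C.inv_closed[OF \<gamma>(1)] by blast
  qed
  have one: "real id"
  proof -
    have "\<phi> \<one>\<^bsub>?C\<^esub> (tableau xs) = tableau (id xs)" if "xs \<in> LE ?D" for xs
      using fun_cong[OF id_eq_one, of "tableau xs"] tableau_mem_SYT[OF that] by simp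
    then show ?thesis unfolding real_def using C.one_closed by blast
  qed
  have evacuate: "real (evacuate j)" if j: "j \<le> n" for j
  proof (cases "j \<ge> 2")
    case False
    \<comment> \<open>No generator belongs to these \<open>j\<close>, but the evacuation is the
      identity.\<close>
    then have "j = 0 \<or> j = Suc 0" by auto
    then have "evacuate j = id" by (auto simp: fun_eq_iff)
    then show ?thesis using one by (simp only:)
  next
    case True
    have "(1, j) \<in> intervals n" using True j by (simp add: intervals_def)
    then have "[sletter 1 j] \<in> gwords (intervals n)" by (simp add: gwords_def)
    then have "cactus_gen n 1 j \<in> carrier ?C"
      unfolding cactus_gen_def cactus_group_def presented_group_def by (simp add: quotientI)
    moreover have "\<phi> (cactus_gen n 1 j) (tableau xs) = tableau (evacuate j xs)" if "xs \<in> LE ?D" for xs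
      using act tableau_mem_SYT[OF that] evac_upto_tableau[OF that, of j] True j cD
      by (simp add: schuetzenberger_action_def)
    ultimately show ?thesis unfolding real_def by blast
  qed
  have promote: "real (promote 0 j)" if j: "Suc j \<le> n" for j
  proof -
    have "finv (evacuate j) \<circ> evacuate (Suc j) = promote 0 j" using evacuate_mem[of j]
      by (simp add: fun_eq_iff)
    moreover have "real (finv (evacuate j) \<circ> evacuate (Suc j))"
      by (rule comp[OF inv[OF evacuate[of j] evacuate_mem] evacuate[of "Suc j"] evacuate_mem]) (use j in simp_all)
    ultimately show ?thesis by (simp only:)
  qed
  have bk: "real (bk i)" if i: "Suc i < n" for i
  proof -
    have m: "promote 0 i \<in> G (Suc i)" by (rule promote_mem) simp
    have "promote 0 (Suc i) \<circ> finv (promote 0 i) = bk i"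
      unfolding promote_Suc using m by (simp add: fun_eq_iff)
    moreover have "real (promote 0 (Suc i) \<circ> finv (promote 0 i))"
      by (rule comp[OF promote[of "Suc i"] inv[OF promote[of i] m] G_inv[OF m]]) (use i in simp_all)
    ultimately show ?thesis by (simp only:)
  qed
  have "real g" using g
  proof (induction rule: G.induct)
    case G_id
    then show ?case by (rule one)
  next
    case (G_step g i)
    then show ?case using comp[OF bk G_step(3) G_step(1)] by blast
  qed
  then show ?thesis unfolding real_def .
qed

theorem theoremB:
  fixes n :: nat and lam :: "nat list"
    and \<phi> :: "(nat \<times> nat) gword set \<Rightarrow> filling \<Rightarrow> filling"
  assumes "partition_of n lam"
    and "\<not> hook_shaped lam"
    and "\<not> self_transpose lam"
    and "schuetzenberger_action n lam \<phi>"
  shows "\<phi> ` carrier (cactus_group n) = carrier (BijGroup (SYT lam)) \<or>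
         \<phi> ` carrier (cactus_group n) = Alt (SYT lam)"
proof (rule all_cyc_imp_Alt_or_full)
  let ?D = "diagram lam" and ?C = "cactus_group n"
  have yD: "young ?D" using young_diagram[OF assms(1)] .
  have cD: "card ?D = n" using card_diagram assms(1) by (simp add: partition_of_def)
  have good: "good ?D"
    using yD assms(2,3) by (simp add: good_def hook_shaped_def self_transpose_def)
  have "card ?D \<ge> 5"
  proof (rule ccontr)
    assume "\<not> ?thesis"
    \<comment> \<open>With fewer than five boxes the diagram would be the square, which is
      self-transpose.\<close>
    moreover have sq: "square \<subseteq> ?D" using good by (intro square_subset) (auto simp: good_def)
    ultimately have "square = ?D"
      using card_seteq[OF young_finite[OF yD] sq] by simp
    then have "tr ?D = ?D" by (auto simp flip: \<open>square = ?D\<close>)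
    then show False using good by (simp add: good_def)
  qed
  then have loc: "loc ?D" using good_imp_loc[OF good] by blast
  have SYT: "SYT lam = tableau ` LE ?D"
    using SYT_imp_tableau[OF assms(1)] tableau_mem_SYT by blast
  show "finite (SYT lam)" unfolding SYT using finite_LE by simp
  interpret group_action ?C "SYT lam" \<phi> using assms(4) by (simp add: schuetzenberger_action_def)
  show "subgroup (\<phi> ` carrier ?C) (BijGroup (SYT lam))"
    using group_hom.img_is_subgroup[OF group_hom] .
  fix x y z assume xyz: "x \<in> SYT lam" "y \<in> SYT lam" "z \<in> SYT lam" "x \<noteq> y" "y \<noteq> z" "x \<noteq> z"
  then obtain a b c where abc: "a \<in> LE ?D" "b \<in> LE ?D" "c \<in> LE ?D" "x = tableau a" "y = tableau b" "z = tableau c"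
    unfolding SYT by blast
  then obtain g where g: "g \<in> G n" "cyc g (LE ?D) a b c"
    using loc xyz(4-6) unfolding loc_def cD by metis
  obtain \<gamma> where \<gamma>: "\<gamma> \<in> carrier ?C" "\<forall>xs\<in>LE ?D. \<phi> \<gamma> (tableau xs) = tableau (g xs)"
    using action_contains_bk_group[OF assms(1,4) g(1)] by blast
  note p = cyc_points[OF g(2)]
  have "\<phi> \<gamma> v = v" if v: "v \<in> SYT lam" "v \<noteq> x" "v \<noteq> y" "v \<noteq> z" for v
  proof -
    obtain w where w: "w \<in> LE ?D" "v = tableau w" using v(1) unfolding SYT by blast
    then have "g w = w" using cyc_fixes[OF g(2) w(1)] v(2-4) abc(4-6) by blast
    then show ?thesis using \<gamma>(2) w by simp
  qed
  then have "cyc (\<phi> \<gamma>) (SYT lam) x y z"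
    unfolding cyc_def using xyz \<gamma>(2) abc p by simp
  then show "\<exists>f\<in>\<phi> ` carrier ?C. cyc f (SYT lam) x y z" using \<gamma>(1) by blast
qed

end
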